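(* Let $\mathcal G$ be a discrete groupoid (a small category all of whose morphisms are invertible), let $(\mathcal G_i)_{i\in I}$ be its connected components, for each $i\in I$ choose an object $x_i\in\mathcal G_i^0$ and let $G_i$ be the group of loops $l$ with $s(l)=t(l)=x_i$. If $B$ denotes the groupoid algebra of $\mathcal G$ over a field $\mathbb K$ of characteristic zero, then $$\mathrm{HC}_\ast(B)\cong\bigoplus_{i\in I}\mathrm{HC}_\ast(\mathbb KG_i).$$ In addition, if $\mathcal G_i^0$ is a finite set for every $i\in I$, then a similar isomorphism holds in Hochschild homology: $\mathrm{HH}_\ast(B)\cong\bigoplus_{i\in I}\mathrm{HH}_\ast(\mathbb KG_i)$.
   Context: For a groupoid $\mathcal G$, $\mathcal G^0$ and $\mathcal G^1$ are its sets of objects and morphisms, $s,t$ source and target; the groupoid algebra $B=\mathbb K\mathcal G^1$ has basis $\mathcal G^1$ and product $gg'=g\circ g'$ if $s(g)=t(g')$ and $0$ otherwise; it is not unital if $\mathcal G^0$ is infinite. Cyclic homology $\mathrm{HC}_\ast(B)$ of a possibly non-unital algebra is the homology of Connes' complex $C^\lambda_\ast(B)$: $C^\lambda_n(B)$ is the quotient of $B^{\otimes_{\mathbb K}\,n+1}$ by the image of $1-\tau_n$, where $\tau_n(b_0\otimes\dots\otimes b_n)=(-1)^nb_n\otimes b_0\otimes\dots\otimes b_{n-1}$, with differential induced by the Hochschild boundary $\sum_{k=0}^n(-1)^kd_k$, where $d_k$ multiplies $b_k$ and $b_{k+1}$ for $k<n$ and $d_n(b_0\otimes\dots\otimes b_n)=b_nb_0\otimes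 b_1\otimes\dots\otimes b_{n-1}$. For a unital algebra, $\mathrm{HH}_\ast$ is ordinary Hochschild homology (with coefficients in the algebra itself); for a non-unital $\mathbb K$-algebra $A$ it is defined as in Loday's book "Cyclic Homology", Chapter 1, i.e. $\mathrm{HH}_n(A)=\mathrm{coker}(\mathrm{HH}_n(\mathbb K)\to\mathrm{HH}_n(A_+))$, with $A_+=\mathbb K\oplus A$ the algebra obtained by adjoining a unit. *)

theory Defs
  imports Complex_Main "HOL-Algebra.AbelCoset" "HOL-Algebra.Module" "HOL-Library.Poly_Mapping"
begin

section \<open>Vector spaces\<close>

text \<open>
  The ground field is a type \<open>'k\<close> of class \<^class>\<open>field\<close>. A vector space over it is a
  \<^type>\<open>module\<close> record with scalars from all of \<open>'k\<close>; its fields \<open>mult\<close> and \<open>one\<close> carry no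
  information. For a possibly non-unital algebra, \<open>mult\<close> is the product, and \<open>one\<close> is still
  not used by any definition below.
\<close>

definition vs_iso :: "('k::field, 'v) module \<Rightarrow> ('k, 'w) module \<Rightarrow> bool" (infix \<open>\<cong>\<^sub>v\<close> 50) where
  "M \<cong>\<^sub>v N \<longleftrightarrow> (\<exists>f \<in> iso (add_monoid M) (add_monoid N).
     \<forall>c. \<forall>x \<in> carrier M. f (c \<odot>\<^bsub>M\<^esub> x) = c \<odot>\<^bsub>N\<^esub> f x)"

definition quot_space :: "('k::field, 'v) module \<Rightarrow> 'v set \<Rightarrow> ('k, 'v set) module" where
  "quot_space M N = \<lparr>carrier = a_rcosets\<^bsub>M\<^esub> N, mult = undefined, one = undefined,
     zero = N, add = set_add M, smult = (\<lambda>c X. set_add M N ((\<lambda>x. c \<odot>\<^bsub>M\<^esub> x) ` X))\<rparr>"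

definition direct_sum :: "'i set \<Rightarrow> ('i \<Rightarrow> ('k::field, 'v) module) \<Rightarrow> ('k, 'i \<Rightarrow> 'v) module" where
  "direct_sum I M =
     \<lparr>carrier = {f \<in> \<Pi>\<^sub>E i\<in>I. carrier (M i). finite {i \<in> I. f i \<noteq> \<zero>\<^bsub>M i\<^esub>}},
      mult = undefined, one = undefined, zero = (\<lambda>i\<in>I. \<zero>\<^bsub>M i\<^esub>),
      add = (\<lambda>f g. \<lambda>i\<in>I. f i \<oplus>\<^bsub>M i\<^esub> g i), smult = (\<lambda>c f. \<lambda>i\<in>I. c \<odot>\<^bsub>M i\<^esub> f i)\<rparr>"

abbreviation pm_scale :: "'k::field \<Rightarrow> ('a \<Rightarrow>\<^sub>0 'k) \<Rightarrow> ('a \<Rightarrow>\<^sub>0 'k)" where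
  "pm_scale c \<equiv> Poly_Mapping.map ((*) c)"

definition free_space :: "'a set \<Rightarrow> ('k::field, 'a \<Rightarrow>\<^sub>0 'k) module" where
  "free_space S = \<lparr>carrier = {f. Poly_Mapping.keys f \<subseteq> S}, mult = undefined, one = undefined,
     zero = 0, add = (+), smult = pm_scale\<rparr>"

definition lin_ext :: "('k::field, 'v) module \<Rightarrow> ('a \<Rightarrow> 'v) \<Rightarrow> ('a \<Rightarrow>\<^sub>0 'k) \<Rightarrow> 'v" where
  "lin_ext M \<phi> f = (\<Oplus>\<^bsub>M\<^esub>x\<in>Poly_Mapping.keys f. Poly_Mapping.lookup f x \<odot>\<^bsub>M\<^esub> \<phi> x)"


section \<open>Homology of a complex of vector spaces\<close>

text \<open>A complex is given by \<open>C n\<close> for \<open>n \<ge> 0\<close> and differentials \<open>d n\<close> from \<open>C (Suc n)\<close> to \<open>C n\<close>.\<close>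

definition cycles :: "(nat \<Rightarrow> ('k::field, 'v) module) \<Rightarrow> (nat \<Rightarrow> 'v \<Rightarrow> 'v) \<Rightarrow> nat \<Rightarrow> 'v set" where
  "cycles C d n = {z \<in> carrier (C n). case n of 0 \<Rightarrow> True | Suc m \<Rightarrow> d m z = \<zero>\<^bsub>C m\<^esub>}"

definition boundaries :: "(nat \<Rightarrow> ('k::field, 'v) module) \<Rightarrow> (nat \<Rightarrow> 'v \<Rightarrow> 'v) \<Rightarrow> nat \<Rightarrow> 'v set" where
  "boundaries C d n = d n ` carrier (C (Suc n))"

definition homology ::
    "(nat \<Rightarrow> ('k::field, 'v) module) \<Rightarrow> (nat \<Rightarrow> 'v \<Rightarrow> 'v) \<Rightarrow> nat \<Rightarrow> ('k, 'v set) module" where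
  "homology C d n = quot_space ((C n)\<lparr>carrier := cycles C d n\<rparr>) (boundaries C d n)"

text \<open>The map into the homology of \<open>(C, d)\<close> induced by a chain map \<open>h\<close>; \<open>X\<close> is a homology class of
  the source complex.\<close>

definition homology_map ::
    "(nat \<Rightarrow> ('k::field, 'w) module) \<Rightarrow> (nat \<Rightarrow> 'w \<Rightarrow> 'w) \<Rightarrow> (nat \<Rightarrow> 'v \<Rightarrow> 'w) \<Rightarrow> nat \<Rightarrow> 'v set \<Rightarrow> 'w set" where
  "homology_map C d h n X = the_elem ((\<lambda>z. boundaries C d n +>\<^bsub>C n\<^esub> h n z) ` X)"


section \<open>Tensor powers\<close>

text \<open>The tensor power of exponent \<open>n + 1\<close> of \<open>A\<close> over the ground field, as the quotient of the vector
  space with basis the \<open>n + 1\<close>-tuples by the relations of multilinearity.\<close>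

definition tuples :: "('k::field, 'a) module \<Rightarrow> nat \<Rightarrow> 'a list set" where
  "tuples A n = {bs. length bs = Suc n \<and> set bs \<subseteq> carrier A}"

definition multilin_gens :: "('k::field, 'a) module \<Rightarrow> nat \<Rightarrow> ('a list \<Rightarrow>\<^sub>0 'k) set" where
  "multilin_gens A n =
     {Poly_Mapping.single (u @ (a \<oplus>\<^bsub>A\<^esub> b) # v) 1 - Poly_Mapping.single (u @ a # v) 1
        - Poly_Mapping.single (u @ b # v) 1
       | u v a b. u @ a # v \<in> tuples A n \<and> b \<in> carrier A} \<union>
     {Poly_Mapping.single (u @ (c \<odot>\<^bsub>A\<^esub> a) # v) 1 - Poly_Mapping.single (u @ a # v) c
       | u v a c. u @ a # v \<in> tuples A n}"

definition multilin_rels :: "('k::field, 'a) module \<Rightarrow> nat \<Rightarrow> ('a list \<Rightarrow>\<^sub>0 'k) set" where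
  "multilin_rels A n = Modules.module.span pm_scale (multilin_gens A n)"

definition tensor_power :: "('k::field, 'a) module \<Rightarrow> nat \<Rightarrow> ('k, ('a list \<Rightarrow>\<^sub>0 'k) set) module" where
  "tensor_power A n = quot_space (free_space (tuples A n)) (multilin_rels A n)"

definition pure_tensor :: "('k::field, 'a) module \<Rightarrow> nat \<Rightarrow> 'a list \<Rightarrow> ('a list \<Rightarrow>\<^sub>0 'k) set" where
  "pure_tensor A n bs =
     multilin_rels A n +>\<^bsub>(free_space (tuples A n) :: ('k, 'a list \<Rightarrow>\<^sub>0 'k) module)\<^esub>
       Poly_Mapping.single bs 1"

text \<open>The linear map from a tensor power to \<open>M\<close> that sends the pure tensor of \<open>bs\<close> to \<open>\<phi> bs\<close>,
  for \<open>\<phi>\<close> multilinear.\<close>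

definition tensor_ext ::
    "('k::field, 'v) module \<Rightarrow> ('a list \<Rightarrow> 'v) \<Rightarrow> ('a list \<Rightarrow>\<^sub>0 'k) set \<Rightarrow> 'v" where
  "tensor_ext M \<phi> X = the_elem (lin_ext M \<phi> ` X)"


section \<open>Hochschild and cyclic homology\<close>

text \<open>On a tuple of length \<open>n + 1\<close>, \<open>face A k\<close> is the \<open>k\<close>-th face for \<open>k < n\<close>, and
  \<open>face A n\<close> is the cyclic one.\<close>

definition face :: "('k::field, 'a) module \<Rightarrow> nat \<Rightarrow> 'a list \<Rightarrow> 'a list" where
  "face A k bs =
     (if Suc k < length bs then take k bs @ (bs ! k \<otimes>\<^bsub>A\<^esub> bs ! Suc k) # drop (k + 2) bs
      else (last bs \<otimes>\<^bsub>A\<^esub> hd bs) # butlast (tl bs))"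

definition hochschild_boundary ::
    "('k::field, 'a) module \<Rightarrow> nat \<Rightarrow> ('a list \<Rightarrow>\<^sub>0 'k) set \<Rightarrow> ('a list \<Rightarrow>\<^sub>0 'k) set" where
  "hochschild_boundary A n = tensor_ext (tensor_power A n)
     (\<lambda>bs. \<Oplus>\<^bsub>tensor_power A n\<^esub>k\<in>{..Suc n}.
        (-1) ^ k \<odot>\<^bsub>tensor_power A n\<^esub> pure_tensor A n (face A k bs))"

definition cyclic_op ::
    "('k::field, 'a) module \<Rightarrow> nat \<Rightarrow> ('a list \<Rightarrow>\<^sub>0 'k) set \<Rightarrow> ('a list \<Rightarrow>\<^sub>0 'k) set" where
  "cyclic_op A n = tensor_ext (tensor_power A n)
     (\<lambda>bs. (-1) ^ n \<odot>\<^bsub>tensor_power A n\<^esub> pure_tensor A n (last bs # butlast bs))"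

definition cyclic_image :: "('k::field, 'a) module \<Rightarrow> nat \<Rightarrow> ('a list \<Rightarrow>\<^sub>0 'k) set set" where
  "cyclic_image A n =
     {x \<ominus>\<^bsub>tensor_power A n\<^esub> cyclic_op A n x | x. x \<in> carrier (tensor_power A n)}"

definition connes_space ::
    "('k::field, 'a) module \<Rightarrow> nat \<Rightarrow> ('k, ('a list \<Rightarrow>\<^sub>0 'k) set set) module" where
  "connes_space A n = quot_space (tensor_power A n) (cyclic_image A n)"

definition connes_boundary ::
    "('k::field, 'a) module \<Rightarrow> nat \<Rightarrow> ('a list \<Rightarrow>\<^sub>0 'k) set set \<Rightarrow> ('a list \<Rightarrow>\<^sub>0 'k) set set" where
  "connes_boundary A n X =
     the_elem ((\<lambda>x. cyclic_image A n +>\<^bsub>tensor_power A n\<^esub> hochschild_boundary A n x) ` X)"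

definition HC :: "('k::field, 'a) module \<Rightarrow> nat \<Rightarrow> ('k, ('a list \<Rightarrow>\<^sub>0 'k) set set set) module" where
  "HC A = homology (connes_space A) (connes_boundary A)"

definition HH :: "('k::field, 'a) module \<Rightarrow> nat \<Rightarrow> ('k, ('a list \<Rightarrow>\<^sub>0 'k) set set) module" where
  "HH A = homology (tensor_power A) (hochschild_boundary A)"

definition unital :: "('k::field, 'a) module \<Rightarrow> bool" where
  "unital A \<longleftrightarrow> (\<exists>e \<in> carrier A. \<forall>a \<in> carrier A. e \<otimes>\<^bsub>A\<^esub> a = a \<and> a \<otimes>\<^bsub>A\<^esub> e = a)"

definition ground_algebra :: "('k::field, 'k) module" where
  "ground_algebra = \<lparr>carrier = UNIV, mult = (*), one = 1, zero = 0, add = (+), smult = (*)\<rparr>"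

definition unitization :: "('k::field, 'a) module \<Rightarrow> ('k, 'k \<times> 'a) module" where
  "unitization A = \<lparr>carrier = UNIV \<times> carrier A,
     mult = (\<lambda>(c, a) (d, b). (c * d, c \<odot>\<^bsub>A\<^esub> b \<oplus>\<^bsub>A\<^esub> d \<odot>\<^bsub>A\<^esub> a \<oplus>\<^bsub>A\<^esub> a \<otimes>\<^bsub>A\<^esub> b)),
     one = (1, \<zero>\<^bsub>A\<^esub>), zero = (0, \<zero>\<^bsub>A\<^esub>),
     add = (\<lambda>(c, a) (d, b). (c + d, a \<oplus>\<^bsub>A\<^esub> b)),
     smult = (\<lambda>c (d, b). (c * d, c \<odot>\<^bsub>A\<^esub> b))\<rparr>"

definition unit_inclusion ::
    "('k::field, 'a) module \<Rightarrow> nat \<Rightarrow> ('k list \<Rightarrow>\<^sub>0 'k) set \<Rightarrow> (('k \<times> 'a) list \<Rightarrow>\<^sub>0 'k) set" where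
  "unit_inclusion A n = tensor_ext (tensor_power (unitization A) n)
     (\<lambda>cs. pure_tensor (unitization A) n (map (\<lambda>c. (c, \<zero>\<^bsub>A\<^esub>)) cs))"

text \<open>Hochschild homology of a non-unital algebra, following Loday: the cokernel of the map from the
  homology of the ground field to that of the unitization.\<close>

definition HH_nonunital ::
    "('k::field, 'a) module \<Rightarrow> nat \<Rightarrow> ('k, (('k \<times> 'a) list \<Rightarrow>\<^sub>0 'k) set set set) module" where
  "HH_nonunital A n = quot_space (HH (unitization A) n)
     (homology_map (tensor_power (unitization A)) (hochschild_boundary (unitization A))
        (unit_inclusion A) n ` carrier (HH (ground_algebra :: ('k, 'k) module) n))"


section \<open>Groupoids and their algebras\<close>

record ('o, 'm) groupoid =
  Obj :: "'o set"
  Mor :: "'m set"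
  src :: "'m \<Rightarrow> 'o"
  tgt :: "'m \<Rightarrow> 'o"
  ident :: "'o \<Rightarrow> 'm"
  mcomp :: "'m \<Rightarrow> 'm \<Rightarrow> 'm"

text \<open>\<open>mcomp G g h\<close> is \<open>g\<close> after \<open>h\<close>, meaningful when the source of \<open>g\<close> is the target of \<open>h\<close>.\<close>

locale groupoid =
  fixes G :: "('o, 'm) groupoid"
  assumes src_closed: "g \<in> Mor G \<Longrightarrow> src G g \<in> Obj G"
    and tgt_closed: "g \<in> Mor G \<Longrightarrow> tgt G g \<in> Obj G"
    and ident_closed: "x \<in> Obj G \<Longrightarrow> ident G x \<in> Mor G"
    and src_ident: "x \<in> Obj G \<Longrightarrow> src G (ident G x) = x"
    and tgt_ident: "x \<in> Obj G \<Longrightarrow> tgt G (ident G x) = x"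
    and comp_closed: "\<lbrakk>g \<in> Mor G; h \<in> Mor G; src G g = tgt G h\<rbrakk> \<Longrightarrow> mcomp G g h \<in> Mor G"
    and src_comp: "\<lbrakk>g \<in> Mor G; h \<in> Mor G; src G g = tgt G h\<rbrakk> \<Longrightarrow> src G (mcomp G g h) = src G h"
    and tgt_comp: "\<lbrakk>g \<in> Mor G; h \<in> Mor G; src G g = tgt G h\<rbrakk> \<Longrightarrow> tgt G (mcomp G g h) = tgt G g"
    and comp_assoc: "\<lbrakk>g \<in> Mor G; h \<in> Mor G; k \<in> Mor G; src G g = tgt G h; src G h = tgt G k\<rbrakk>
          \<Longrightarrow> mcomp G (mcomp G g h) k = mcomp G g (mcomp G h k)"
    and comp_ident_left: "g \<in> Mor G \<Longrightarrow> mcomp G (ident G (tgt G g)) g = g"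
    and comp_ident_right: "g \<in> Mor G \<Longrightarrow> mcomp G g (ident G (src G g)) = g"
    and invertible: "g \<in> Mor G \<Longrightarrow> \<exists>h \<in> Mor G. src G h = tgt G g \<and> tgt G h = src G g \<and>
          mcomp G h g = ident G (src G g) \<and> mcomp G g h = ident G (tgt G g)"

text \<open>A connected component is represented by its set of objects. In a groupoid the relation below is
  an equivalence relation on the objects.\<close>

definition components :: "('o, 'm) groupoid \<Rightarrow> 'o set set" where
  "components G = Obj G // {(x, y). \<exists>g \<in> Mor G. src G g = x \<and> tgt G g = y}"

definition loop_group :: "('o, 'm) groupoid \<Rightarrow> 'o \<Rightarrow> 'm monoid" where
  "loop_group G x =
     \<lparr>carrier = {l \<in> Mor G. src G l = x \<and> tgt G l = x}, mult = mcomp G, one = ident G x\<rparr>"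

definition groupoid_algebra :: "('o, 'm) groupoid \<Rightarrow> ('k::field, 'm \<Rightarrow>\<^sub>0 'k) module" where
  "groupoid_algebra G = (free_space (Mor G))
     \<lparr>mult := (\<lambda>f h. \<Sum>a\<in>Poly_Mapping.keys f. \<Sum>b\<in>Poly_Mapping.keys h.
        if src G a = tgt G b then Poly_Mapping.single (mcomp G a b) (Poly_Mapping.lookup f a * Poly_Mapping.lookup h b) else 0)\<rparr>"

definition group_algebra :: "('m, 'x) monoid_scheme \<Rightarrow> ('k::field, 'm \<Rightarrow>\<^sub>0 'k) module" where
  "group_algebra G = (free_space (carrier G))
     \<lparr>mult := (\<lambda>f h. \<Sum>a\<in>Poly_Mapping.keys f. \<Sum>b\<in>Poly_Mapping.keys h.
        Poly_Mapping.single (a \<otimes>\<^bsub>G\<^esub> b) (Poly_Mapping.lookup f a * Poly_Mapping.lookup h b)),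
      one := Poly_Mapping.single \<one>\<^bsub>G\<^esub> 1\<rparr>"

end

theory Submission
  imports Defs "HOL-Library.Disjoint_Sets"
begin

text \<open>
  The inclusion of the words in loops at one of the \<open>x i\<close> into all words in arrows
  induces the isomorphisms. Choosing an arrow \<open>\<gamma> y\<close> from the base point of its component to each object \<open>y\<close>
  gives a retraction \<open>e\<close>: it conjugates the letters of a cyclically composable word into the vertex
  group and kills all other words. One operator \<open>h\<close> satisfies both \<open>b' h + h b' = 1\<close> and
  \<open>b h + h b = 1 - e\<close>, so on the kernel of \<open>e\<close> the complexes of \<open>b\<close> and of \<open>b'\<close> are acyclic. In
  characteristic zero this makes Connes' complex of the kernel acyclic, by a chase in Tsygan's bicomplex.
  For the unitization, a further homotopy, built from \<open>1\<close> minus the sum of the identities of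
  finitely many objects, moves any cycle all of whose words contain an arrow to one whose words begin with an arrow, where
  \<open>h\<close> applies again.
\<close>

section \<open>Linear algebra of finitely supported functions\<close>

text \<open>The operator \<open>h\<close> comes from regarding the chosen arrows \<gamma> as a
  natural isomorphism between the identity functor and the retraction onto the vertex groups. Its
  k-th term multiplies the first letter by a \<gamma>, conjugates the next k letters, inserts an
  inverse \<gamma> and leaves the rest of the word alone, with sign (-1)^k. Where an inner face
  touches the inserted letter, neighbouring terms cancel and only the original word is left over;
  the cyclic face alone joins the last inserted inverse to the first letter. This is why
  \<open>e\<close> shows up for \<open>b\<close> and not for \<open>b'\<close>, and why the bar
  complex is contractible although B need not have a unit to insert. Characteristic zero enters
  through averaging over rotations: invariant chains are norms, and chains of norm zero have the
  form v - \<open>La\<close> v. The unitization poses an obstacle of its own: an adjoined unit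
  inside a word can borrow the object reached so far, but a unit in first place has no source from
  which \<open>h\<close> could start. Hence the reduction to words that begin with an arrow. A sum
  of identities has to be finite, so that reduction is chosen for one chain at a time.\<close>

abbreviation "single \<equiv> Poly_Mapping.single"
abbreviation "lookup \<equiv> Poly_Mapping.lookup"
abbreviation "keys \<equiv> Poly_Mapping.keys"

type_synonym ('b, 'k) chain = "'b list \<Rightarrow>\<^sub>0 'k"

lemma lookup_pm_scale [simp]: "lookup (pm_scale c f) x = c * lookup f x"
  by (cases "lookup f x = 0") (auto simp: Poly_Mapping.map.rep_eq when_def)

interpretation pm: vector_space "pm_scale :: 'k::field \<Rightarrow> ('a \<Rightarrow>\<^sub>0 'k) \<Rightarrow> ('a \<Rightarrow>\<^sub>0 'k)"
  by standard (auto intro!: poly_mapping_eqI simp: lookup_add algebra_simps)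

lemma pm_scale_single [simp]: "pm_scale c (single x d) = single x (c * d)"
  by (rule poly_mapping_eqI) (simp add: lookup_single when_def)

lemma lookup_finite_sum: "lookup (\<Sum>x\<in>A. f x) y = (\<Sum>x\<in>A. lookup (f x) y)"
  by (induction A rule: infinite_finite_induct) (auto simp: lookup_add)

definition ext :: "('a \<Rightarrow> 'b \<Rightarrow>\<^sub>0 'k::field) \<Rightarrow> ('a \<Rightarrow>\<^sub>0 'k) \<Rightarrow> 'b \<Rightarrow>\<^sub>0 'k" where
  "ext \<phi> f = (\<Sum>x\<in>keys f. pm_scale (lookup f x) (\<phi> x))"

lemma ext_superset:
  assumes "finite A" "keys f \<subseteq> A"
  shows "ext \<phi> f = (\<Sum>x\<in>A. pm_scale (lookup f x) (\<phi> x))"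
  unfolding ext_def using assms
  by (intro sum.mono_neutral_left) (auto simp: in_keys_iff)

lemma ext_0 [simp]: "ext \<phi> 0 = 0"
  by (simp add: ext_def)

lemma ext_add [simp]: "ext \<phi> (f + g) = ext \<phi> f + ext \<phi> g"
proof -
  let ?A = "keys f \<union> keys g"
  have "keys (f + g) \<subseteq> ?A"
    by (rule keys_add)
  then show ?thesis
    by (simp add: ext_superset[of ?A] lookup_add pm.scale_left_distrib sum.distrib)
qed

lemma ext_scale [simp]: "ext \<phi> (pm_scale c f) = pm_scale c (ext \<phi> f)"
proof -
  have "keys (pm_scale c f) \<subseteq> keys f"
    by (auto simp: in_keys_iff)
  then have "ext \<phi> (pm_scale c f)
      = (\<Sum>x\<in>keys f. pm_scale (lookup (pm_scale c f) x) (\<phi> x))"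
    by (intro ext_superset) auto
  then show ?thesis
    by (simp add: ext_def pm.scale_sum_right)
qed

lemma ext_uminus [simp]: "ext \<phi> (- f) = - ext \<phi> f"
  by (metis ext_0 ext_add add.left_inverse neg_eq_iff_add_eq_0)

lemma ext_diff [simp]: "ext \<phi> (f - g) = ext \<phi> f - ext \<phi> g"
  using ext_add[of \<phi> f "- g"] by simp

lemma ext_sum [simp]: "ext \<phi> (\<Sum>x\<in>A. f x) = (\<Sum>x\<in>A. ext \<phi> (f x))"
  by (induction A rule: infinite_finite_induct) auto

lemma ext_single [simp]: "ext \<phi> (single x c) = pm_scale c (\<phi> x)"
  by (simp add: ext_def)

lemma ext_cong: "(\<And>x. x \<in> keys f \<Longrightarrow> \<phi> x = \<psi> x) \<Longrightarrow> ext \<phi> f = ext \<psi> f"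
  by (simp add: ext_def)

lemma ext_ext: "ext \<phi> (ext \<psi> f) = ext (\<lambda>x. ext \<phi> (\<psi> x)) f"
  by (simp add: ext_def[of \<psi>] ext_def[of "\<lambda>x. ext \<phi> (\<psi> x)"])

lemma ext_singles [simp]: "ext (\<lambda>x. single x 1) f = f"
proof (rule poly_mapping_eqI)
  fix y
  have "(\<Sum>x\<in>keys f. lookup f x * (if x = y then 1 else 0))
      = (\<Sum>x\<in>keys f. if x = y then lookup f x else 0)"
    by (intro sum.cong) auto
  also have "\<dots> = lookup f y"
    by (simp add: in_keys_iff)
  finally show "lookup (ext (\<lambda>x. single x 1) f) y = lookup f y"
    unfolding ext_def lookup_finite_sum lookup_pm_scale lookup_single when_def .
qed

lemma ext_fun_add: "ext (\<lambda>x. \<phi> x + \<psi> x) f = ext \<phi> f + ext \<psi> f"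
  by (simp add: ext_def pm.scale_right_distrib sum.distrib)

lemma ext_fun_diff: "ext (\<lambda>x. \<phi> x - \<psi> x) f = ext \<phi> f - ext \<psi> f"
  by (simp add: ext_def pm.scale_right_diff_distrib sum_subtractf)

lemma ext_fun_scale: "ext (\<lambda>x. pm_scale c (\<phi> x)) f = pm_scale c (ext \<phi> f)"
  by (simp add: ext_def pm.scale_sum_right mult.commute)

lemma ext_fun_0 [simp]: "ext (\<lambda>x. 0) f = 0"
  by (simp add: ext_def)

lemma ext_fun_sum: "ext (\<lambda>x. \<Sum>i\<in>A. \<phi> i x) f = (\<Sum>i\<in>A. ext (\<phi> i) f)"
  by (induction A rule: infinite_finite_induct) (auto simp: ext_fun_add)

lemma ext_swap: "ext (\<lambda>x. ext (\<lambda>y. F x y) g) f = ext (\<lambda>y. ext (\<lambda>x. F x y) f) g"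
  by (simp add: ext_def pm.scale_sum_right mult.commute) (rule sum.swap)

section \<open>Chains with prescribed support\<close>

definition chains :: "'a set \<Rightarrow> ('a \<Rightarrow>\<^sub>0 'k::field) set" where
  "chains P = {f. keys f \<subseteq> P}"

lemma chains_iff: "f \<in> chains P \<longleftrightarrow> (\<forall>x. x \<notin> P \<longrightarrow> lookup f x = 0)"
  by (auto simp: chains_def in_keys_iff)

lemma subspace_chains [intro, simp]: "pm.subspace (chains P)"
  unfolding pm.subspace_def by (simp add: chains_iff lookup_add)

lemma chains_closed [intro]:
  "0 \<in> chains P" "f \<in> chains P \<Longrightarrow> g \<in> chains P \<Longrightarrow> f + g \<in> chains P"
  "f \<in> chains P \<Longrightarrow> g \<in> chains P \<Longrightarrow> f - g \<in> chains P" "f \<in> chains P \<Longrightarrow> - f \<in> chains P"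
  "f \<in> chains P \<Longrightarrow> pm_scale c f \<in> chains P"
  by (simp_all add: chains_iff lookup_add lookup_minus)

lemma single_in_chains [intro, simp]: "x \<in> P \<Longrightarrow> single x c \<in> chains P"
  by (auto simp: chains_def)

lemma chains_mono: "P \<subseteq> Q \<Longrightarrow> chains P \<subseteq> chains Q"
  by (auto simp: chains_def)

lemma keys_in: "f \<in> chains P \<Longrightarrow> x \<in> keys f \<Longrightarrow> x \<in> P"
  by (auto simp: chains_def)

lemma ext_cong_chains: "f \<in> chains P \<Longrightarrow> (\<And>x. x \<in> P \<Longrightarrow> \<phi> x = \<psi> x) \<Longrightarrow> ext \<phi> f = ext \<psi> f"
  by (rule ext_cong) (auto simp: chains_def)

lemma ext_in:
  assumes "f \<in> chains P" "\<And>x. x \<in> P \<Longrightarrow> \<phi> x \<in> U" "pm.subspace U"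
  shows "ext \<phi> f \<in> U"
  unfolding ext_def using assms
  by (intro pm.subspace_sum pm.subspace_scale) (auto simp: chains_def)

lemma chains_induct [consumes 1, case_names zero add]:
  assumes "f \<in> chains P" "Q 0" "\<And>x c f. x \<in> P \<Longrightarrow> f \<in> chains P \<Longrightarrow> Q f \<Longrightarrow> Q (single x c + f)"
  shows "Q f"
proof -
  have "Q (\<Sum>x\<in>A. single x (lookup f x)) \<and>
      (\<Sum>x\<in>A. single x (lookup f x)) \<in> chains P"
    if "finite A" "A \<subseteq> P" for A
    using that
  proof (induction A rule: finite_induct)
    case empty
    then show ?case using assms(2) by auto
  next
    case (insert x A)
    then show ?case
      using assms(3)[of x "\<Sum>x\<in>A. single x (lookup f x)" "lookup f x"]
      by (auto intro!: chains_closed(2))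
  qed
  from this[of "keys f"] have "Q (\<Sum>x\<in>keys f. single x (lookup f x))"
    using assms(1) by (auto simp: chains_def)
  also have "(\<Sum>x\<in>keys f. single x (lookup f x)) = f"
    using ext_singles[of f] unfolding ext_def by simp
  finally show ?thesis .
qed

definition restr :: "'a set \<Rightarrow> ('a \<Rightarrow>\<^sub>0 'k::field) \<Rightarrow> 'a \<Rightarrow>\<^sub>0 'k" where
  "restr P = ext (\<lambda>x. if x \<in> P then single x 1 else 0)"

lemma lookup_restr: "lookup (restr P f) y = (if y \<in> P then lookup f y else 0)"
proof -
  have "restr P f = (\<Sum>x\<in>keys f. if x \<in> P then single x (lookup f x) else 0)"
    unfolding restr_def ext_def by (intro sum.cong) auto
  then have "lookup (restr P f) y = (\<Sum>x\<in>keys f.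
      lookup (if x \<in> P then single x (lookup f x) else 0) y)"
    by (simp only: lookup_finite_sum)
  also have "\<dots> = (\<Sum>x\<in>keys f. if x = y then (if y \<in> P then lookup f y else 0) else 0)"
    by (rule sum.cong[OF refl]) (simp add: lookup_single when_def)
  finally show ?thesis
    by (simp add: in_keys_iff)
qed

lemma restr_in [simp]: "restr P f \<in> chains P"
  by (auto simp: chains_iff lookup_restr)

lemma restr_id: "f \<in> chains P \<Longrightarrow> restr P f = f"
  by (rule poly_mapping_eqI) (auto simp: lookup_restr chains_iff)

lemma restr_disjoint: "f \<in> chains Q \<Longrightarrow> P \<inter> Q = {} \<Longrightarrow> restr P f = 0"
  by (rule poly_mapping_eqI) (auto simp: lookup_restr chains_iff)

lemma restr_linear [simp]:
  "restr P 0 = 0" "restr P (f + g) = restr P f + restr P g" "restr P (pm_scale c f) = pm_scale c (restr P f)"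
  "restr P (f - g) = restr P f - restr P g" "restr P (sum F A) = (\<Sum>x\<in>A. restr P (F x))"
  by (simp_all add: restr_def)

lemma restr_in_chains: "f \<in> chains Q \<Longrightarrow> restr P f \<in> chains (P \<inter> Q)"
  by (auto simp: chains_iff lookup_restr)

lemma restr_ext_commute:
  assumes "f \<in> chains Q" "\<And>x. x \<in> P \<Longrightarrow> x \<in> Q \<Longrightarrow> \<delta> x \<in> chains P'"
    "\<And>x. x \<notin> P \<Longrightarrow> x \<in> Q \<Longrightarrow> restr P' (\<delta> x) = 0"
  shows "restr P' (ext \<delta> f) = ext \<delta> (restr P f)"
  unfolding restr_def[of P'] restr_def[of P] ext_ext
  by (rule ext_cong_chains[OF assms(1)]) (use assms(2,3) in \<open>auto simp: restr_def[symmetric] restr_id\<close>)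

section \<open>Presentations of vector spaces\<close>

text \<open>\<open>presents M V W q\<close>: the linear map \<open>q\<close> from \<open>V\<close> onto \<open>M\<close> has kernel \<open>W\<close>. This replaces the iterated
  quotients in the definitions of the homology groups by pairs of subspaces of one space of chains.\<close>

definition presents ::
    "('k::field, 'v) module \<Rightarrow> ('x \<Rightarrow>\<^sub>0 'k) set \<Rightarrow> ('x \<Rightarrow>\<^sub>0 'k) set \<Rightarrow> (('x \<Rightarrow>\<^sub>0 'k) \<Rightarrow> 'v) \<Rightarrow> bool" where
  "presents M V W q \<longleftrightarrow> pm.subspace V \<and> pm.subspace W \<and> W \<subseteq> V \<and> q ` V = carrier M \<and>
     (\<forall>u\<in>V. \<forall>v\<in>V. q (u + v) = q u \<oplus>\<^bsub>M\<^esub> q v) \<and> (\<forall>c. \<forall>v\<in>V. q (pm_scale c v) = c \<odot>\<^bsub>M\<^esub> q v) \<and>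
     q 0 = \<zero>\<^bsub>M\<^esub> \<and> (\<forall>v\<in>V. q v = \<zero>\<^bsub>M\<^esub> \<longleftrightarrow> v \<in> W)"

lemma presentsD:
  assumes "presents M V W q"
  shows "pm.subspace V" "pm.subspace W" "W \<subseteq> V" "q ` V = carrier M"
    "u \<in> V \<Longrightarrow> v \<in> V \<Longrightarrow> q (u + v) = q u \<oplus>\<^bsub>M\<^esub> q v" "v \<in> V \<Longrightarrow> q (pm_scale c v) = c \<odot>\<^bsub>M\<^esub> q v"
    "q 0 = \<zero>\<^bsub>M\<^esub>" "v \<in> V \<Longrightarrow> q v = \<zero>\<^bsub>M\<^esub> \<longleftrightarrow> v \<in> W" "v \<in> V \<Longrightarrow> q v \<in> carrier M"
  using assms unfolding presents_def by auto

text \<open>The quotient records come without proofs of the vector space laws. The surjection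
  \<open>q\<close> carries the group laws over from chains, which opens the library facts on
  \<open>finsum\<close> and subtraction.\<close>

lemma presents_abelian_group:
  assumes P: "presents M V W q"
  shows "abelian_group M"
proof (rule abelian_groupI)
  note p = presentsD[OF P]
  have rep: "\<exists>v\<in>V. x = q v" if "x \<in> carrier M" for x
    using that p(4) by (metis imageE)
  have V: "u + v \<in> V" "0 \<in> V" "- u \<in> V" if "u \<in> V" "v \<in> V" for u v
    using that p(1) pm.subspace_add pm.subspace_0 pm.subspace_neg by blast+
  have 0: "0 \<in> V" using p(1) pm.subspace_0 by blast
  show "x \<oplus>\<^bsub>M\<^esub> y \<in> carrier M" if "x \<in> carrier M" "y \<in> carrier M" for x y
    using rep[OF that(1)] rep[OF that(2)] p(5,9) V by metis
  show "\<zero>\<^bsub>M\<^esub> \<in> carrier M"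
    using p(7,9) 0 by metis
  show "x \<oplus>\<^bsub>M\<^esub> y \<oplus>\<^bsub>M\<^esub> z = x \<oplus>\<^bsub>M\<^esub> (y \<oplus>\<^bsub>M\<^esub> z)" if "x \<in> carrier M" "y \<in> carrier M" "z \<in> carrier M" for x y z
    using rep[OF that(1)] rep[OF that(2)] rep[OF that(3)] p(5) V by (metis add.assoc)
  show "x \<oplus>\<^bsub>M\<^esub> y = y \<oplus>\<^bsub>M\<^esub> x" if "x \<in> carrier M" "y \<in> carrier M" for x y
    using rep[OF that(1)] rep[OF that(2)] p(5) by (metis add.commute)
  show "\<zero>\<^bsub>M\<^esub> \<oplus>\<^bsub>M\<^esub> x = x" if "x \<in> carrier M" for x
    using rep[OF that(1)] p(5,7) 0 by (metis add_0)
  show "\<exists>y\<in>carrier M. y \<oplus>\<^bsub>M\<^esub> x = \<zero>\<^bsub>M\<^esub>" if "x \<in> carrier M" for x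
    using rep[OF that(1)] p(5,7,9) V by (metis add.left_inverse)
qed

lemma presents_uminus:
  assumes P: "presents M V W q" and "v \<in> V"
  shows "q (- v) = \<ominus>\<^bsub>M\<^esub> q v"
proof -
  interpret abelian_group M by (rule presents_abelian_group[OF P])
  note p = presentsD[OF P]
  have "- v \<in> V" using p(1) assms(2) pm.subspace_neg by blast
  then have "q (- v) \<oplus>\<^bsub>M\<^esub> q v = \<zero>\<^bsub>M\<^esub>"
    using p(5,7) assms(2) by (metis add.left_inverse)
  then show ?thesis
    using p(9) \<open>- v \<in> V\<close> assms(2) by (metis minus_equality)
qed

lemma presents_diff:
  assumes P: "presents M V W q" and "u \<in> V" "v \<in> V"
  shows "q (u - v) = q u \<ominus>\<^bsub>M\<^esub> q v"
  using presentsD(5)[OF P, of u "- v"] presents_uminus[OF P, of v] assms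
    pm.subspace_neg[OF presentsD(1)[OF P]] by (simp add: a_minus_def)

lemma presents_eq_iff:
  assumes P: "presents M V W q" and "u \<in> V" "v \<in> V"
  shows "q u = q v \<longleftrightarrow> u - v \<in> W"
proof -
  interpret abelian_group M by (rule presents_abelian_group[OF P])
  note p = presentsD[OF P]
  have "u - v \<in> V" using p(1) assms(2,3) pm.subspace_diff by blast
  then have "u - v \<in> W \<longleftrightarrow> q u \<ominus>\<^bsub>M\<^esub> q v = \<zero>\<^bsub>M\<^esub>"
    using p(8) presents_diff[OF P assms(2,3)] by metis
  also have "\<dots> \<longleftrightarrow> q u = q v"
    using p(9) assms(2,3) by (metis add.inv_closed a_minus_def minus_equality minus_minus r_neg)
  finally show ?thesis by simp
qed

lemma presents_set_add:
  assumes P: "presents M V W q" and "A \<subseteq> V" "B \<subseteq> V"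
  shows "set_add M (q ` A) (q ` B) = q ` {a + b |a b. a \<in> A \<and> b \<in> B}"
proof -
  have eq: "q a \<oplus>\<^bsub>M\<^esub> q b = q (a + b)" if "a \<in> A" "b \<in> B" for a b
    using presentsD(5)[OF P, of a b] that assms(2,3) by (metis subsetD)
  have "set_add M (q ` A) (q ` B) = (\<Union>a\<in>A. \<Union>b\<in>B. {q a \<oplus>\<^bsub>M\<^esub> q b})"
    by (simp add: set_add_def')
  also have "\<dots> = (\<Union>a\<in>A. \<Union>b\<in>B. {q (a + b)})"
    using eq by simp
  also have "\<dots> = q ` {a + b |a b. a \<in> A \<and> b \<in> B}"
    by auto
  finally show ?thesis .
qed

lemma presents_coset:
  assumes P: "presents M V W q" and "U \<subseteq> V" "v \<in> V"
  shows "q ` U +>\<^bsub>M\<^esub> q v = q ` {u + v |u. u \<in> U}"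
proof -
  have "(\<lambda>u. q (u + v)) ` U = (\<lambda>u. q u \<oplus>\<^bsub>M\<^esub> q v) ` U"
    using presentsD(5)[OF P] assms(2,3) by (intro image_cong) auto
  moreover have "q ` {u + v |u. u \<in> U} = (\<lambda>u. q (u + v)) ` U"
    by auto
  ultimately show ?thesis
    by (auto simp: a_r_coset_def')
qed

text \<open>Every coset of \<open>N\<close> is the \<open>q\<close>-image of a translate of
  \<open>U\<close>, so set-level addition and scaling of cosets reduce to translates of one
  subspace. Iterating the lemma describes a quotient of a quotient by a single pair of
  subspaces.\<close>

lemma presents_quot:
  assumes P: "presents M V W q" and U: "pm.subspace U" "W \<subseteq> U" "U \<subseteq> V" and N: "N = q ` U"
  shows "presents (quot_space M N) V U (\<lambda>v. N +>\<^bsub>M\<^esub> q v)"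
proof -
  note p = presentsD[OF P]
  let ?c = "\<lambda>v. {u + v |u. u \<in> U}"
  have cos: "N +>\<^bsub>M\<^esub> q v = q ` ?c v" if "v \<in> V" for v
    using presents_coset[OF P U(3) that] N by simp
  have U0: "0 \<in> U" and Ua: "\<And>u v. u \<in> U \<Longrightarrow> v \<in> U \<Longrightarrow> u + v \<in> U" and Us: "\<And>c u. u \<in> U \<Longrightarrow> pm_scale c u \<in> U"
    and Un: "\<And>u. u \<in> U \<Longrightarrow> - u \<in> U"
    using U(1) pm.subspace_0 pm.subspace_add pm.subspace_scale pm.subspace_neg by blast+
  have Va: "\<And>u v. u \<in> V \<Longrightarrow> v \<in> V \<Longrightarrow> u + v \<in> V" and Vs: "\<And>c u. u \<in> V \<Longrightarrow> pm_scale c u \<in> V" and V0: "0 \<in> V"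
    using p(1) pm.subspace_add pm.subspace_scale pm.subspace_0 by blast+
  have cV: "?c v \<subseteq> V" if "v \<in> V" for v
    using that U(3) Va by auto
  have add: "N +>\<^bsub>M\<^esub> q (u + v) = set_add M (N +>\<^bsub>M\<^esub> q u) (N +>\<^bsub>M\<^esub> q v)" if "u \<in> V" "v \<in> V" for u v
  proof -
    have "{a + b |a b. a \<in> ?c u \<and> b \<in> ?c v} = ?c (u + v)"
    proof (intro equalityI subsetI)
      fix x assume "x \<in> {a + b |a b. a \<in> ?c u \<and> b \<in> ?c v}"
      then obtain a b where "x = (a + u) + (b + v)" "a \<in> U" "b \<in> U" by auto
      then show "x \<in> ?c (u + v)" using Ua[of a b] by (auto intro!: exI[of _ "a + b"] simp: algebra_simps)
    next
      fix x assume "x \<in> ?c (u + v)"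
      then obtain a where "x = (a + u) + (0 + v)" "a \<in> U" by (auto simp: algebra_simps)
      then show "x \<in> {a + b |a b. a \<in> ?c u \<and> b \<in> ?c v}" using U0 by blast
    qed
    then show ?thesis
      using presents_set_add[OF P cV[OF that(1)] cV[OF that(2)]] that Va by (simp add: cos)
  qed
  have smult: "N +>\<^bsub>M\<^esub> q (pm_scale c v) = set_add M N ((\<lambda>x. c \<odot>\<^bsub>M\<^esub> x) ` (N +>\<^bsub>M\<^esub> q v))" if "v \<in> V" for c v
  proof -
    have "(\<lambda>x. c \<odot>\<^bsub>M\<^esub> x) ` (q ` ?c v) = q ` (pm_scale c ` ?c v)"
      using p(6) cV[OF that] by (auto simp: image_image subset_iff image_iff)
    moreover have "pm_scale c ` ?c v \<subseteq> V" using cV[OF that] Vs by auto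
    moreover have "{a + b |a b. a \<in> U \<and> b \<in> pm_scale c ` ?c v} = ?c (pm_scale c v)"
    proof (intro equalityI subsetI)
      fix x assume "x \<in> {a + b |a b. a \<in> U \<and> b \<in> pm_scale c ` ?c v}"
      then obtain a b where "x = a + pm_scale c (b + v)" "a \<in> U" "b \<in> U" by auto
      then show "x \<in> ?c (pm_scale c v)" using Ua[of a "pm_scale c b"] Us
        by (auto intro!: exI[of _ "a + pm_scale c b"] simp: pm.scale_right_distrib algebra_simps)
    next
      fix x assume "x \<in> ?c (pm_scale c v)"
      then obtain a where "x = a + pm_scale c (0 + v)" "a \<in> U" by auto
      then show "x \<in> {a + b |a b. a \<in> U \<and> b \<in> pm_scale c ` ?c v}" using U0 by blast
    qed
    ultimately show ?thesis
      using presents_set_add[OF P U(3), of "pm_scale c ` ?c v", folded N] that Vs by (simp add: cos)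
  qed
  have zero: "N +>\<^bsub>M\<^esub> q 0 = N"
    using cos[OF V0] N by simp
  have ker: "N +>\<^bsub>M\<^esub> q v = N \<longleftrightarrow> v \<in> U" if "v \<in> V" for v
  proof
    assume "N +>\<^bsub>M\<^esub> q v = N"
    then have "q (0 + v) \<in> q ` U" using cos[OF that] N U0 by blast
    then obtain u where u: "u \<in> U" "q v = q u" by auto
    then have "v - u \<in> U" using presents_eq_iff[OF P that, of u] U by blast
    then show "v \<in> U" using Ua[OF _ u(1), of "v - u"] by simp
  next
    assume v: "v \<in> U"
    have "?c v = U"
    proof (intro equalityI subsetI)
      fix x assume "x \<in> U"
      then show "x \<in> ?c v" using Ua[OF _ Un[OF v], of x] by (auto intro!: exI[of _ "x - v"])
    qed (use Ua v in auto)
    then show "N +>\<^bsub>M\<^esub> q v = N" using cos[OF that] N by simp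
  qed
  have "(\<lambda>v. N +>\<^bsub>M\<^esub> q v) ` V = a_rcosets\<^bsub>M\<^esub> N"
    using p(4)[symmetric] by (auto simp: A_RCOSETS_def')
  then show ?thesis
    unfolding presents_def quot_space_def using p(1) U add smult zero ker by simp
qed

text \<open>Change of representatives along a linear map that is onto modulo \<open>W\<close>; this
  is how tuples of algebra elements give way to words of basis elements.\<close>

lemma presents_transfer:
  assumes P: "presents M V W q" and V': "pm.subspace V'" and F: "\<And>v. v \<in> V' \<Longrightarrow> ext \<phi> v \<in> V"
    and surj: "\<And>v. v \<in> V \<Longrightarrow> \<exists>v'\<in>V'. v - ext \<phi> v' \<in> W"
    and W': "W' = {v \<in> V'. ext \<phi> v \<in> W}"
  shows "presents M V' W' (\<lambda>v. q (ext \<phi> v))"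
proof -
  note p = presentsD[OF P]
  have "pm.subspace W'"
    using V' p(2) unfolding W' pm.subspace_def by auto
  moreover have "(\<lambda>v. q (ext \<phi> v)) ` V' = carrier M"
  proof
    show "carrier M \<subseteq> (\<lambda>v. q (ext \<phi> v)) ` V'"
    proof
      fix x assume "x \<in> carrier M"
      then obtain v where v: "v \<in> V" "x = q v" using p(4) by auto
      then obtain v' where "v' \<in> V'" "v - ext \<phi> v' \<in> W" using surj by blast
      then show "x \<in> (\<lambda>v. q (ext \<phi> v)) ` V'"
        using presents_eq_iff[OF P v(1) F] v by auto
    qed
  qed (use F p(9) in auto)
  ultimately show ?thesis
    using p F V' unfolding presents_def W' by auto
qed

text \<open>Cycles modulo the relations are the chains whose boundary falls into the relations one
  degree lower, and the relations join the boundaries. \<open>ext \<delta>\<close> may be a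
  differential up to \<open>W\<close> only. Nothing leaves degree 0, whence the disjunct
  \<open>n = 0\<close>.\<close>

lemma presents_homology:
  fixes C :: "nat \<Rightarrow> ('k::field, 'v) module" and V W :: "nat \<Rightarrow> ('x \<Rightarrow>\<^sub>0 'k) set"
    and q :: "nat \<Rightarrow> ('x \<Rightarrow>\<^sub>0 'k) \<Rightarrow> 'v"
  assumes P: "\<And>n. presents (C n) (V n) (W n) (q n)"
    and D: "\<And>n v. v \<in> V (Suc n) \<Longrightarrow> ext \<delta> v \<in> V n"
    and W: "\<And>n v. v \<in> W (Suc n) \<Longrightarrow> ext \<delta> v \<in> W n"
    and DD: "\<And>n v. v \<in> V (Suc (Suc n)) \<Longrightarrow> ext \<delta> (ext \<delta> v) \<in> W n"
    and d: "\<And>n v. v \<in> V (Suc n) \<Longrightarrow> d n (q (Suc n) v) = q n (ext \<delta> v)"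
  shows "presents (homology C d n) {v \<in> V n. n = 0 \<or> ext \<delta> v \<in> W (n - 1)}
    {w + ext \<delta> u |w u. w \<in> W n \<and> u \<in> V (Suc n)} (\<lambda>v. boundaries C d n +>\<^bsub>C n\<^esub> q n v)"
proof -
  let ?Z = "{v \<in> V n. n = 0 \<or> ext \<delta> v \<in> W (n - 1)}"
  let ?U = "{w + ext \<delta> u |w u. w \<in> W n \<and> u \<in> V (Suc n)}"
  let ?M = "(C n)\<lparr>carrier := cycles C d n\<rparr>"
  note p = presentsD[OF P]
  have sub: "pm.subspace ?Z"
  proof (cases n)
    case 0
    then show ?thesis using p(1) by simp
  next
    case (Suc m)
    then show ?thesis using p(1)[of n] p(2)[of m] unfolding pm.subspace_def by auto
  qed
  have cyc: "q n ` ?Z = cycles C d n"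
  proof (cases n)
    case 0
    then show ?thesis using p(4) by (simp add: cycles_def)
  next
    case (Suc m)
    have "d m (q n v) = \<zero>\<^bsub>C m\<^esub> \<longleftrightarrow> ext \<delta> v \<in> W m" if "v \<in> V n" for v
      using that d[of v m] D[of v m] p(8)[of "ext \<delta> v" m] Suc by simp
    then show ?thesis
      using p(4)[of n, symmetric] Suc by (auto simp: cycles_def)
  qed
  have WZ: "W n \<subseteq> ?Z"
    using p(3)[of n] W by (cases n) auto
  have P': "presents ?M ?Z (W n) (q n)"
    using sub presentsD(2,3,5-8)[OF P[of n]] cyc WZ unfolding presents_def by auto
  have subU: "pm.subspace ?U"
    unfolding pm.subspace_def
  proof (intro conjI ballI allI)
    show "0 \<in> ?U"
      using pm.subspace_0[OF p(2)[of n]] pm.subspace_0[OF p(1)[of "Suc n"]]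
      by (intro CollectI exI[of _ 0]) auto
  next
    fix x y assume "x \<in> ?U" "y \<in> ?U"
    then obtain w u w' u' where "x = w + ext \<delta> u" "y = w' + ext \<delta> u'" "w \<in> W n" "w' \<in> W n"
        "u \<in> V (Suc n)" "u' \<in> V (Suc n)" by blast
    then show "x + y \<in> ?U"
      using pm.subspace_add[OF p(2)[of n], of w w'] pm.subspace_add[OF p(1)[of "Suc n"], of u u']
      by (intro CollectI exI[of _ "w + w'"] exI[of _ "u + u'"]) auto
  next
    fix c x assume "x \<in> ?U"
    then obtain w u where "x = w + ext \<delta> u" "w \<in> W n" "u \<in> V (Suc n)" by blast
    then show "pm_scale c x \<in> ?U"
      using pm.subspace_scale[OF p(2)[of n], of w c] pm.subspace_scale[OF p(1)[of "Suc n"], of u c]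
      by (intro CollectI exI[of _ "pm_scale c w"] exI[of _ "pm_scale c u"]) (auto simp: pm.scale_right_distrib)
  qed
  have WU: "W n \<subseteq> ?U"
    using pm.subspace_0[OF p(1)[of "Suc n"]] by force
  have "ext \<delta> u \<in> ?Z" if "u \<in> V (Suc n)" for u
    using D[OF that] DD[of u "n - 1"] that by (cases n) auto
  then have UZ: "?U \<subseteq> ?Z"
    using WZ pm.subspace_add[OF sub] by blast
  have "q n (w + ext \<delta> u) = q n (ext \<delta> u)" if "w \<in> W n" "u \<in> V (Suc n)" for w u
    using presents_eq_iff[OF P, of "w + ext \<delta> u" n "ext \<delta> u"] that D p(1,3) pm.subspace_add
    by (metis add_diff_cancel_right' subsetD)
  then have "q n ` ?U = (\<lambda>u. q n (ext \<delta> u)) ` V (Suc n)"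
    using pm.subspace_0[OF p(2)[of n]] by (force simp: image_iff)
  also have "\<dots> = d n ` q (Suc n) ` V (Suc n)"
    using d by (auto simp: image_iff)
  also have "\<dots> = boundaries C d n"
    using p(4)[of "Suc n"] by (simp add: boundaries_def)
  finally have B: "boundaries C d n = q n ` ?U" by simp
  have "presents (homology C d n) ?Z ?U (\<lambda>v. boundaries C d n +>\<^bsub>?M\<^esub> q n v)"
    unfolding homology_def by (rule presents_quot[OF P' subU WU UZ B])
  then show ?thesis
    by (simp add: a_r_coset_def')
qed

text \<open>The inclusion induces a map from V'/W' to V/W:
  \<open>V' \<inter> W \<subseteq> W'\<close> makes it injective and \<open>surj\<close> makes it
  surjective. The witness is its inverse, which picks a representative in \<open>V'\<close>.\<close>

lemma vs_iso_presents:
  assumes P: "presents M V W q" and P': "presents M' V' W' q'"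
    and sub: "V' \<subseteq> V" "W' \<subseteq> W" "V' \<inter> W \<subseteq> W'" and surj: "\<And>v. v \<in> V \<Longrightarrow> \<exists>v'\<in>V'. v - v' \<in> W"
  shows "M \<cong>\<^sub>v M'"
proof -
  note p = presentsD[OF P] and p' = presentsD[OF P']
  have rep: "\<exists>v\<in>V'. x = q v" if "x \<in> carrier M" for x
    using that p(4) surj presents_eq_iff[OF P] sub(1) by (metis (no_types, lifting) imageE subsetD)
  have eq: "q u = q v \<longleftrightarrow> q' u = q' v" if "u \<in> V'" "v \<in> V'" for u v
    using presents_eq_iff[OF P, of u v] presents_eq_iff[OF P', of u v] sub that pm.subspace_diff[OF p'(1)] by blast
  define f where "f x = q' (SOME v. v \<in> V' \<and> q v = x)" for x
  have f: "f (q v) = q' v" if "v \<in> V'" for v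
  proof -
    have "(SOME w. w \<in> V' \<and> q w = q v) \<in> V' \<and> q (SOME w. w \<in> V' \<and> q w = q v) = q v"
      by (rule someI[of _ v]) (use that in simp)
    then show ?thesis using eq[of "SOME w. w \<in> V' \<and> q w = q v" v] that by (simp add: f_def)
  qed
  have car: "carrier M = q ` V'"
    using rep p(9) sub(1) by blast
  have Va: "u + v \<in> V'" "pm_scale c u \<in> V'" if "u \<in> V'" "v \<in> V'" for u v c
    using that p'(1) pm.subspace_add pm.subspace_scale by blast+
  have "f \<in> hom (add_monoid M) (add_monoid M')"
  proof (rule homI)
    fix x assume "x \<in> carrier (add_monoid M)"
    then show "f x \<in> carrier (add_monoid M')" using car f p'(9) by auto
  next
    fix x y assume "x \<in> carrier (add_monoid M)" "y \<in> carrier (add_monoid M)"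
    then obtain u v where uv: "u \<in> V'" "v \<in> V'" "x = q u" "y = q v" using car by auto
    then have "f (x \<oplus>\<^bsub>M\<^esub> y) = f (q (u + v))" using p(5) sub(1) by (metis subsetD)
    also have "\<dots> = f x \<oplus>\<^bsub>M'\<^esub> f y" using uv f Va p'(5) by simp
    finally show "f (x \<otimes>\<^bsub>add_monoid M\<^esub> y) = f x \<otimes>\<^bsub>add_monoid M'\<^esub> f y" by simp
  qed
  moreover have "bij_betw f (carrier M) (carrier M')"
    unfolding bij_betw_def car
  proof
    show "inj_on f (q ` V')" using f eq by (auto intro!: inj_onI)
    show "f ` q ` V' = carrier M'" using f p'(4) by (auto simp: image_image)
  qed
  moreover have "f (c \<odot>\<^bsub>M\<^esub> x) = c \<odot>\<^bsub>M'\<^esub> f x" if x: "x \<in> carrier M" for c x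
  proof -
    obtain u where u: "u \<in> V'" "x = q u" using x car by auto
    then have "f (c \<odot>\<^bsub>M\<^esub> x) = f (q (pm_scale c u))" using p(6) sub(1) by (metis subsetD)
    also have "\<dots> = c \<odot>\<^bsub>M'\<^esub> f x" using u f Va p'(6) by simp
    finally show ?thesis .
  qed
  ultimately show ?thesis
    unfolding vs_iso_def iso_def by auto
qed

section \<open>Disjoint blocks and direct sums\<close>

lemma restr_family_finite:
  assumes "disjoint_family_on P I"
  shows "finite {i \<in> I. restr (P i) f \<noteq> 0}"
proof -
  have "finite {i \<in> I. x \<in> P i}" for x
  proof (cases "\<exists>i\<in>I. x \<in> P i")
    case True
    then obtain i where "i \<in> I" "x \<in> P i" by blast
    then have "{i \<in> I. x \<in> P i} \<subseteq> {i}" using assms by (auto simp: disjoint_family_on_def)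
    then show ?thesis using finite_subset by blast
  next
    case False
    then have "{i \<in> I. x \<in> P i} = {}" by blast
    then show ?thesis by (metis finite.emptyI)
  qed
  then have "finite (\<Union>x\<in>keys f. {i \<in> I. x \<in> P i})" by simp
  moreover have "{i \<in> I. restr (P i) f \<noteq> 0} \<subseteq> (\<Union>x\<in>keys f. {i \<in> I. x \<in> P i})"
  proof
    fix i assume "i \<in> {i \<in> I. restr (P i) f \<noteq> 0}"
    then have "i \<in> I" "restr (P i) f \<noteq> 0" by auto
    then obtain x where "lookup (restr (P i) f) x \<noteq> 0"
      by (metis poly_mapping_eqI lookup_zero)
    then show "i \<in> (\<Union>x\<in>keys f. {i \<in> I. x \<in> P i})"
      using \<open>i \<in> I\<close> by (auto simp: lookup_restr in_keys_iff split: if_splits)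
  qed
  ultimately show ?thesis by (rule finite_subset[rotated])
qed

lemma restr_family_sum:
  assumes dis: "disjoint_family_on P I" and f: "f \<in> chains (\<Union>i\<in>I. P i)"
  shows "f = (\<Sum>i\<in>{i \<in> I. restr (P i) f \<noteq> 0}. restr (P i) f)"
proof (rule poly_mapping_eqI)
  fix x
  let ?J = "{i \<in> I. restr (P i) f \<noteq> 0}"
  show "lookup f x = lookup (\<Sum>i\<in>?J. restr (P i) f) x"
  proof (cases "lookup f x = 0")
    case True
    then have "lookup (restr (P i) f) x = 0" for i by (simp add: lookup_restr)
    then show ?thesis using True by (simp add: lookup_finite_sum)
  next
    case False
    then obtain i where i: "i \<in> I" "x \<in> P i" using f by (auto simp: chains_iff)
    then have "lookup (restr (P i) f) x \<noteq> 0" using False by (simp add: lookup_restr)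
    then have "i \<in> ?J" using i by auto
    moreover have "lookup (restr (P j) f) x = (if j = i then lookup f x else 0)" if "j \<in> I" for j
      using that i dis by (auto simp: lookup_restr disjoint_family_on_def)
    ultimately have "(\<Sum>j\<in>?J. lookup (restr (P j) f) x)
        = (\<Sum>j\<in>?J. if j = i then lookup f x else 0)"
      by (intro sum.cong) auto
    also have "\<dots> = lookup f x"
      using restr_family_finite[OF dis, of f] \<open>i \<in> ?J\<close> by simp
    finally show ?thesis
      by (simp add: lookup_finite_sum)
  qed
qed

lemma restr_sum_family:
  assumes dis: "disjoint_family_on P I" and "J \<subseteq> I" "finite J" "\<And>j. j \<in> J \<Longrightarrow> v j \<in> chains (P j)" "i \<in> I"
  shows "restr (P i) (\<Sum>j\<in>J. v j) = (if i \<in> J then v i else 0)"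
proof -
  have "restr (P i) (v j) = (if j = i then v i else 0)" if "j \<in> J" for j
  proof (cases "j = i")
    case True
    then show ?thesis using that assms(4) by (simp add: restr_id)
  next
    case False
    then have "P i \<inter> P j = {}" using dis that assms(2,5) by (auto simp: disjoint_family_on_def)
    then show ?thesis using False restr_disjoint[OF assms(4)[OF that]] by simp
  qed
  then show ?thesis using assms(3) by (simp cong: sum.cong)
qed

abbreviation glued :: "'i set \<Rightarrow> ('i \<Rightarrow> 'a set) \<Rightarrow> ('i \<Rightarrow> ('a \<Rightarrow>\<^sub>0 'k::field) set) \<Rightarrow> ('a \<Rightarrow>\<^sub>0 'k) set" where
  "glued I Q R \<equiv> {f \<in> chains (\<Union>i\<in>I. Q i). \<forall>i\<in>I. restr (Q i) f \<in> R i}"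

text \<open>A chain on a disjoint union of blocks is the same as a finitely supported family of
  chains on the blocks, since one chain meets only finitely many of them. So a direct sum, too, is
  presented by subspaces of one space of chains.\<close>

lemma presents_direct_sum:
  assumes P: "\<And>i. i \<in> I \<Longrightarrow> presents (M i) (V i) (W i) (q i)"
    and V: "\<And>i. i \<in> I \<Longrightarrow> V i \<subseteq> chains (P i)" and dis: "disjoint_family_on P I"
  shows "presents (direct_sum I M)
    (glued I P V)
    (glued I P W) (\<lambda>f. \<lambda>i\<in>I. q i (restr (P i) f))"
proof -
  let ?V = "(glued I P V)"
  let ?q = "\<lambda>f. \<lambda>i\<in>I. q i (restr (P i) f)"
  note p = presentsD[OF P]
  have sub: "pm.subspace (glued I P U)"
    if "\<And>i. i \<in> I \<Longrightarrow> pm.subspace (U i)" for U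
    using that subspace_chains[of "\<Union>i\<in>I. P i"] unfolding pm.subspace_def by auto
  have car: "?q ` ?V = carrier (direct_sum I M)"
  proof (intro equalityI subsetI)
    fix x assume "x \<in> ?q ` ?V"
    then obtain f where f: "f \<in> ?V" "x = ?q f" by blast
    have "{i \<in> I. ?q f i \<noteq> \<zero>\<^bsub>M i\<^esub>} \<subseteq> {i \<in> I. restr (P i) f \<noteq> 0}"
      using p(7) by (auto simp: restr_def)
    then have "finite {i \<in> I. ?q f i \<noteq> \<zero>\<^bsub>M i\<^esub>}"
      using restr_family_finite[OF dis] finite_subset by blast
    then show "x \<in> carrier (direct_sum I M)"
      using f p(9) by (auto simp: direct_sum_def)
  next
    fix x assume "x \<in> carrier (direct_sum I M)"
    then have x: "x \<in> (\<Pi>\<^sub>E i\<in>I. carrier (M i))" and fin: "finite {i \<in> I. x i \<noteq> \<zero>\<^bsub>M i\<^esub>}"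
      by (auto simp: direct_sum_def)
    let ?J = "{i \<in> I. x i \<noteq> \<zero>\<^bsub>M i\<^esub>}"
    have "\<forall>i\<in>I. \<exists>v\<in>V i. x i = q i v" using x p(4) by (metis PiE_mem imageE)
    then obtain v where v: "\<And>i. i \<in> I \<Longrightarrow> v i \<in> V i" "\<And>i. i \<in> I \<Longrightarrow> x i = q i (v i)" by metis
    define f where "f = (\<Sum>j\<in>?J. v j)"
    have r: "restr (P i) f = (if i \<in> ?J then v i else 0)" if "i \<in> I" for i
      unfolding f_def by (rule restr_sum_family[OF dis]) (use fin that v V in auto)
    have "f \<in> chains (\<Union>i\<in>I. P i)"
      unfolding f_def using v V chains_mono[of "P _" "\<Union>i\<in>I. P i"]
      by (intro pm.subspace_sum subspace_chains) blast
    moreover have "restr (P i) f \<in> V i" if "i \<in> I" for i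
      using r[OF that] that v pm.subspace_0[OF p(1)] by auto
    moreover have "?q f = x"
    proof
      fix i show "?q f i = x i"
        using x r[of i] v(2)[of i] p(7)[of i] by (cases "i \<in> I") (auto simp: PiE_def extensional_def)
    qed
    ultimately show "x \<in> ?q ` ?V" by blast
  qed
  have "?q f = (\<lambda>i\<in>I. \<zero>\<^bsub>M i\<^esub>) \<longleftrightarrow> (\<forall>i\<in>I. restr (P i) f \<in> W i)" if "f \<in> ?V" for f
    using that p(8) by (auto simp: restrict_def fun_eq_iff)
  then show ?thesis
    unfolding presents_def
    using sub p(1,2) car p(5-7) subsetD[OF p(3)]
    by (auto simp: direct_sum_def fun_eq_iff)
qed


section \<open>The bar and cyclic operators of a partial semigroup\<close>

abbreviation lists_of_length :: "nat \<Rightarrow> 'b list set" where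
  "lists_of_length n \<equiv> {l. length l = n}"

lemma lin_eqI:
  fixes F G :: "('a \<Rightarrow>\<^sub>0 'k::field) \<Rightarrow> ('b \<Rightarrow>\<^sub>0 'k)"
  assumes "f \<in> chains P"
    and "\<And>f g. F (f + g) = F f + F g" "\<And>c f. F (pm_scale c f) = pm_scale c (F f)"
    and "\<And>f g. G (f + g) = G f + G g" "\<And>c f. G (pm_scale c f) = pm_scale c (G f)"
    and "\<And>x. x \<in> P \<Longrightarrow> F (single x 1) = G (single x 1)"
  shows "F f = G f"
  using assms(1)
proof (induction rule: chains_induct)
  case zero
  show ?case using assms(3,5)[of 0 0] by simp
next
  case (add x c f)
  have "single x c = pm_scale c (single x 1)" by simp
  then have "F (single x c) = G (single x c)"
    using assms(3,5,6) add by metis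
  then show ?case using add assms(2,4) by simp
qed

lemma chains_UNIV [simp]: "f \<in> chains UNIV"
  by (simp add: chains_def)

section \<open>Signed rotation and norm of words\<close>

definition cns :: "'b \<Rightarrow> ('b, 'k::field) chain \<Rightarrow> ('b, 'k) chain" where
  "cns a = ext (\<lambda>l. single (a # l) 1)"

definition snc :: "'b \<Rightarrow> ('b, 'k::field) chain \<Rightarrow> ('b, 'k) chain" where
  "snc a = ext (\<lambda>l. single (l @ [a]) 1)"

definition Lal :: "'b list \<Rightarrow> ('b, 'k::field) chain" where
  "Lal l = (if l = [] then 0 else single (last l # butlast l) ((- 1) ^ (length l - 1)))"

definition La :: "('b, 'k::field) chain \<Rightarrow> ('b, 'k) chain" where
  "La = ext Lal"

lemma cns_simps [simp]:
  "cns a 0 = 0" "cns a (f + g) = cns a f + cns a g" "cns a (f - g) = cns a f - cns a g"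
  "cns a (- f) = - cns a f" "cns a (pm_scale c f) = pm_scale c (cns a f)"
  "cns a (single l c) = single (a # l) c"
  "cns a (sum F A) = (\<Sum>x\<in>A. cns a (F x))"
  by (simp_all add: cns_def)

lemma snc_simps [simp]:
  "snc a 0 = 0" "snc a (f + g) = snc a f + snc a g" "snc a (f - g) = snc a f - snc a g"
  "snc a (- f) = - snc a f" "snc a (pm_scale c f) = pm_scale c (snc a f)"
  "snc a (single l c) = single (l @ [a]) c"
  by (simp_all add: snc_def)

lemma La_simps [simp]:
  "La 0 = 0" "La (f + g) = La f + La g" "La (f - g) = La f - La g"
  "La (- f) = - La f" "La (pm_scale c f) = pm_scale c (La f)"
  "La (single l c) = pm_scale c (Lal l)"
  "La (sum F A) = (\<Sum>x\<in>A. La (F x))"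
  by (simp_all add: La_def)

lemma snc_cns: "snc z (cns a f) = cns a (snc z f)"
  by (rule lin_eqI[of f UNIV]) simp_all

lemma Lal_snoc [simp]: "Lal (l @ [z]) = single (z # l) ((- 1) ^ length l)"
  by (simp add: Lal_def)

lemma Lal_Nil [simp]: "Lal [] = 0"
  by (simp add: Lal_def)

lemma La_snc:
  assumes "f \<in> chains (lists_of_length n)"
  shows "La (snc z f) = pm_scale ((- 1) ^ n) (cns z f)"
  by (rule lin_eqI[OF assms])
    (auto simp: pm.scale_right_distrib pm.scale_left_commute simp del: pm.scale_scale)

lemma La_chains:
  assumes "f \<in> chains P" "\<And>l z. l @ [z] \<in> P \<Longrightarrow> z # l \<in> Q"
  shows "La f \<in> chains Q"
  unfolding La_def
proof (rule ext_in[OF assms(1)])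
  fix l assume "l \<in> P"
  then show "Lal l \<in> chains Q"
    using assms(2) by (cases l rule: rev_cases) auto
qed simp

lemma cns_chains:
  assumes "f \<in> chains P" "\<And>l. l \<in> P \<Longrightarrow> a # l \<in> Q"
  shows "cns a f \<in> chains Q"
  unfolding cns_def by (rule ext_in[OF assms(1)]) (use assms(2) in auto)

lemma La_length: "f \<in> chains (lists_of_length n) \<Longrightarrow> La f \<in> chains (lists_of_length n)"
  by (rule La_chains) auto

lemma La_pow_simps [simp]:
  "(La ^^ k) 0 = 0" "(La ^^ k) (f + g) = (La ^^ k) f + (La ^^ k) g" "(La ^^ k) (f - g) = (La ^^ k) f - (La ^^ k) g"
  "(La ^^ k) (pm_scale c f) = pm_scale c ((La ^^ k) f)"
  "(La ^^ k) (sum F A) = (\<Sum>x\<in>A. (La ^^ k) (F x))"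
  by (induction k) simp_all

text \<open>The length is constant during the rotations, so each one contributes the same sign. With
  \<open>u = []\<close> the exponent is a product of two consecutive numbers, hence even, and a full
  turn is the identity.\<close>

lemma La_pow_append:
  "(La ^^ length v) (single (u @ v) (1 :: 'k::field)) =
     single (v @ u) ((- 1) ^ ((length u + length v - 1) * length v))"
proof (induction v arbitrary: u rule: rev_induct)
  case (snoc z v)
  have "(La ^^ length (v @ [z])) (single (u @ v @ [z]) (1 :: 'k))
      = (La ^^ length v) (Lal ((u @ v) @ [z]))"
    by (simp add: funpow_swap1)
  also have "\<dots> = pm_scale ((- 1) ^ length (u @ v)) ((La ^^ length v) (single ((z # u) @ v) 1))"
    unfolding Lal_snoc La_pow_simps(4)[symmetric] by simp
  also have "\<dots> = single ((v @ [z]) @ u)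
      ((- 1) ^ length (u @ v) * (- 1) ^ ((length (z # u) + length v - 1) * length v))"
    unfolding snoc by simp
  finally show ?case
    by (simp add: power_add)
qed simp

lemma La_pow_length:
  assumes "f \<in> chains (lists_of_length n)"
  shows "(La ^^ n) f = f"
proof (rule lin_eqI[OF assms, where F = "La ^^ n" and G = "\<lambda>f. f"])
  fix l :: "'a list" assume "l \<in> lists_of_length n"
  then show "(La ^^ n) (single l 1) = single l (1 :: 'b)"
    using La_pow_append[of l "[]"] by (cases n) (auto simp: mult.commute)
qed simp_all

text \<open>The number of summands is an argument of its own because a full turn takes
  \<open>n\<close> rotations only on words of length \<open>n\<close>, and because shorter sums
  occur in the witness of \<open>Nm_eq_0_imp\<close>.\<close>

definition Nm :: "nat \<Rightarrow> ('b, 'k::field) chain \<Rightarrow> ('b, 'k) chain" where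
  "Nm m f = (\<Sum>i<m. (La ^^ i) f)"

lemma Nm_simps [simp]:
  "Nm m 0 = 0" "Nm m (f + g) = Nm m f + Nm m g" "Nm m (f - g) = Nm m f - Nm m g"
  "Nm m (pm_scale c f) = pm_scale c (Nm m f)" "Nm m (sum F A) = (\<Sum>x\<in>A. Nm m (F x))"
  by (simp_all add: Nm_def sum.distrib sum_subtractf pm.scale_sum_right)
    (rule sum.swap)

lemma La_pow_in:
  "f \<in> chains (lists_of_length n) \<Longrightarrow> (La ^^ k) f \<in> chains (lists_of_length n)"
  by (induction k) (auto intro: La_length)

lemma Nm_La:
  assumes "f \<in> chains (lists_of_length n)"
  shows "Nm n (La f) = Nm n f"
proof -
  have "Nm n (La f) = (\<Sum>i<n. (La ^^ Suc i) f)"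
    by (simp add: Nm_def funpow_swap1)
  also have "\<dots> = (\<Sum>i<n. (La ^^ i) f) + (La ^^ n) f - (La ^^ 0) f"
    by (subst sum.lessThan_Suc[symmetric], subst sum.lessThan_Suc_shift) simp
  finally show ?thesis
    using La_pow_length[OF assms] by (simp add: Nm_def)
qed

lemma La_Nm:
  assumes "f \<in> chains (lists_of_length n)"
  shows "La (Nm n f) = Nm n f"
  using Nm_La[OF assms] by (simp add: Nm_def funpow_swap1)

lemma Nm_La_pow:
  assumes "f \<in> chains (lists_of_length n)"
  shows "Nm n ((La ^^ k) f) = Nm n f"
  by (induction k) (use Nm_La[OF La_pow_in[OF assms]] in auto)

lemma La_pow_Nm:
  assumes "f \<in> chains (lists_of_length n)"
  shows "(La ^^ k) (Nm n f) = Nm n f"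
  by (induction k) (use assms La_Nm in auto)

lemma Nm_in: "f \<in> chains (lists_of_length n) \<Longrightarrow> Nm n f \<in> chains (lists_of_length n)"
  unfolding Nm_def by (intro pm.subspace_sum La_pow_in) auto

text \<open>The empty word is left out, so that words over disjoint alphabets stay disjoint at
  length 0 as well; cyclic cycles of degree 0 look at that length.\<close>

definition words :: "'b set \<Rightarrow> nat \<Rightarrow> 'b list set" where
  "words S m = {l. l \<noteq> [] \<and> length l = m \<and> set l \<subseteq> S}"

text \<open>
  The product \<open>dot a b\<close> is defined when \<open>ok a b\<close>; in the algebra with this basis all other products of
  basis elements are zero. On words of length \<open>n + 1\<close>, read as tensors of degree \<open>n\<close>, \<open>La\<close> is the signed
  cyclic operator, \<open>d0\<close> the first face, \<open>bp\<close> the bar differential \<open>b'\<close> and \<open>Db\<close> the Hochschild boundary \<open>b\<close>.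
\<close>

locale partial_semigroup =
  fixes ok :: "'b \<Rightarrow> 'b \<Rightarrow> bool" and dot :: "'b \<Rightarrow> 'b \<Rightarrow> 'b"
  assumes ok_assoc: "ok a b \<and> ok (dot a b) c \<longleftrightarrow> ok b c \<and> ok a (dot b c)"
    and dot_assoc: "ok a b \<Longrightarrow> ok (dot a b) c \<Longrightarrow> dot (dot a b) c = dot a (dot b c)"
begin

fun actl :: "'b \<Rightarrow> 'b list \<Rightarrow> ('b, 'k::field) chain" where
  "actl a [] = 0"
| "actl a (b # l) = (if ok a b then single (dot a b # l) 1 else 0)"

definition act :: "'b \<Rightarrow> ('b, 'k::field) chain \<Rightarrow> ('b, 'k) chain" where
  "act a = ext (actl a)"

primrec bpl :: "'b list \<Rightarrow> ('b, 'k::field) chain" where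
  "bpl [] = 0"
| "bpl (a # l) = actl a l - cns a (bpl l)"

definition bp :: "('b, 'k::field) chain \<Rightarrow> ('b, 'k) chain" where
  "bp = ext bpl"

primrec d0l :: "'b list \<Rightarrow> ('b, 'k::field) chain" where
  "d0l [] = 0"
| "d0l (a # l) = actl a l"

definition d0 :: "('b, 'k::field) chain \<Rightarrow> ('b, 'k) chain" where
  "d0 = ext d0l"

text \<open>The cyclic face is the first face of the rotated word; the sign built into
  \<open>Lal\<close> is exactly its sign (-1)^n.\<close>

definition Dl :: "'b list \<Rightarrow> ('b, 'k::field) chain" where
  "Dl l = bpl l + d0 (Lal l)"

definition Db :: "('b, 'k::field) chain \<Rightarrow> ('b, 'k) chain" where
  "Db = ext Dl"

lemma act_simps [simp]:
  "act a 0 = 0" "act a (f + g) = act a f + act a g" "act a (f - g) = act a f - act a g"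
  "act a (- f) = - act a f" "act a (pm_scale c f) = pm_scale c (act a f)"
  "act a (single l c) = pm_scale c (actl a l)"
  by (simp_all add: act_def)

lemma bp_simps [simp]:
  "bp 0 = 0" "bp (f + g) = bp f + bp g" "bp (f - g) = bp f - bp g"
  "bp (- f) = - bp f" "bp (pm_scale c f) = pm_scale c (bp f)"
  "bp (single l c) = pm_scale c (bpl l)" "bp (sum F A) = (\<Sum>x\<in>A. bp (F x))"
  by (simp_all add: bp_def)

lemma d0_simps [simp]:
  "d0 0 = 0" "d0 (f + g) = d0 f + d0 g" "d0 (f - g) = d0 f - d0 g"
  "d0 (- f) = - d0 f" "d0 (pm_scale c f) = pm_scale c (d0 f)"
  "d0 (single l c) = pm_scale c (d0l l)" "d0 (sum F A) = (\<Sum>x\<in>A. d0 (F x))"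
  by (simp_all add: d0_def)

lemma Db_simps [simp]:
  "Db 0 = 0" "Db (f + g) = Db f + Db g" "Db (f - g) = Db f - Db g"
  "Db (- f) = - Db f" "Db (pm_scale c f) = pm_scale c (Db f)" "Db (sum F A) = (\<Sum>x\<in>A. Db (F x))"
  by (simp_all add: Db_def)

section \<open>Relations between faces, rotation and the two differentials\<close>

lemma Db_eq: "Db f = bp f + d0 (La f)"
proof (rule lin_eqI[of f UNIV])
  show "Db (single l 1) = bp (single l 1) + d0 (La (single l 1))" for l
    by (simp add: Db_def Dl_def)
qed (simp_all add: pm.scale_right_distrib)

lemma act_actl: "act a (actl b l) = (if ok a b then actl (dot a b) l else 0)"
  using ok_assoc[of a b] dot_assoc[of a b] by (cases l) auto

lemma act_cns: "act a (cns b f) = (if ok a b then cns (dot a b) f else 0)"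
  by (rule lin_eqI[of f UNIV]) simp_all

lemma bp_cns: "bp (cns a f) = act a f - cns a (bp f)"
  by (rule lin_eqI[of f UNIV]) (simp_all add: pm.scale_right_diff_distrib)

lemma bp_actl: "bp (actl a l) = act a (bpl l)"
  by (cases l) (auto simp: act_actl act_cns)

lemma bp_bpl: "bp (bpl l) = 0"
  by (induction l) (simp_all add: bp_actl bp_cns)

lemma bp_bp: "bp (bp f) = 0"
  by (rule lin_eqI[of f UNIV]) (simp_all add: bp_bpl)

lemma d0_cns: "d0 (cns a f) = act a f"
  by (rule lin_eqI[of f UNIV]) simp_all

lemma bp_d0: "bp (d0 f) + d0 (bp f) = d0 (d0 f)"
proof (rule lin_eqI[of f UNIV])
  show "bp (d0 (single l 1)) + d0 (bp (single l 1)) = d0 (d0 (single l 1))" for l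
    by (cases l) (simp_all add: bp_actl d0_cns)
qed (simp_all add: pm.scale_right_distrib)

lemma actl_chains: "(\<And>b l'. l = b # l' \<Longrightarrow> ok a b \<Longrightarrow> dot a b # l' \<in> Q) \<Longrightarrow> actl a l \<in> chains Q"
  by (cases l) auto

lemma d0_chains:
  assumes "f \<in> chains P" "\<And>a b l. a # b # l \<in> P \<Longrightarrow> ok a b \<Longrightarrow> dot a b # l \<in> Q"
  shows "d0 f \<in> chains Q"
  unfolding d0_def
proof (rule ext_in[OF assms(1)])
  fix l assume "l \<in> P"
  then show "d0l l \<in> chains Q"
    using assms(2) by (cases l) (auto intro!: actl_chains)
qed simp

lemma bpl_chains:
  assumes "\<And>u a b v. l = u @ a # b # v \<Longrightarrow> ok a b \<Longrightarrow> u @ dot a b # v \<in> Q"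
  shows "(bpl l :: ('b, 'k::field) chain) \<in> chains Q"
  using assms
proof (induction l arbitrary: Q)
  case (Cons a l)
  have "(bpl l :: ('b, 'k) chain) \<in> chains {m. a # m \<in> Q}"
  proof (rule Cons.IH)
    fix u c d v assume "l = u @ c # d # v" "ok c d"
    then show "u @ dot c d # v \<in> {m. a # m \<in> Q}"
      using Cons.prems[of "a # u" c d v] by simp
  qed
  then have "(cns a (bpl l) :: ('b, 'k) chain) \<in> chains Q"
    by (rule cns_chains) simp
  moreover have "(actl a l :: ('b, 'k) chain) \<in> chains Q"
    using Cons.prems[of "[]"] by (intro actl_chains) simp
  ultimately show ?case by auto
qed auto

lemma bp_chains:
  assumes "f \<in> chains P" "\<And>u a b v. u @ a # b # v \<in> P \<Longrightarrow> ok a b \<Longrightarrow> u @ dot a b # v \<in> Q"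
  shows "bp f \<in> chains Q"
  unfolding bp_def by (rule ext_in[OF assms(1)]) (use assms(2) in \<open>auto intro!: bpl_chains\<close>)

lemma Db_chains:
  assumes "f \<in> chains P" "\<And>u a b v. u @ a # b # v \<in> P \<Longrightarrow> ok a b \<Longrightarrow> u @ dot a b # v \<in> Q"
    "\<And>a l b. a # l @ [b] \<in> P \<Longrightarrow> ok b a \<Longrightarrow> dot b a # l \<in> Q"
  shows "Db f \<in> chains Q"
proof -
  have "La f \<in> chains {l. case l of b # a # l' \<Rightarrow> a # l' @ [b] \<in> P | _ \<Rightarrow> True}"
    by (rule La_chains[OF assms(1)]) (auto split: list.splits)
  then have "d0 (La f) \<in> chains Q"
    by (rule d0_chains) (use assms(3) in auto)
  then show ?thesis
    unfolding Db_eq using bp_chains[OF assms(1,2)] by auto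
qed

lemma bpl_length: "bpl l \<in> chains (lists_of_length (length l - 1))"
  by (rule bpl_chains) auto

lemma d0_length: "f \<in> chains (lists_of_length n) \<Longrightarrow> d0 f \<in> chains (lists_of_length (n - 1))"
  by (erule d0_chains) auto

lemma snc_actl: "l \<noteq> [] \<Longrightarrow> snc z (actl a l) = actl a (l @ [z])"
  by (cases l) auto

lemma bpl_snoc:
  "bpl (l @ [z]) = snc z (bpl l) + (if l \<noteq> [] \<and> ok (last l) z
     then single (butlast l @ [dot (last l) z]) ((- 1) ^ (length l - 1)) else 0)"
proof (induction l)
  case (Cons a l)
  show ?case
  proof (cases "l = []")
    case False
    then have "(- 1 :: 'a) ^ (length l - 1) = - ((- 1) ^ length l)"
      by (cases l) auto
    then show ?thesis using False
      by (simp add: Cons snc_actl[symmetric] snc_cns single_uminus del: bpl.simps(1))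
  qed simp
qed simp

text \<open>The inner faces of the rotated word are its first face, namely the wrapped one, followed
  by the inner faces that avoid the last letter of the original word. The inner face that uses this
  last letter is missing there and is the first face after two rotations.\<close>

lemma La_bp: "La (bp f) = bp (La f) + d0 (La (La f)) - d0 (La f)"
proof (rule lin_eqI[of f UNIV])
  fix l :: "'b list"
  show "La (bp (single l 1)) = bp (La (single l 1)) +
    d0 (La (La (single l 1))) - d0 (La (single l (1::'a)))"
  proof (cases l rule: rev_cases)
    case (snoc m z)
    show ?thesis
    proof (cases "m = []")
      case True
      then show ?thesis using snoc by (simp add: Lal_def)
    next
      case False
      have "La (snc z (bpl m)) = pm_scale ((- 1) ^ (length m - 1)) (cns z (bpl m) :: ('b, 'a) chain)"
        by (rule La_snc[OF bpl_length])
      moreover have "Lal (z # m) = single (last m # z # butlast m) ((- 1 :: 'a) ^ length m)"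
        using Lal_snoc[of "z # butlast m" "last m"] False by simp
      moreover have "(- 1 :: 'a) ^ length m = - ((- 1) ^ (length m - 1))"
        using False by (cases m) auto
      ultimately show ?thesis
        using snoc False
        by (simp add: bpl_snoc pm.scale_right_diff_distrib power_mult_distrib[symmetric])
    qed
  qed simp
qed (simp_all add: pm.scale_right_distrib pm.scale_right_diff_distrib algebra_simps)

text \<open>Both sides fuse the last letter with the first two, and associativity makes the results
  agree. The sign comes from rotating a word that is one letter shorter on the right.\<close>

lemma d0_d0_La: "d0 (d0 (La f)) = - d0 (La (d0 f))"
proof (rule lin_eqI[of f UNIV])
  fix l :: "'b list"
  show "d0 (d0 (La (single l 1))) = - d0 (La (d0 (single l (1::'a))))"
  proof (cases l rule: rev_cases)
    case (snoc m z)
    show ?thesis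
    proof (cases "length m \<le> 1")
      case True
      then show ?thesis using snoc by (cases m) (auto simp: Lal_def)
    next
      case False
      then obtain a b m' where m: "m = a # b # m'" by (metis One_nat_def le_numeral_extra(4) length_Cons less_imp_le_nat list.exhaust list.size(3) not_le zero_less_one)
      have "Lal (dot a b # m' @ [z]) = single (z # dot a b # m') ((- 1 :: 'a) ^ Suc (length m'))"
        using Lal_snoc[of "dot a b # m'" z] by simp
      moreover have "Lal (a # b # m' @ [z]) = single (z # a # b # m') ((- 1 :: 'a) ^ length m')"
        using Lal_snoc[of "a # b # m'" z] by simp
      ultimately show ?thesis
        using snoc m ok_assoc[of z a b] dot_assoc[of z a b] by (auto simp: single_uminus)
    qed
  qed simp
qed simp_all

lemma Db_Db: "Db (Db f) = 0"
proof -
  have "Db (Db f) = bp (d0 (La f)) + d0 (La (bp f)) + d0 (La (d0 (La f)))"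
    by (simp add: Db_eq bp_bp)
  also have "\<dots> = bp (d0 (La f)) + d0 (bp (La f)) - d0 (d0 (La f)) + d0 (d0 (La (La f))) + d0 (La (d0 (La f)))"
    by (simp add: La_bp)
  finally show ?thesis
    by (simp add: bp_d0 d0_d0_La)
qed

text \<open>Compatibility of the first two columns of Tsygan's bicomplex; it also lets
  \<open>Db\<close> descend to Connes' quotient.\<close>

lemma Db_one_minus_La: "Db (f - La f) = bp f - La (bp f)"
  by (simp add: Db_eq La_bp)

text \<open>The first k signed faces of the bar differential, cut off so that an induction on k can
  shift faces by rotation without meeting the end of the word.\<close>

primrec bpkl :: "nat \<Rightarrow> 'b list \<Rightarrow> ('b, 'k::field) chain" where
  "bpkl 0 l = 0"
| "bpkl (Suc k) l = (case l of [] \<Rightarrow> 0 | a # m \<Rightarrow> actl a m - cns a (bpkl k m))"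

lemma bpkl_eq_bpl: "length l \<le> Suc k \<Longrightarrow> bpkl k l = bpl l"
  by (induction k arbitrary: l) (auto simp: le_Suc_eq length_Suc_conv split: list.splits)

lemma bpkl_snoc: "k < length l \<Longrightarrow> bpkl k (l @ [z]) = snc z (bpkl k l)"
proof (induction k arbitrary: l)
  case (Suc k)
  then obtain a m where l: "l = a # m" "k < length m" by (cases l) auto
  then have "m \<noteq> []" by auto
  then show ?case using l Suc.IH[of m] by (simp add: snc_actl snc_cns)
qed simp

lemma bpkl_Nil [simp]: "bpkl k [] = 0"
  by (cases k) simp_all

lemma bpkl_length: "(bpkl k l :: ('b, 'k::field) chain) \<in> chains (lists_of_length (length l - 1))"
proof (induction k arbitrary: l)
  case (Suc k)
  show ?case
  proof (cases l)
    case (Cons a m)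
    have "(cns a (bpkl k m) :: ('b, 'k) chain) \<in> chains (lists_of_length (length m))"
      by (cases m) (auto intro!: cns_chains[OF Suc.IH])
    moreover have "(actl a m :: ('b, 'k) chain) \<in> chains (lists_of_length (length m))"
      by (auto intro!: actl_chains)
    ultimately show ?thesis using Cons by auto
  qed auto
qed auto

text \<open>\<open>Suc k < n\<close> keeps the last letter out of reach of the first k faces.
  Bringing it to the front turns them into faces 1 to k, so the new face 0 has to be
  removed.\<close>

lemma La_bpk:
  assumes "f \<in> chains (lists_of_length n)" "Suc k < n"
  shows "La (ext (bpkl k) f) = ext (bpkl (Suc k)) (La f) - d0 (La f)"
proof (rule lin_eqI[OF assms(1)])
  fix l :: "'b list" assume "l \<in> lists_of_length n"
  then obtain m z where l: "l = m @ [z]" "Suc k \<le> length m"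
    using assms(2) by (cases l rule: rev_cases) auto
  have "La (snc z (bpkl k m)) = pm_scale ((- 1) ^ (length m - 1)) (cns z (bpkl k m) :: ('b, 'a) chain)"
    by (rule La_snc[OF bpkl_length])
  moreover have "(- 1 :: 'a) ^ length m = - ((- 1) ^ (length m - 1))"
    using l by (cases m) auto
  ultimately show "La (ext (bpkl k) (single l 1)) =
      ext (bpkl (Suc k)) (La (single l 1)) - d0 (La (single l (1::'a)))"
    using l by (simp add: bpkl_snoc pm.scale_right_diff_distrib)
qed (simp_all add: pm.scale_right_diff_distrib)

text \<open>The i-th signed face is the first face conjugated by \<open>La ^^ i\<close>; the inverse
  power is written \<open>La ^^ (n - i)\<close>, a full turn being the identity.\<close>

lemma bpk_eq:
  assumes "f \<in> chains (lists_of_length n)" "k < n"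
  shows "ext (bpkl k) f = (\<Sum>i<k. (La ^^ i) (d0 ((La ^^ (n - i)) f)))"
  using assms
proof (induction k arbitrary: f)
  case (Suc k)
  let ?g = "(La ^^ (n - 1)) f"
  have "La ?g = (La ^^ Suc (n - 1)) f" by simp
  then have g: "La ?g = f" using La_pow_length[OF Suc.prems(1)] Suc.prems(2) by simp
  have gin: "?g \<in> chains (lists_of_length n)" by (rule La_pow_in[OF Suc.prems(1)])
  have "ext (bpkl (Suc k)) f = La (ext (bpkl k) ?g) + d0 f"
    using La_bpk[OF gin Suc.prems(2)] g by simp
  also have "ext (bpkl k) ?g = (\<Sum>i<k. (La ^^ i) (d0 ((La ^^ (n - i)) ?g)))"
    using Suc.IH[OF gin] Suc.prems(2) by simp
  also have "\<dots> = (\<Sum>i<k. (La ^^ i) (d0 ((La ^^ (n - Suc i)) f)))"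
  proof (rule sum.cong[OF refl])
    fix i assume "i \<in> {..<k}"
    then have i: "n - i + (n - 1) = (n - Suc i) + n" using Suc.prems(2) by auto
    have "(La ^^ (n - i)) ?g = (La ^^ (n - i + (n - 1))) f"
      by (simp only: funpow_add o_def)
    also have "\<dots> = (La ^^ (n - Suc i)) ((La ^^ n) f)"
      unfolding i by (simp only: funpow_add o_def)
    finally show "(La ^^ i) (d0 ((La ^^ (n - i)) ?g)) = (La ^^ i) (d0 ((La ^^ (n - Suc i)) f))"
      using La_pow_length[OF Suc.prems(1)] by simp
  qed
  also have "La \<dots> = (\<Sum>i<k. (La ^^ Suc i) (d0 ((La ^^ (n - Suc i)) f)))"
    by simp
  finally show ?case
    using La_pow_length[OF Suc.prems(1)] by (simp only: sum.lessThan_Suc_shift funpow_0 diff_zero add.commute)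
qed (simp add: ext_def)

lemma bp_eq_sum:
  assumes "f \<in> chains (lists_of_length n)" "0 < n"
  shows "bp f = (\<Sum>i<n - 1. (La ^^ i) (d0 ((La ^^ (n - i)) f)))"
proof -
  have "bp f = ext (bpkl (n - 1)) f"
    unfolding bp_def by (rule ext_cong_chains[OF assms(1)]) (simp add: bpkl_eq_bpl)
  then show ?thesis using bpk_eq[OF assms(1), of "n - 1"] assms(2) by simp
qed

text \<open>Every face is a conjugate of \<open>d0\<close>, and a norm on either side absorbs
  rotations. Both sides therefore equal \<open>Nm (n - 1) (d0 (Nm n f))\<close>; on the left the
  exponents of \<open>La\<close> run through 1 to n, the exponent 1 being the cyclic face.\<close>

lemma Nm_Db:
  assumes f: "f \<in> chains (lists_of_length n)" and n: "0 < n"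
  shows "Nm (n - 1) (Db f) = bp (Nm n f)"
proof -
  have din: "d0 ((La ^^ j) f) \<in> chains (lists_of_length (n - 1))" for j
    by (intro d0_length La_pow_in f)
  have "bp (Nm n f) = (\<Sum>i<n - 1. (La ^^ i) (d0 (Nm n f)))"
    using bp_eq_sum[OF Nm_in[OF f] n] La_pow_Nm[OF f] by simp
  then have 1: "bp (Nm n f) = Nm (n - 1) (d0 (Nm n f))"
    by (simp add: Nm_def)
  have "Nm (n - 1) (Db f) = Nm (n - 1) (\<Sum>i<n - 1. (La ^^ i) (d0 ((La ^^ (n - i)) f))) + Nm (n - 1) (d0 (La f))"
    by (simp only: Db_eq bp_eq_sum[OF f n] Nm_simps)
  also have "\<dots> = (\<Sum>i<n - 1. Nm (n - 1) (d0 ((La ^^ (n - i)) f))) + Nm (n - 1) (d0 (La f))"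
    by (simp only: Nm_simps(5) Nm_La_pow[OF din])
  also have "\<dots> = (\<Sum>i<n. Nm (n - 1) (d0 ((La ^^ (n - i)) f)))"
    using n by (cases n) (simp_all add: Suc_diff_le)
  also have "\<dots> = Nm (n - 1) (d0 (\<Sum>i<n. (La ^^ (n - i)) f))"
    by simp
  also have "(\<Sum>i<n. (La ^^ (n - i)) f) = (\<Sum>i<n. (La ^^ Suc i) f)"
    by (rule sum.reindex_bij_witness[of _ "\<lambda>i. n - Suc i" "\<lambda>i. n - Suc i"]) (auto simp: Suc_diff_Suc)
  also have "\<dots> = Nm n (La f)"
    by (simp add: Nm_def funpow_swap1)
  finally show ?thesis
    using 1 Nm_La[OF f] by simp
qed

lemma bp_singletons: "f \<in> chains (lists_of_length (Suc 0)) \<Longrightarrow> bp f = 0"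
  by (rule lin_eqI[of f "lists_of_length (Suc 0)" bp "\<lambda>_. 0"]) (auto simp: length_Suc_conv)

lemma Db_singletons: "f \<in> chains (lists_of_length (Suc 0)) \<Longrightarrow> Db f = 0"
  by (rule lin_eqI[of f "lists_of_length (Suc 0)" Db "\<lambda>_. 0"])
    (auto simp: length_Suc_conv Db_eq Lal_def pm.scale_right_distrib)

section \<open>Cycles and boundaries over a family of word sets\<close>

definition hhZ :: "(nat \<Rightarrow> 'b list set) \<Rightarrow> nat \<Rightarrow> ('b, 'k::field) chain set" where
  "hhZ P n = {v \<in> chains (P (Suc n)). Db v = 0}"

definition hhB :: "(nat \<Rightarrow> 'b list set) \<Rightarrow> nat \<Rightarrow> ('b, 'k::field) chain set" where
  "hhB P n = Db ` chains (P (Suc (Suc n)))"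

text \<open>Indexed by word length, whereas \<open>hhZ\<close>, \<open>hhB\<close>,
  \<open>hcZ\<close> and \<open>hcB\<close> are indexed by degree: the boundary of a chain of degree
  n has words of length n and is compared with \<open>cycB P n\<close>.\<close>

definition cycB :: "(nat \<Rightarrow> 'b list set) \<Rightarrow> nat \<Rightarrow> ('b, 'k::field) chain set" where
  "cycB P m = (\<lambda>v. v - La v) ` chains (P m)"

definition hcZ :: "(nat \<Rightarrow> 'b list set) \<Rightarrow> nat \<Rightarrow> ('b, 'k::field) chain set" where
  "hcZ P n = {v \<in> chains (P (Suc n)). Db v \<in> cycB P n}"

definition hcB :: "(nat \<Rightarrow> 'b list set) \<Rightarrow> nat \<Rightarrow> ('b, 'k::field) chain set" where
  "hcB P n = {w + u |w u. w \<in> cycB P (Suc n) \<and> u \<in> hhB P n}"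

end


section \<open>Tensor powers in coordinates\<close>

lemma presents_finsum:
  assumes P: "presents M V W q" and h: "\<And>x. x \<in> X \<Longrightarrow> h x \<in> V" and "finite X"
  shows "(\<Oplus>\<^bsub>M\<^esub>x\<in>X. q (h x)) = q (\<Sum>x\<in>X. h x)"
proof -
  interpret abelian_group M by (rule presents_abelian_group[OF P])
  note p = presentsD[OF P]
  show ?thesis
    using assms(3) h
  proof (induction X rule: finite_induct)
    case empty
    then show ?case using p(7) by simp
  next
    case (insert x X)
    then have "(\<Sum>x\<in>X. h x) \<in> V" by (intro pm.subspace_sum p(1)) auto
    moreover have "(\<lambda>x. q (h x)) \<in> X \<rightarrow> carrier M" using insert p(9) by auto
    ultimately show ?case using insert p(5,9) by (simp add: finsum_insert)
  qed
qed

lemma presents_smult_closed: "presents M V W q \<Longrightarrow> v \<in> V \<Longrightarrow> c \<odot>\<^bsub>M\<^esub> q v \<in> carrier M"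
  by (metis presentsD(1,6,9) pm.subspace_scale)

lemma lin_ext_presents:
  assumes P: "presents M V W q" and "f \<in> chains Q" and "\<And>x. x \<in> Q \<Longrightarrow> g x \<in> V" "\<And>x. x \<in> Q \<Longrightarrow> \<phi> x = q (g x)"
  shows "lin_ext M \<phi> f = q (ext g f)"
proof -
  interpret abelian_group M by (rule presents_abelian_group[OF P])
  note p = presentsD[OF P]
  have k: "x \<in> Q" if "x \<in> keys f" for x
    using assms(2) that by (rule keys_in)
  have "lin_ext M \<phi> f = (\<Oplus>\<^bsub>M\<^esub>x\<in>keys f. q (pm_scale (lookup f x) (g x)))"
    unfolding lin_ext_def using k assms(3,4) p(6)
    by (intro finsum_cong') (auto simp: Pi_def presents_smult_closed[OF P])
  also have "\<dots> = q (\<Sum>x\<in>keys f. pm_scale (lookup f x) (g x))"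
    using k assms(3) pm.subspace_scale[OF p(1)] by (intro presents_finsum[OF P]) auto
  finally show ?thesis by (simp add: ext_def)
qed

lemma presents_free_space: "presents (free_space P) (chains P) {0} (\<lambda>f. f)"
  by (auto simp: presents_def free_space_def chains_def[symmetric])

lemma the_elem_image_const:
  assumes "X \<noteq> {}" "\<And>x. x \<in> X \<Longrightarrow> f x = c"
  shows "the_elem (f ` X) = c"
proof -
  have "f ` X = {c}" using assms by auto
  then show ?thesis by simp
qed

text \<open>An algebra with a basis closed, up to 0, under multiplication. The groupoid algebra, the
  group algebras, the unitization and the ground field are all instances with the same
  \<open>ok\<close> and \<open>dot\<close>, so their chains can be compared inside one space of
  words.\<close>

locale based_algebra = partial_semigroup ok dot
  for ok :: "'b \<Rightarrow> 'b \<Rightarrow> bool" and dot :: "'b \<Rightarrow> 'b \<Rightarrow> 'b" +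
  fixes A :: "('k::field, 'a) module" and S :: "'b set"
    and coord :: "'a \<Rightarrow> 'b \<Rightarrow>\<^sub>0 'k" and bas :: "'b \<Rightarrow> 'a"
  assumes add_in: "a \<in> carrier A \<Longrightarrow> b \<in> carrier A \<Longrightarrow> a \<oplus>\<^bsub>A\<^esub> b \<in> carrier A"
    and smult_in: "a \<in> carrier A \<Longrightarrow> c \<odot>\<^bsub>A\<^esub> a \<in> carrier A"
    and mult_in: "a \<in> carrier A \<Longrightarrow> b \<in> carrier A \<Longrightarrow> a \<otimes>\<^bsub>A\<^esub> b \<in> carrier A"
    and zero_in: "\<zero>\<^bsub>A\<^esub> \<in> carrier A"
    and bas_in: "s \<in> S \<Longrightarrow> bas s \<in> carrier A"
    and dot_in: "s \<in> S \<Longrightarrow> t \<in> S \<Longrightarrow> ok s t \<Longrightarrow> dot s t \<in> S"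
    and coord_in: "a \<in> carrier A \<Longrightarrow> coord a \<in> chains S"
    and coord_inj: "inj_on coord (carrier A)"
    and coord_zero: "coord \<zero>\<^bsub>A\<^esub> = 0"
    and coord_add: "a \<in> carrier A \<Longrightarrow> b \<in> carrier A \<Longrightarrow> coord (a \<oplus>\<^bsub>A\<^esub> b) = coord a + coord b"
    and coord_smult: "a \<in> carrier A \<Longrightarrow> coord (c \<odot>\<^bsub>A\<^esub> a) = pm_scale c (coord a)"
    and coord_bas: "s \<in> S \<Longrightarrow> coord (bas s) = single s 1"
    and coord_mult: "a \<in> carrier A \<Longrightarrow> b \<in> carrier A \<Longrightarrow> coord (a \<otimes>\<^bsub>A\<^esub> b) =
      ext (\<lambda>s. ext (\<lambda>t. if ok s t then single (dot s t) 1 else 0) (coord b)) (coord a)"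
begin

text \<open>\<open>T as\<close> is the coordinate vector of the tensor of \<open>as\<close> in the basis of words; the relations of
  multilinearity are the kernel of its linear extension.\<close>

primrec T :: "'a list \<Rightarrow> ('b, 'k) chain" where
  "T [] = single [] 1"
| "T (a # as) = ext (\<lambda>s. cns s (T as)) (coord a)"

definition blists :: "nat \<Rightarrow> 'b list set" where
  "blists m = {l. length l = m \<and> set l \<subseteq> S}"

definition lft :: "('b, 'k) chain \<Rightarrow> ('a, 'k) chain" where
  "lft = ext (\<lambda>l. single (map bas l) 1)"

lemma lft_simps [simp]:
  "lft 0 = 0" "lft (f + g) = lft f + lft g" "lft (f - g) = lft f - lft g"
  "lft (pm_scale c f) = pm_scale c (lft f)" "lft (single l c) = single (map bas l) c"
  by (simp_all add: lft_def)

lemma T_in: "set as \<subseteq> carrier A \<Longrightarrow> T as \<in> chains (blists (length as))"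
proof (induction as)
  case (Cons a as)
  then have "T as \<in> chains (blists (length as))" by simp
  then have "cns s (T as) \<in> chains (blists (length (a # as)))" if "s \<in> S" for s
    by (rule cns_chains) (use that in \<open>auto simp: blists_def\<close>)
  then show ?case
    using Cons.prems coord_in[of a] by (auto intro!: ext_in)
qed (auto simp: blists_def)

lemma T_map_bas: "set l \<subseteq> S \<Longrightarrow> T (map bas l) = single l 1"
  by (induction l) (simp_all add: coord_bas)

lemma T_add:
  assumes "a \<in> carrier A" "b \<in> carrier A"
  shows "T (u @ (a \<oplus>\<^bsub>A\<^esub> b) # v) = T (u @ a # v) + T (u @ b # v)"
  by (induction u) (simp_all add: coord_add assms ext_fun_add)

lemma T_smult:
  assumes "a \<in> carrier A"
  shows "T (u @ (c \<odot>\<^bsub>A\<^esub> a) # v) = pm_scale c (T (u @ a # v))"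
  by (induction u) (simp_all add: coord_smult assms ext_fun_scale)

lemma ext_T_rels:
  assumes "f \<in> multilin_rels A n"
  shows "ext T f = 0"
proof -
  have sub: "pm.subspace {f. ext T f = 0}" by (simp add: pm.subspace_def)
  have "multilin_gens A n \<subseteq> {f. ext T f = 0}"
    by (auto simp: multilin_gens_def tuples_def T_add T_smult)
  from pm.span_minimal[OF this sub] show ?thesis
    using assms by (auto simp: multilin_rels_def)
qed

lemma subspace_rels: "pm.subspace (multilin_rels A n)"
  unfolding multilin_rels_def by (rule pm.subspace_span)

lemma rels_chains: "multilin_rels A n \<subseteq> chains (tuples A n)"
proof -
  have "multilin_gens A n \<subseteq> chains (tuples A n)"
    unfolding multilin_gens_def
    by (auto intro!: chains_closed simp: tuples_def add_in smult_in)
  from pm.span_minimal[OF this subspace_chains] show ?thesis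
    by (simp add: multilin_rels_def)
qed

lemma rels_add: "u @ a # v \<in> tuples A n \<Longrightarrow> b \<in> carrier A \<Longrightarrow>
    single (u @ (a \<oplus>\<^bsub>A\<^esub> b) # v) 1 - single (u @ a # v) 1
      - single (u @ b # v) 1 \<in> multilin_rels A n"
  unfolding multilin_rels_def multilin_gens_def by (rule pm.span_base) blast

lemma rels_smult: "u @ a # v \<in> tuples A n \<Longrightarrow>
    single (u @ (c \<odot>\<^bsub>A\<^esub> a) # v) 1 - single (u @ a # v) c \<in> multilin_rels A n"
  unfolding multilin_rels_def multilin_gens_def by (rule pm.span_base) blast

text \<open>An element with the given coordinates is assembled together with its expansion, by
  induction on the coordinate vector; injectivity of \<open>coord\<close> then shows that it was
  \<open>a\<close>. This avoids finite sums in \<open>A\<close>, for which no group laws are at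
  hand.\<close>

lemma expand_coord:
  assumes a: "a \<in> carrier A" and uv: "set u \<subseteq> carrier A" "set v \<subseteq> carrier A" "length u + length v = n"
  shows "single (u @ a # v) 1 - ext (\<lambda>s. single (u @ bas s # v) 1) (coord a)
    \<in> multilin_rels A n"
proof -
  let ?E = "ext (\<lambda>s. single (u @ bas s # v) (1 :: 'k))"
  have tup: "u @ x # v \<in> tuples A n" if "x \<in> carrier A" for x
    using that uv by (simp add: tuples_def)
  have "\<exists>a'\<in>carrier A. coord a' = f \<and> single (u @ a' # v) 1 - ?E f \<in> multilin_rels A n"
    if "f \<in> chains S" for f
    using that
  proof (induction rule: chains_induct)
    case zero
    \<comment> \<open>Not an axiom here, but both sides have coordinate vector 0.\<close>
    have "0 \<odot>\<^bsub>A\<^esub> \<zero>\<^bsub>A\<^esub> = \<zero>\<^bsub>A\<^esub>"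
      using coord_inj zero_in smult_in[OF zero_in, of 0] coord_smult[OF zero_in, of 0] coord_zero
      by (auto dest!: inj_onD[of coord "carrier A" "0 \<odot>\<^bsub>A\<^esub> \<zero>\<^bsub>A\<^esub>" "\<zero>\<^bsub>A\<^esub>"])
    then show ?case
      using rels_smult[OF tup[OF zero_in], of 0] zero_in coord_zero by auto
  next
    case (add s c f)
    then obtain b where b: "b \<in> carrier A" "coord b = f"
      "single (u @ b # v) 1 - ?E f \<in> multilin_rels A n" by blast
    let ?s = "c \<odot>\<^bsub>A\<^esub> bas s"
    have s: "?s \<in> carrier A" using bas_in smult_in add(1) by blast
    have "single (u @ (?s \<oplus>\<^bsub>A\<^esub> b) # v) 1 - ?E (single s c + f) =
      (single (u @ (?s \<oplus>\<^bsub>A\<^esub> b) # v) 1 - single (u @ ?s # v) 1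
        - single (u @ b # v) 1)
      + (single (u @ ?s # v) 1 - single (u @ bas s # v) c)
      + (single (u @ b # v) 1 - ?E f)"
      by simp
    also have "\<dots> \<in> multilin_rels A n"
      by (intro pm.subspace_add[OF subspace_rels] rels_add rels_smult tup s b bas_in add)
    finally show ?case
      using b s add(1) by (intro bexI[of _ "?s \<oplus>\<^bsub>A\<^esub> b"]) (auto simp: add_in coord_add coord_smult coord_bas bas_in)
  qed
  from this[OF coord_in[OF a]] obtain a' where "a' \<in> carrier A" "coord a' = coord a"
    "single (u @ a' # v) 1 - ?E (coord a) \<in> multilin_rels A n" by blast
  moreover have "a' = a" using calculation(1,2) a coord_inj by (auto dest: inj_onD)
  ultimately show ?thesis by simp
qed

text \<open>The prefix \<open>bs\<close> holds the letters already replaced by basis elements;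
  generalising over it lets the induction expand one letter at a time.\<close>

lemma single_minus_lift_aux:
  assumes "set bs \<subseteq> S" "set as \<subseteq> carrier A" "length bs + length as = Suc n"
  shows "single (map bas bs @ as) 1 - ext (\<lambda>cs. single (map bas bs @ map bas cs) 1) (T as)
    \<in> multilin_rels A n"
  using assms
proof (induction as arbitrary: bs)
  case Nil
  then show ?case using pm.subspace_0[OF subspace_rels] by simp
next
  case (Cons a as)
  let ?x = "\<lambda>s. single (map bas bs @ bas s # as) (1 :: 'k)"
  let ?y = "\<lambda>s. ext (\<lambda>cs. single (map bas bs @ bas s # map bas cs) (1 :: 'k)) (T as)"
  have "?x s - ?y s \<in> multilin_rels A n" if "s \<in> S" for s
    using Cons.IH[of "bs @ [s]"] Cons.prems that by simp
  then have "ext (\<lambda>s. ?x s - ?y s) (coord a) \<in> multilin_rels A n"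
    using Cons.prems by (intro ext_in[OF coord_in] subspace_rels) auto
  moreover have "single (map bas bs @ a # as) 1 - ext ?x (coord a) \<in> multilin_rels A n"
    using Cons.prems bas_in by (intro expand_coord) auto
  ultimately have "(single (map bas bs @ a # as) 1 - ext ?x (coord a))
      + ext (\<lambda>s. ?x s - ?y s) (coord a) \<in> multilin_rels A n"
    by (intro pm.subspace_add[OF subspace_rels])
  also have "(single (map bas bs @ a # as) 1 - ext ?x (coord a)) + ext (\<lambda>s. ?x s - ?y s) (coord a)
      = single (map bas bs @ a # as) 1 - ext ?y (coord a)"
    by (simp add: ext_fun_diff)
  also have "ext ?y (coord a) = ext (\<lambda>cs. single (map bas bs @ map bas cs) 1) (T (a # as))"
    by (simp add: ext_ext cns_def)
  finally show ?case .
qed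

lemma minus_lift:
  assumes "f \<in> chains (tuples A n)"
  shows "f - lft (ext T f) \<in> multilin_rels A n"
proof -
  have "ext (\<lambda>as. single as 1 - lft (T as)) f \<in> multilin_rels A n"
    using single_minus_lift_aux[of "[]" _ n]
    by (intro ext_in[OF assms] subspace_rels) (auto simp: tuples_def lft_def)
  then show ?thesis
    by (simp add: ext_fun_diff lft_def ext_ext)
qed

lemma rels_iff:
  assumes "f \<in> chains (tuples A n)"
  shows "f \<in> multilin_rels A n \<longleftrightarrow> ext T f = 0"
  using ext_T_rels[of f n] minus_lift[OF assms] by auto

lemma lft_in:
  assumes "v \<in> chains (blists (Suc n))"
  shows "lft v \<in> chains (tuples A n)"
  unfolding lft_def
proof (rule ext_in[OF assms])
  fix l assume "l \<in> blists (Suc n)"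
  then have "map bas l \<in> tuples A n" by (auto simp: blists_def tuples_def intro!: bas_in)
  then show "single (map bas l) 1 \<in> chains (tuples A n)" by simp
qed simp

lemma T_tuples: "as \<in> tuples A n \<Longrightarrow> T as \<in> chains (blists (Suc n))"
  using T_in[of as] by (simp add: tuples_def)

lemma ext_T_lft: "v \<in> chains (blists m) \<Longrightarrow> ext T (lft v) = v"
  by (rule lin_eqI[of v "blists m"]) (auto simp: T_map_bas blists_def)

definition tup_coset :: "nat \<Rightarrow> ('a, 'k) chain \<Rightarrow> ('a, 'k) chain set" where
  "tup_coset n f = multilin_rels A n +>\<^bsub>(free_space (tuples A n) :: ('k, ('a, 'k) chain) module)\<^esub> f"

definition tclass :: "nat \<Rightarrow> ('b, 'k) chain \<Rightarrow> ('a, 'k) chain set" where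
  "tclass n v = tup_coset n (lft v)"

lemma pure_tensor_eq: "pure_tensor A n bs = tup_coset n (single bs 1)"
  by (simp add: pure_tensor_def tup_coset_def)

lemma presents_tuples: "presents (tensor_power A n) (chains (tuples A n)) (multilin_rels A n) (tup_coset n)"
  unfolding tensor_power_def tup_coset_def[abs_def]
  using pm.subspace_0[OF subspace_rels]
  by (intro presents_quot[OF presents_free_space] subspace_rels rels_chains) auto

lemma presents_tensor_power: "presents (tensor_power A n) (chains (blists (Suc n))) {0} (tclass n)"
proof -
  have "presents (tensor_power A n) (chains (blists (Suc n))) {0}
    (\<lambda>v. tup_coset n (ext (\<lambda>l. single (map bas l) 1) v))"
  proof (rule presents_transfer[OF presents_tuples subspace_chains])
    fix v :: "('b, 'k) chain" assume "v \<in> chains (blists (Suc n))"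
    then show "ext (\<lambda>l. single (map bas l) 1) v \<in> chains (tuples A n)"
      using lft_in by (simp add: lft_def)
  next
    fix f :: "('a, 'k) chain" assume f: "f \<in> chains (tuples A n)"
    then have "ext T f \<in> chains (blists (Suc n))"
      by (rule ext_in) (auto intro: T_tuples)
    then show "\<exists>v\<in>chains (blists (Suc n)). f - ext (\<lambda>l. single (map bas l) 1) v \<in> multilin_rels A n"
      using minus_lift[OF f] by (auto simp: lft_def)
  next
    have "v = 0" if "v \<in> chains (blists (Suc n))" "lft v \<in> multilin_rels A n" for v
      using ext_T_lft[OF that(1)] ext_T_rels[OF that(2)] by simp
    then show "{0} = {v \<in> chains (blists (Suc n)). ext (\<lambda>l. single (map bas l) 1) v \<in> multilin_rels A n}"
      using pm.subspace_0[OF subspace_rels] by (auto simp: lft_def)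
  qed
  then show ?thesis by (simp add: tclass_def[abs_def] lft_def)
qed

lemma tup_coset_eq_tclass:
  assumes "f \<in> chains (tuples A n)"
  shows "tup_coset n f = tclass n (ext T f)"
proof -
  have "ext T f \<in> chains (blists (Suc n))"
    by (rule ext_in[OF assms]) (auto intro: T_tuples)
  then show ?thesis
    unfolding tclass_def
    using presents_eq_iff[OF presents_tuples assms lft_in] minus_lift[OF assms] by blast
qed

text \<open>\<open>tensor_ext\<close> takes the unique value on a coset, so the content is that
  \<open>lin_ext\<close> is constant there. A formula \<open>g\<close> on representatives that sends
  the multilinear relations into \<open>W\<close> provides this.\<close>

lemma tensor_ext_tup_coset:
  assumes P: "presents M V W p" and g: "\<And>bs. bs \<in> tuples A n \<Longrightarrow> g bs \<in> V"
    and \<phi>: "\<And>bs. bs \<in> tuples A n \<Longrightarrow> \<phi> bs = p (g bs)"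
    and rel: "\<And>r. r \<in> multilin_rels A n \<Longrightarrow> ext g r \<in> W" and f: "f \<in> chains (tuples A n)"
  shows "tensor_ext M \<phi> (tup_coset n f) = p (ext g f)"
proof -
  have tc: "tup_coset n f = {r + f |r. r \<in> multilin_rels A n}"
    by (auto simp: tup_coset_def a_r_coset_def' free_space_def)
  show ?thesis
    unfolding tensor_ext_def
  proof (rule the_elem_image_const)
    show "tup_coset n f \<noteq> {}" using tc pm.subspace_0[OF subspace_rels] by auto
    fix x assume "x \<in> tup_coset n f"
    then obtain r where r: "r \<in> multilin_rels A n" "x = r + f" using tc by auto
    then have x: "x \<in> chains (tuples A n)" using rels_chains f by (auto intro!: chains_closed)
    have "ext g x \<in> V" "ext g f \<in> V"
      using x f g presentsD(1)[OF P] by (auto intro!: ext_in)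
    then have "p (ext g x) = p (ext g f)"
      using presents_eq_iff[OF P] r rel by simp
    then show "lin_ext M \<phi> x = p (ext g f)"
      using lin_ext_presents[OF P x g \<phi>] by simp
  qed
qed

section \<open>Faces, rotation and boundary in coordinates\<close>

lemma T_mult:
  assumes "a \<in> carrier A" "b \<in> carrier A"
  shows "ext (\<lambda>s. act s (T (b # cs))) (coord a) = T ((a \<otimes>\<^bsub>A\<^esub> b) # cs)"
proof -
  have "act s (ext (\<lambda>t. cns t (T cs)) (coord b)) =
      ext (\<lambda>t. if ok s t then cns (dot s t) (T cs) else 0) (coord b)" for s
    unfolding act_def ext_ext by (simp add: act_def[symmetric] act_cns)
  then show ?thesis
    by (simp add: coord_mult[OF assms] ext_ext if_distrib[of "ext _"] cong: if_cong)
qed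

lemma bp_T:
  assumes "set bs \<subseteq> carrier A" "length bs = Suc m"
  shows "bp (T bs) = (\<Sum>k<m. pm_scale ((- 1) ^ k) (T (face A k bs)))"
  using assms
proof (induction bs arbitrary: m)
  case (Cons a bs)
  show ?case
  proof (cases bs)
    case Nil
    then show ?thesis using Cons.prems by (simp add: bp_def ext_ext)
  next
    case b: (Cons b cs)
    then obtain m' where m: "m = Suc m'" "length bs = Suc m'" using Cons.prems by simp
    have "bp (T (a # bs)) = ext (\<lambda>s. bp (cns s (T bs))) (coord a)"
      by (simp add: bp_def ext_ext)
    also have "\<dots> = ext (\<lambda>s. act s (T bs)) (coord a) - ext (\<lambda>s. cns s (bp (T bs))) (coord a)"
      by (simp add: bp_cns ext_fun_diff)
    also have "ext (\<lambda>s. act s (T bs)) (coord a) = T (face A 0 (a # bs))"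
      using T_mult[of a b cs] Cons.prems b by (simp add: face_def)
    also have "ext (\<lambda>s. cns s (bp (T bs))) (coord a) = (\<Sum>k<m'. pm_scale ((- 1) ^ k) (T (a # face A k bs)))"
      using Cons.IH[of m'] Cons.prems m by (simp add: ext_fun_sum ext_fun_scale)
    also have "\<dots> = (\<Sum>k<m'. pm_scale ((- 1) ^ k) (T (face A (Suc k) (a # bs))))"
      by (rule sum.cong) (use m in \<open>auto simp: face_def\<close>)
    finally show ?thesis
      by (simp only: m sum.lessThan_Suc_shift) (simp add: sum_negf)
  qed
qed simp

lemma T_snoc: "T (as @ [z]) = ext (\<lambda>s. snc s (T as)) (coord z)"
proof (induction as)
  case (Cons a as)
  have "T ((a # as) @ [z]) = ext (\<lambda>t. ext (\<lambda>s. cns t (snc s (T as))) (coord z)) (coord a)"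
    using Cons by (simp add: cns_def ext_ext)
  also have "\<dots> = ext (\<lambda>s. ext (\<lambda>t. cns t (snc s (T as))) (coord a)) (coord z)"
    by (rule ext_swap)
  also have "\<dots> = ext (\<lambda>s. snc s (T (a # as))) (coord z)"
    by (simp add: snc_cns[symmetric]) (simp add: snc_def ext_ext)
  finally show ?case .
qed simp

lemma La_T:
  assumes "set bs \<subseteq> carrier A" "length bs = Suc n"
  shows "La (T bs) = pm_scale ((- 1) ^ n) (T (last bs # butlast bs))"
proof -
  obtain u z where bs: "bs = u @ [z]" "length u = n" using assms(2) by (cases bs rule: rev_cases) auto
  have "T u \<in> chains (lists_of_length n)"
    using T_in[of u] assms(1) bs chains_mono[of "blists n" "lists_of_length n"] by (auto simp: blists_def)
  then have "La (snc s (T u)) = pm_scale ((- 1) ^ n) (cns s (T u))" for s by (rule La_snc)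
  then show ?thesis
    using bs by (simp add: T_snoc La_def ext_ext) (simp add: La_def[symmetric] ext_fun_scale)
qed

lemma Db_T:
  assumes "set bs \<subseteq> carrier A" "length bs = Suc (Suc n)"
  shows "Db (T bs) = (\<Sum>k\<le>Suc n. pm_scale ((- 1) ^ k) (T (face A k bs)))"
proof -
  obtain a cs where bs: "bs = a # cs" using assms(2) by (cases bs) auto
  then have "cs \<noteq> []" using assms(2) by auto
  have face: "face A (Suc n) bs = (last bs \<otimes>\<^bsub>A\<^esub> a) # butlast cs"
    using assms(2) bs \<open>cs \<noteq> []\<close> by (simp add: face_def)
  have mem: "last bs \<in> carrier A" "a \<in> carrier A" using assms(1) bs last_in_set[of bs] by auto
  have "d0 (T (last bs # butlast bs)) = ext (\<lambda>s. act s (T (a # butlast cs))) (coord (last bs))"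
    using bs \<open>cs \<noteq> []\<close> by (simp add: d0_def ext_ext) (simp add: d0_def[symmetric] d0_cns)
  then have "d0 (La (T bs)) = pm_scale ((- 1) ^ Suc n) (T (face A (Suc n) bs))"
    using La_T[OF assms] T_mult[OF mem] face by simp
  then show ?thesis
    using bp_T[OF assms] by (simp add: Db_eq lessThan_Suc_atMost[symmetric])
qed

lemma face_tuples:
  assumes "bs \<in> tuples A (Suc n)" "k \<le> Suc n"
  shows "face A k bs \<in> tuples A n"
proof -
  have "bs \<noteq> []" "tl bs \<noteq> []" using assms(1) by (auto simp: tuples_def) (metis length_tl list.size(3) diff_Suc_1 nat.simps(3))
  moreover have "length (face A k bs) = Suc n"
    using assms by (auto simp: face_def tuples_def)
  moreover have "set (face A k bs) \<subseteq> carrier A"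
    using assms calculation
    by (auto simp: face_def tuples_def intro!: mult_in dest!: in_set_takeD in_set_dropD in_set_butlastD list.set_sel(2)[rotated])
  ultimately show ?thesis by (simp add: tuples_def)
qed

text \<open>\<open>g\<close> is the boundary formula before any quotient is taken. Since
  \<open>ext T\<close> intertwines it with \<open>Db\<close> and has the multilinear relations as
  kernel, \<open>g\<close> respects the relations and the induced map is \<open>Db\<close>.\<close>

lemma hochschild_boundary_tclass:
  assumes v: "v \<in> chains (blists (Suc (Suc n)))"
  shows "hochschild_boundary A n (tclass (Suc n) v) = tclass n (Db v)"
proof -
  define g where "g bs = (\<Sum>k\<le>Suc n. pm_scale ((- 1) ^ k) (single (face A k bs) (1 :: 'k)))" for bs
  have gin: "g bs \<in> chains (tuples A n)" if "bs \<in> tuples A (Suc n)" for bs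
    unfolding g_def using that face_tuples
    by (intro pm.subspace_sum subspace_chains pm.subspace_scale single_in_chains) auto
  have gT: "ext T (g bs) = Db (T bs)" if "bs \<in> tuples A (Suc n)" for bs
    using that Db_T[of bs n] by (simp add: g_def tuples_def)
  have gT': "ext T (ext g f) = Db (ext T f)" if "f \<in> chains (tuples A (Suc n))" for f
    unfolding Db_def ext_ext by (rule ext_cong_chains[OF that]) (use gT in \<open>simp add: Db_def\<close>)
  have gin': "ext g f \<in> chains (tuples A n)" if "f \<in> chains (tuples A (Suc n))" for f
    by (rule ext_in[OF that gin subspace_chains])
  have "hochschild_boundary A n (tclass (Suc n) v) = tup_coset n (ext g (lft v))"
    unfolding hochschild_boundary_def tclass_def
  proof (rule tensor_ext_tup_coset[OF presents_tuples gin])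
    fix bs assume bs: "bs \<in> tuples A (Suc n)"
    have "tup_coset n (g bs) = (\<Oplus>\<^bsub>tensor_power A n\<^esub>k\<in>{..Suc n}. tup_coset n (pm_scale ((- 1) ^ k) (single (face A k bs) 1)))"
      unfolding g_def
      by (rule presents_finsum[OF presents_tuples, symmetric]) (use face_tuples[OF bs] in auto)
    also have "\<dots> = (\<Oplus>\<^bsub>tensor_power A n\<^esub>k\<in>{..Suc n}. (- 1) ^ k \<odot>\<^bsub>tensor_power A n\<^esub> pure_tensor A n (face A k bs))"
    proof -
      interpret abelian_group "tensor_power A n" by (rule presents_abelian_group[OF presents_tuples])
      note p = presentsD[OF presents_tuples]
      show ?thesis
        unfolding pure_tensor_eq using face_tuples[OF bs] p(6)[symmetric] p(9)
        by (intro finsum_cong') (auto simp: Pi_def simp del: pm_scale_single intro!: p(9) pm.subspace_scale)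
    qed
    finally show "(\<Oplus>\<^bsub>tensor_power A n\<^esub>k\<in>{..Suc n}. (- 1) ^ k \<odot>\<^bsub>tensor_power A n\<^esub> pure_tensor A n (face A k bs)) = tup_coset n (g bs)"
      by simp
  next
    fix r assume r: "r \<in> multilin_rels A (Suc n)"
    then have rc: "r \<in> chains (tuples A (Suc n))" using rels_chains by blast
    show "ext g r \<in> multilin_rels A n"
      using rels_iff[OF gin'[OF rc]] gT'[OF rc] ext_T_rels[OF r] by simp
  qed (use lft_in[OF v] in auto)
  also have "\<dots> = tclass n (Db v)"
    using tup_coset_eq_tclass[OF gin'] gT' lft_in[OF v] ext_T_lft[OF v] by simp
  finally show ?thesis .
qed

lemma cyclic_op_tclass:
  assumes v: "v \<in> chains (blists (Suc n))"
  shows "cyclic_op A n (tclass n v) = tclass n (La v)"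
proof -
  define g where "g bs = pm_scale ((- 1) ^ n) (single (last bs # butlast bs) (1 :: 'k))" for bs :: "'a list"
  have rot: "last bs # butlast bs \<in> tuples A n" if "bs \<in> tuples A n" for bs
    using that by (cases bs rule: rev_cases) (auto simp: tuples_def)
  have gin: "g bs \<in> chains (tuples A n)" if "bs \<in> tuples A n" for bs
    unfolding g_def using that rot by (intro pm.subspace_scale single_in_chains) auto
  have gT': "ext T (ext g f) = La (ext T f)" if "f \<in> chains (tuples A n)" for f
    unfolding La_def ext_ext
    by (rule ext_cong_chains[OF that]) (use La_T in \<open>simp add: La_def g_def tuples_def\<close>)
  have gin': "ext g f \<in> chains (tuples A n)" if "f \<in> chains (tuples A n)" for f
    by (rule ext_in[OF that gin subspace_chains])
  have "cyclic_op A n (tclass n v) = tup_coset n (ext g (lft v))"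
    unfolding cyclic_op_def tclass_def
  proof (rule tensor_ext_tup_coset[OF presents_tuples gin])
    fix bs assume bs: "bs \<in> tuples A n"
    show "(- 1) ^ n \<odot>\<^bsub>tensor_power A n\<^esub> pure_tensor A n (last bs # butlast bs) = tup_coset n (g bs)"
      unfolding g_def pure_tensor_eq
      by (rule presentsD(6)[OF presents_tuples single_in_chains[OF rot[OF bs]], symmetric])
  next
    fix r assume r: "r \<in> multilin_rels A n"
    then have rc: "r \<in> chains (tuples A n)" using rels_chains by blast
    show "ext g r \<in> multilin_rels A n"
      using rels_iff[OF gin'[OF rc]] gT'[OF rc] ext_T_rels[OF r] by simp
  qed (use lft_in[OF v] in auto)
  also have "\<dots> = tclass n (La v)"
    using tup_coset_eq_tclass[OF gin'] gT' lft_in[OF v] ext_T_lft[OF v] by simp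
  finally show ?thesis .
qed

lemma Db_blists: "v \<in> chains (blists (Suc n)) \<Longrightarrow> Db v \<in> chains (blists n)"
  by (erule Db_chains) (auto simp: blists_def dot_in)

lemma bp_blists: "v \<in> chains (blists (Suc n)) \<Longrightarrow> bp v \<in> chains (blists n)"
  by (erule bp_chains) (auto simp: blists_def dot_in)

lemma La_blists: "v \<in> chains (blists n) \<Longrightarrow> La v \<in> chains (blists n)"
  by (erule La_chains) (auto simp: blists_def)

lemma Db_blists_singletons: "v \<in> chains (blists (Suc 0)) \<Longrightarrow> Db v = 0"
  using chains_mono[of "blists (Suc 0)" "lists_of_length (Suc 0)"] by (intro Db_singletons) (auto simp: blists_def)

section \<open>Presentations of Hochschild and cyclic homology\<close>

abbreviation hh_cycles :: "nat \<Rightarrow> ('b, 'k) chain set" where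
  "hh_cycles n \<equiv> hhZ blists n"

abbreviation hh_bounds :: "nat \<Rightarrow> ('b, 'k) chain set" where
  "hh_bounds n \<equiv> hhB blists n"

abbreviation cyc_rels :: "nat \<Rightarrow> ('b, 'k) chain set" where
  "cyc_rels m \<equiv> cycB blists m"

abbreviation hc_cycles :: "nat \<Rightarrow> ('b, 'k) chain set" where
  "hc_cycles n \<equiv> hcZ blists n"

abbreviation hc_bounds :: "nat \<Rightarrow> ('b, 'k) chain set" where
  "hc_bounds n \<equiv> hcB blists n"

definition hh_class :: "nat \<Rightarrow> ('b, 'k) chain \<Rightarrow> ('a, 'k) chain set set" where
  "hh_class n v = boundaries (tensor_power A) (hochschild_boundary A) n +>\<^bsub>tensor_power A n\<^esub> tclass n v"

lemma presents_HH: "presents (HH A n) (hh_cycles n) (hh_bounds n) (hh_class n)"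
proof -
  have "presents (HH A n) {v \<in> chains (blists (Suc n)). n = 0 \<or> ext Dl v \<in> {0}}
      {w + ext Dl u |w u. w \<in> {0} \<and> u \<in> chains (blists (Suc (Suc n)))} (hh_class n)"
    unfolding HH_def hh_class_def[abs_def]
    by (rule presents_homology[OF presents_tensor_power])
      (use Db_blists hochschild_boundary_tclass Db_Db in \<open>auto simp: Db_def[symmetric]\<close>)
  moreover have "{v \<in> chains (blists (Suc n)). n = 0 \<or> ext Dl v \<in> {0}} = hh_cycles n"
    by (auto simp: hhZ_def Db_def[symmetric] Db_blists_singletons)
  moreover have "{w + ext Dl u |w u. w \<in> {0} \<and> u \<in> chains (blists (Suc (Suc n)))} = hh_bounds n"
    by (auto simp: hhB_def Db_def[symmetric])
  ultimately show ?thesis by simp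
qed

lemma subspace_cyc_rels: "pm.subspace (cyc_rels m)"
  unfolding pm.subspace_def
proof (intro conjI ballI allI)
  show "0 \<in> cyc_rels m" unfolding cycB_def by (rule image_eqI[of _ _ 0]) auto
next
  fix x y assume "x \<in> cyc_rels m" "y \<in> cyc_rels m"
  then obtain u v where "x = u - La u" "y = v - La v" "u \<in> chains (blists m)" "v \<in> chains (blists m)"
    by (auto simp: cycB_def)
  then show "x + y \<in> cyc_rels m" unfolding cycB_def by (intro image_eqI[of _ _ "u + v"]) auto
next
  fix c x assume "x \<in> cyc_rels m"
  then obtain u where "x = u - La u" "u \<in> chains (blists m)" by (auto simp: cycB_def)
  then show "pm_scale c x \<in> cyc_rels m"
    unfolding cycB_def by (intro image_eqI[of _ _ "pm_scale c u"]) (auto simp: pm.scale_right_diff_distrib)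
qed

lemma cyc_rels_chains: "cyc_rels m \<subseteq> chains (blists m)"
  using La_blists by (auto simp: cycB_def)

lemma Db_cyc_rels:
  assumes "v \<in> cyc_rels (Suc n)"
  shows "Db v \<in> cyc_rels n"
proof -
  obtain u where u: "u \<in> chains (blists (Suc n))" "v = u - La u" using assms by (auto simp: cycB_def)
  show ?thesis
    unfolding cycB_def u(2) Db_one_minus_La by (rule image_eqI[OF refl bp_blists[OF u(1)]])
qed

lemma cyclic_image_eq: "cyclic_image A n = tclass n ` cyc_rels (Suc n)"
proof -
  note p = presentsD[OF presents_tensor_power]
  have "cyclic_image A n = (\<lambda>x. x \<ominus>\<^bsub>tensor_power A n\<^esub> cyclic_op A n x) ` (tclass n ` chains (blists (Suc n)))"
    unfolding p(4) by (auto simp: cyclic_image_def)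
  also have "\<dots> = (\<lambda>v. tclass n v \<ominus>\<^bsub>tensor_power A n\<^esub> tclass n (La v)) ` chains (blists (Suc n))"
    unfolding image_image by (rule image_cong) (simp_all add: cyclic_op_tclass)
  also have "\<dots> = (\<lambda>v. tclass n (v - La v)) ` chains (blists (Suc n))"
    by (rule image_cong) (simp_all add: presents_diff[OF presents_tensor_power] La_blists)
  finally show ?thesis by (simp add: cycB_def image_image)
qed

definition connes_class :: "nat \<Rightarrow> ('b, 'k) chain \<Rightarrow> ('a, 'k) chain set set" where
  "connes_class n v = cyclic_image A n +>\<^bsub>tensor_power A n\<^esub> tclass n v"

lemma presents_connes_space:
  "presents (connes_space A n) (chains (blists (Suc n))) (cyc_rels (Suc n)) (connes_class n)"
  unfolding connes_space_def connes_class_def[abs_def]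
  using pm.subspace_0[OF subspace_cyc_rels]
  by (intro presents_quot[OF presents_tensor_power] subspace_cyc_rels cyc_rels_chains cyclic_image_eq) auto

lemma connes_boundary_class:
  assumes v: "v \<in> chains (blists (Suc (Suc n)))"
  shows "connes_boundary A n (connes_class (Suc n) v) = connes_class n (Db v)"
proof -
  have cc: "connes_class (Suc n) v = tclass (Suc n) ` {u + v |u. u \<in> cyc_rels (Suc (Suc n))}"
    unfolding connes_class_def cyclic_image_eq
    by (rule presents_coset[OF presents_tensor_power cyc_rels_chains v])
  show ?thesis
    unfolding connes_boundary_def
  proof (rule the_elem_image_const)
    show "connes_class (Suc n) v \<noteq> {}" using cc pm.subspace_0[OF subspace_cyc_rels] by auto
    fix x assume "x \<in> connes_class (Suc n) v"
    then obtain u where u: "u \<in> cyc_rels (Suc (Suc n))" "x = tclass (Suc n) (u + v)" using cc by auto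
    then have uv: "u + v \<in> chains (blists (Suc (Suc n)))" using cyc_rels_chains v by auto
    have "connes_class n (Db (u + v)) = connes_class n (Db v)"
      using presents_eq_iff[OF presents_connes_space] Db_blists[OF uv] Db_blists[OF v] Db_cyc_rels[OF u(1)] by simp
    then show "cyclic_image A n +>\<^bsub>tensor_power A n\<^esub> hochschild_boundary A n x = connes_class n (Db v)"
      unfolding u(2) hochschild_boundary_tclass[OF uv] by (simp add: connes_class_def)
  qed
qed

definition hc_class :: "nat \<Rightarrow> ('b, 'k) chain \<Rightarrow> ('a, 'k) chain set set set" where
  "hc_class n v = boundaries (connes_space A) (connes_boundary A) n +>\<^bsub>connes_space A n\<^esub> connes_class n v"

lemma presents_HC: "presents (HC A n) (hc_cycles n) (hc_bounds n) (hc_class n)"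
proof -
  have "presents (HC A n) {v \<in> chains (blists (Suc n)). n = 0 \<or> ext Dl v \<in> cyc_rels (Suc (n - 1))}
      {w + ext Dl u |w u. w \<in> cyc_rels (Suc n) \<and> u \<in> chains (blists (Suc (Suc n)))} (hc_class n)"
    unfolding HC_def hc_class_def[abs_def]
    by (rule presents_homology[OF presents_connes_space])
      (use Db_blists connes_boundary_class Db_cyc_rels pm.subspace_0[OF subspace_cyc_rels]
       in \<open>auto simp: Db_def[symmetric] Db_Db\<close>)
  \<comment> \<open>In degree 0 no condition is lost: a one-letter word has boundary 0, which lies
    in \<open>cyc_rels 0\<close>.\<close>
  moreover have "{v \<in> chains (blists (Suc n)). n = 0 \<or> ext Dl v \<in> cyc_rels (Suc (n - 1))} = hc_cycles n"
    using pm.subspace_0[OF subspace_cyc_rels]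
    by (cases n) (auto simp: hcZ_def Db_def[symmetric] Db_blists_singletons)
  moreover have "{w + ext Dl u |w u. w \<in> cyc_rels (Suc n) \<and> u \<in> chains (blists (Suc (Suc n)))} = hc_bounds n"
    by (auto simp: hcB_def hhB_def Db_def[symmetric])
  ultimately show ?thesis by simp
qed

end


section \<open>The contracting homotopy\<close>

text \<open>
  In the intended model \<open>S0\<close> consists of the arrows of a groupoid with object set \<open>Ob\<close>, and \<open>S\<close> contains
  in addition an adjoined unit, which is treated as a loop at whatever object is current. When a word is
  read from the object \<open>y\<close>, \<open>mt y a\<close> says that the target of the letter \<open>a\<close> is \<open>y\<close> and \<open>nx y a\<close> is the source
  of \<open>a\<close>. In terms of the chosen arrows \<open>\<gamma>\<close>, \<open>gi y\<close> is the inverse of \<open>\<gamma> y\<close>, \<open>hd' a\<close> is \<open>a\<close> times \<open>\<gamma> (st a)\<close>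
  with \<open>st a\<close> the source of \<open>a\<close>, and \<open>ph y a\<close> is the conjugate of \<open>a\<close> in the vertex group.
\<close>

locale bar_homotopy = partial_semigroup ok dot
  for ok :: "'b \<Rightarrow> 'b \<Rightarrow> bool" and dot :: "'b \<Rightarrow> 'b \<Rightarrow> 'b" +
  fixes S S0 :: "'b set" and Ob :: "'o set"
    and mt :: "'o \<Rightarrow> 'b \<Rightarrow> bool" and nx :: "'o \<Rightarrow> 'b \<Rightarrow> 'o" and ph :: "'o \<Rightarrow> 'b \<Rightarrow> 'b"
    and gi :: "'o \<Rightarrow> 'b" and st :: "'b \<Rightarrow> 'o" and hd' :: "'b \<Rightarrow> 'b"
  assumes S0_S: "S0 \<subseteq> S"
    and dot_S: "a \<in> S \<Longrightarrow> b \<in> S \<Longrightarrow> ok a b \<Longrightarrow> dot a b \<in> S"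
    and dot_S0: "a \<in> S0 \<Longrightarrow> b \<in> S \<Longrightarrow> ok a b \<Longrightarrow> dot a b \<in> S0"
    and dot_S0': "b \<in> S \<Longrightarrow> a \<in> S0 \<Longrightarrow> ok b a \<Longrightarrow> dot b a \<in> S0"
    and nx_in: "y \<in> Ob \<Longrightarrow> a \<in> S \<Longrightarrow> nx y a \<in> Ob"
    and st_in: "a \<in> S0 \<Longrightarrow> st a \<in> Ob"
    and gi_in: "y \<in> Ob \<Longrightarrow> gi y \<in> S0"
    and hd_in: "a \<in> S0 \<Longrightarrow> hd' a \<in> S0"
    and ph_in: "y \<in> Ob \<Longrightarrow> a \<in> S \<Longrightarrow> mt y a \<Longrightarrow> ph y a \<in> S"
    and ok_gi: "y \<in> Ob \<Longrightarrow> a \<in> S \<Longrightarrow> ok (gi y) a \<longleftrightarrow> mt y a"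
    and ph_gi: "y \<in> Ob \<Longrightarrow> a \<in> S \<Longrightarrow> mt y a \<Longrightarrow>
      ok (ph y a) (gi (nx y a)) \<and> dot (ph y a) (gi (nx y a)) = dot (gi y) a"
    and mt_dot: "y \<in> Ob \<Longrightarrow> a \<in> S \<Longrightarrow> b \<in> S \<Longrightarrow> ok a b \<Longrightarrow> mt y (dot a b) \<longleftrightarrow> mt y a \<and> mt (nx y a) b"
    and ok_mt: "y \<in> Ob \<Longrightarrow> a \<in> S \<Longrightarrow> b \<in> S \<Longrightarrow> mt y a \<Longrightarrow> mt (nx y a) b \<Longrightarrow> ok a b"
    and nx_dot: "y \<in> Ob \<Longrightarrow> a \<in> S \<Longrightarrow> b \<in> S \<Longrightarrow> ok a b \<Longrightarrow> nx y (dot a b) = nx (nx y a) b"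
    and ph_dot: "y \<in> Ob \<Longrightarrow> a \<in> S \<Longrightarrow> b \<in> S \<Longrightarrow> mt y a \<Longrightarrow> mt (nx y a) b \<Longrightarrow>
      ok (ph y a) (ph (nx y a) b) \<and> dot (ph y a) (ph (nx y a) b) = ph y (dot a b)"
    and hd_gi: "a \<in> S0 \<Longrightarrow> ok (hd' a) (gi (st a)) \<and> dot (hd' a) (gi (st a)) = a"
    and st_ok: "a \<in> S0 \<Longrightarrow> b \<in> S \<Longrightarrow> ok a b \<longleftrightarrow> mt (st a) b"
    and st_dot: "a \<in> S0 \<Longrightarrow> b \<in> S \<Longrightarrow> ok a b \<Longrightarrow> st (dot a b) = nx (st a) b"
    and hd_dot: "a \<in> S0 \<Longrightarrow> b \<in> S \<Longrightarrow> ok a b \<Longrightarrow>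
      ok (hd' a) (ph (st a) b) \<and> dot (hd' a) (ph (st a) b) = hd' (dot a b)"
    and ok_hd: "z \<in> S \<Longrightarrow> a \<in> S0 \<Longrightarrow> ok z (hd' a) \<longleftrightarrow> ok z a"
    and dot_hd: "z \<in> S \<Longrightarrow> a \<in> S0 \<Longrightarrow> ok z a \<Longrightarrow> dot z (hd' a) = hd' (dot z a)"
    and dot_st: "z \<in> S \<Longrightarrow> a \<in> S0 \<Longrightarrow> ok z a \<Longrightarrow> st (dot z a) = st a"
    and nx_S0: "y \<in> Ob \<Longrightarrow> a \<in> S0 \<Longrightarrow> nx y a = st a"
    and ph_S0: "y \<in> Ob \<Longrightarrow> a \<in> S0 \<Longrightarrow> mt y a \<Longrightarrow> ph y a = dot (gi y) (hd' a)"
begin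

text \<open>Reads the word from the object \<open>y\<close> and inserts \<open>gi\<close> in every
  possible place, with the letters before it conjugated and with alternating signs. The reading
  stops at the first letter that does not compose, and the later places are dropped.\<close>

primrec H :: "'b list \<Rightarrow> 'o \<Rightarrow> ('b, 'k::field) chain" where
  "H [] y = single [gi y] 1"
| "H (a # l) y = single (gi y # a # l) 1 - (if mt y a then cns (ph y a) (H l (nx y a)) else 0)"

definition Hm :: "'o \<Rightarrow> ('b, 'k::field) chain \<Rightarrow> ('b, 'k) chain" where
  "Hm y = ext (\<lambda>l. H l y)"

lemma Hm_simps [simp]:
  "Hm y 0 = 0" "Hm y (f + g) = Hm y f + Hm y g" "Hm y (f - g) = Hm y f - Hm y g"
  "Hm y (- f) = - Hm y f" "Hm y (pm_scale c f) = pm_scale c (Hm y f)"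
  "Hm y (single l c) = pm_scale c (H l y)"
  by (simp_all add: Hm_def)

lemma Hm_cns:
  "Hm y (cns a f) = cns (gi y) (cns a f) - (if mt y a then cns (ph y a) (Hm (nx y a) f) else 0)"
  by (cases "mt y a"; rule lin_eqI[of f UNIV]; simp add: pm.scale_right_diff_distrib)

text \<open>After \<open>a\<close> is multiplied into the next letter, nothing can be inserted
  between the two. By \<open>ph_gi\<close> the term for that place is
  \<open>dot (gi y) a # l\<close>, which is therefore subtracted.\<close>

lemma Hm_actl:
  assumes "y \<in> Ob" "a \<in> S" "set l \<subseteq> S"
  shows "Hm y (actl a l) = cns (gi y) (actl a l) +
    (if mt y a then act (ph y a) (H l (nx y a)) - single (dot (gi y) a # l) 1 else 0)"
proof (cases l)
  case Nil
  then show ?thesis using ph_gi[OF assms(1,2)] by simp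
next
  case (Cons b m)
  then have b: "b \<in> S" using assms by simp
  show ?thesis
  proof (cases "mt y a")
    case False
    then have "\<not> mt y (dot a b)" if "ok a b" using mt_dot[OF assms(1,2) b that] by simp
    then show ?thesis using Cons False by simp
  next
    case mt: True
    note ph = ph_gi[OF assms(1,2) mt]
    show ?thesis
    proof (cases "mt (nx y a) b")
      case True
      then have ok: "ok a b" using ok_mt[OF assms(1,2) b mt] by simp
      have "mt y (dot a b)" "nx y (dot a b) = nx (nx y a) b"
        using mt_dot[OF assms(1,2) b ok] nx_dot[OF assms(1,2) b ok] mt True by simp_all
      then show ?thesis
        using Cons True mt ok ph ph_dot[OF assms(1,2) b mt True] by (simp add: act_cns)
    next
      case False
      then have "\<not> mt y (dot a b)" if "ok a b" using mt_dot[OF assms(1,2) b that] by simp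
      then show ?thesis using Cons False mt ph by simp
    qed
  qed
qed

text \<open>Fusing the inserted letter with its right neighbour gives the same word as fusing it, in
  the next term, with its left neighbour, and the signs are opposite. What is left are faces of
  \<open>l\<close>.\<close>

lemma bp_H:
  assumes "y \<in> Ob" "set l \<subseteq> S"
  shows "bp (H l y :: ('b, 'k::field) chain) = - Hm y (bpl l)"
  using assms
proof (induction l arbitrary: y)
  case (Cons a l)
  then have IH: "bp (H l (nx y a) :: ('b, 'k) chain) = - Hm (nx y a) (bpl l)"
    using nx_in by simp
  have "(Hm y (bpl (a # l)) :: ('b, 'k) chain) = Hm y (actl a l) - Hm y (cns a (bpl l))" by simp
  moreover have "(Hm y (actl a l) :: ('b, 'k) chain) = cns (gi y) (actl a l) +
    (if mt y a then act (ph y a) (H l (nx y a)) - single (dot (gi y) a # l) 1 else 0)"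
    using Cons.prems by (intro Hm_actl) auto
  ultimately show ?case
    using Cons.prems ok_gi[of y a] by (simp add: Hm_cns bp_cns IH)
qed simp

lemma H_length: "(H l y :: ('b, 'k::field) chain) \<in> chains (lists_of_length (Suc (length l)))"
proof (induction l arbitrary: y)
  case (Cons a l)
  have "(cns (ph y a) (H l (nx y a)) :: ('b, 'k) chain) \<in> chains (lists_of_length (Suc (length (a # l))))"
    by (rule cns_chains[OF Cons.IH]) simp
  then show ?case by auto
qed simp

lemma H_in:
  assumes "\<And>y. y \<in> Ob \<Longrightarrow> gi y \<in> Q" "\<And>y a. y \<in> Ob \<Longrightarrow> a \<in> Q \<Longrightarrow> mt y a \<Longrightarrow> ph y a \<in> Q"
    "Q \<subseteq> S" "y \<in> Ob" "set l \<subseteq> Q"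
  shows "(H l y :: ('b, 'k::field) chain) \<in> chains (words Q (Suc (length l)))"
  using assms(4,5)
proof (induction l arbitrary: y)
  case Nil
  then show ?case using assms(1) by (simp add: words_def)
next
  case (Cons a l)
  then have "nx y a \<in> Ob" using nx_in assms(3) by auto
  then have "(cns (ph y a) (H l (nx y a)) :: ('b, 'k) chain) \<in> chains (words Q (Suc (length (a # l))))" if "mt y a"
    using Cons.prems that assms(2) by (intro cns_chains[OF Cons.IH]) (auto simp: words_def)
  moreover have "gi y # a # l \<in> words Q (Suc (length (a # l)))"
    using Cons.prems assms(1) by (simp add: words_def)
  ultimately show ?case by auto
qed

lemma gi_in_S: "y \<in> Ob \<Longrightarrow> gi y \<in> S"
  using gi_in S0_S by blast

lemma H_in_S: "y \<in> Ob \<Longrightarrow> set l \<subseteq> S \<Longrightarrow> (H l y :: ('b, 'k::field) chain) \<in> chains (words S (Suc (length l)))"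
  by (rule H_in) (auto intro: gi_in_S ph_in)

section \<open>Paths and conjugated words\<close>

primrec fin :: "'o \<Rightarrow> 'b list \<Rightarrow> 'o" where
  "fin y [] = y"
| "fin y (a # l) = fin (nx y a) l"

primrec pth :: "'o \<Rightarrow> 'b list \<Rightarrow> bool" where
  "pth y [] \<longleftrightarrow> True"
| "pth y (a # l) \<longleftrightarrow> mt y a \<and> pth (nx y a) l"

primrec phs :: "'o \<Rightarrow> 'b list \<Rightarrow> 'b list" where
  "phs y [] = []"
| "phs y (a # l) = ph y a # phs (nx y a) l"

lemma fin_snoc [simp]: "fin y (l @ [z]) = nx (fin y l) z"
  by (induction l arbitrary: y) simp_all

lemma pth_snoc [simp]: "pth y (l @ [z]) \<longleftrightarrow> pth y l \<and> mt (fin y l) z"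
  by (induction l arbitrary: y) simp_all

lemma phs_snoc [simp]: "phs y (l @ [z]) = phs y l @ [ph (fin y l) z]"
  by (induction l arbitrary: y) simp_all

lemma length_phs [simp]: "length (phs y l) = length l"
  by (induction l arbitrary: y) simp_all

lemma fin_in: "y \<in> Ob \<Longrightarrow> set l \<subseteq> S \<Longrightarrow> fin y l \<in> Ob"
  by (induction l arbitrary: y) (auto intro: nx_in)

text \<open>Only the term that inserts \<open>gi\<close> at the very end sees the new letter
  conjugated, and it is present only if the whole word can be read. It is the term that the cyclic
  face will turn into \<open>e\<close>.\<close>

lemma H_snoc:
  "H (l @ [z]) y = snc z (H l y) + (if pth y (l @ [z])
     then single (phs y (l @ [z]) @ [gi (fin y (l @ [z]))]) ((- 1) ^ Suc (length l)) else 0)"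
  by (induction l arbitrary: y) (simp_all add: snc_cns single_uminus del: pth_snoc fin_snoc phs_snoc)

text \<open>The first letter supplies the object from which the rest is read, so it is multiplied by
  \<gamma> of its source instead of being conjugated.\<close>

primrec hl :: "'b list \<Rightarrow> ('b, 'k::field) chain" where
  "hl [] = 0"
| "hl (a # l) = cns (hd' a) (H l (st a))"

definition h :: "('b, 'k::field) chain \<Rightarrow> ('b, 'k) chain" where
  "h = ext hl"

text \<open>The first letter is conjugated at the object where the path through the other letters
  ends; the \<open>ok\<close> condition there says that the word closes up to a cycle.\<close>

primrec el :: "'b list \<Rightarrow> ('b, 'k::field) chain" where
  "el [] = 0"
| "el (a # l) = (if pth (st a) l \<and> ok (gi (fin (st a) l)) (hd' a)
     then single (dot (gi (fin (st a) l)) (hd' a) # phs (st a) l) 1 else 0)"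

definition e :: "('b, 'k::field) chain \<Rightarrow> ('b, 'k) chain" where
  "e = ext el"

lemma h_simps [simp]:
  "h 0 = 0" "h (f + g) = h f + h g" "h (f - g) = h f - h g"
  "h (- f) = - h f" "h (pm_scale c f) = pm_scale c (h f)"
  "h (single l c) = pm_scale c (hl l)"
  by (simp_all add: h_def)

lemma e_simps [simp]:
  "e 0 = 0" "e (f + g) = e f + e g" "e (f - g) = e f - e g"
  "e (- f) = - e f" "e (pm_scale c f) = pm_scale c (e f)"
  "e (single l c) = pm_scale c (el l)"
  by (simp_all add: e_def)

lemma h_cns: "h (cns a f) = cns (hd' a) (Hm (st a) f)"
  by (rule lin_eqI[of f UNIV]) simp_all

definition L0 :: "'b list set" where
  "L0 = {a # l |a l. a \<in> S0 \<and> set l \<subseteq> S}"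

text \<open>The inverse inserted right after the first letter restores that letter by
  \<open>hd_gi\<close>; the other terms cancel by \<open>bp_H\<close> and
  \<open>hd_dot\<close>.\<close>

lemma bp_h:
  fixes f :: "('b, 'k::field) chain"
  assumes f: "f \<in> chains L0"
  shows "bp (h f) + h (bp f) = f"
proof (rule lin_eqI[OF f, where F = "\<lambda>f. bp (h f) + h (bp f)" and G = "\<lambda>f. f"])
  fix x :: "'b list" assume "x \<in> L0"
  then obtain a l where x: "x = a # l" and a: "a \<in> S0" and l: "set l \<subseteq> S" by (auto simp: L0_def)
  have "act (hd' a) (H l (st a)) + h (actl a l) = single (a # l) (1 :: 'k)"
  proof (cases l)
    case Nil
    then show ?thesis using hd_gi[OF a] by simp
  next
    case (Cons b m)
    then have b: "b \<in> S" using l by simp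
    show ?thesis
    proof (cases "mt (st a) b")
      case True
      then have "ok a b" using st_ok[OF a b] by simp
      then show ?thesis
        using True hd_gi[OF a] hd_dot[OF a b] st_dot[OF a b] Cons by (simp add: act_cns)
    next
      case False
      then have "\<not> ok a b" using st_ok[OF a b] by simp
      then show ?thesis using False hd_gi[OF a] Cons by simp
    qed
  qed
  moreover have "bp (h (single x 1)) + h (bp (single x 1)) =
      act (hd' a) (H l (st a)) + h (actl a l :: ('b, 'k) chain)"
    by (simp add: x bp_cns h_cns bp_H[OF st_in[OF a] l])
  ultimately show "bp (h (single x 1)) + h (bp (single x 1)) = single x (1 :: 'k)"
    by (simp only: x)
qed (simp_all add: pm.scale_right_distrib)

text \<open>All terms of \<open>h\<close> but one keep the last letter untouched, so on them the
  cyclic face commutes with the insertion up to sign. The remaining term ends in an inverse arrow,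
  which the cyclic face multiplies into the first letter; the result is minus
  \<open>e\<close>.\<close>

lemma c_h:
  fixes f :: "('b, 'k::field) chain"
  assumes f: "f \<in> chains L0"
  shows "d0 (La (h f)) + h (d0 (La f)) = - e f"
proof (rule lin_eqI[OF f, where F = "\<lambda>f. d0 (La (h f)) + h (d0 (La f))" and G = "\<lambda>f. - e f"])
  fix x :: "'b list" assume "x \<in> L0"
  then obtain a l where x: "x = a # l" and a: "a \<in> S0" and l: "set l \<subseteq> S" by (auto simp: L0_def)
  show "d0 (La (h (single x 1))) + h (d0 (La (single x 1))) = - e (single x (1 :: 'k))"
  proof (cases l rule: rev_cases)
    case Nil
    then show ?thesis using Lal_snoc[of "[hd' a]" "gi (st a)"] by (simp add: x Lal_def)
  next
    case (snoc m z)
    then have z: "z \<in> S" and m: "set m \<subseteq> S" using l by auto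
    let ?X = "cns (hd' a) (H m (st a)) :: ('b, 'k) chain"
    have X: "?X \<in> chains (lists_of_length (Suc (Suc (length m))))"
      by (rule cns_chains[OF H_length]) simp
    have 1: "d0 (La (snc z ?X)) = pm_scale ((- 1) ^ length m)
        (if ok z a then cns (hd' (dot z a)) (H m (st a)) else 0)"
      using ok_hd[OF z a] dot_hd[OF z a] by (simp add: La_snc[OF X] d0_cns act_cns)
    have L: "Lal (a # m @ [z]) = single (z # a # m) ((- 1 :: 'k) ^ Suc (length m))"
      using Lal_snoc[of "a # m" z] by simp
    have 2: "h (d0 (La (single x 1))) = - pm_scale ((- 1) ^ length m)
        (if ok z a then cns (hd' (dot z a)) (H m (st a)) else 0 :: ('b, 'k) chain)"
      using L dot_st[OF z a] by (simp add: x snoc)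
    \<comment> \<open>Rotating a word with \<open>length m + 3\<close> letters gives the sign
      \<open>(- 1) ^ length m\<close>, and \<open>H_snoc\<close> contributes
      \<open>(- 1) ^ Suc (length m)\<close>: together the minus sign in front of
      \<open>e\<close>.\<close>
    have L3: "Lal (hd' a # phs (st a) l @ [gi (fin (st a) l)])
        = single (gi (fin (st a) l) # hd' a # phs (st a) l) ((- 1 :: 'k) ^ length m)"
      using Lal_snoc[of "hd' a # phs (st a) l" "gi (fin (st a) l)"] snoc by (simp del: fin_snoc phs_snoc)
    have 3: "d0 (La (single (hd' a # phs (st a) l @ [gi (fin (st a) l)]) 1))
      = (if ok (gi (fin (st a) l)) (hd' a)
         then single (dot (gi (fin (st a) l)) (hd' a) # phs (st a) l) ((- 1 :: 'k) ^ length m) else 0)"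
      by (simp add: L3)
    have "hl x = snc z ?X + (if pth (st a) l then pm_scale ((- 1) ^ Suc (length m))
        (single (hd' a # phs (st a) l @ [gi (fin (st a) l)]) (1 :: 'k)) else 0)"
      by (simp add: x snoc snc_cns H_snoc del: pth_snoc fin_snoc phs_snoc)
    then have "d0 (La (hl x)) = d0 (La (snc z ?X)) + (if pth (st a) l then pm_scale ((- 1) ^ Suc (length m))
        (d0 (La (single (hd' a # phs (st a) l @ [gi (fin (st a) l)]) (1 :: 'k)))) else 0)"
      by (cases "pth (st a) l") (simp_all only: if_True if_False La_simps(1,2,5) d0_simps(1,2,5))
    then show ?thesis
      using 2 unfolding 1 3 by (simp add: x single_uminus power_mult_distrib[symmetric] del: pth_snoc fin_snoc phs_snoc)
  qed
qed (simp_all add: pm.scale_right_distrib)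

lemma Db_h:
  fixes f :: "('b, 'k::field) chain"
  assumes "f \<in> chains L0"
  shows "Db (h f) + h (Db f) = f - e f"
proof -
  have "Db (h f) + h (Db f) = (bp (h f) + h (bp f)) + (d0 (La (h f)) + h (d0 (La f)))"
    by (simp add: Db_eq)
  then show ?thesis by (simp add: bp_h[OF assms] c_h[OF assms])
qed

lemma Db_L0:
  assumes "f \<in> chains L0"
  shows "Db f \<in> chains L0"
proof (rule Db_chains[OF assms])
  fix u a b v assume "u @ a # b # v \<in> L0" "ok a b"
  then show "u @ dot a b # v \<in> L0"
    using S0_S by (cases u) (auto simp: L0_def intro: dot_S dot_S0)
qed (use S0_S in \<open>auto simp: L0_def intro: dot_S0'\<close>)

text \<open>On \<open>L0\<close> the operator \<open>e\<close> is 1 minus the anticommutator of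
  \<open>Db\<close> and \<open>h\<close>, and such an expression commutes with \<open>Db\<close>
  because \<open>Db\<close> squares to 0.\<close>

lemma Db_e:
  fixes f :: "('b, 'k::field) chain"
  assumes f: "f \<in> chains L0"
  shows "Db (e f) = e (Db f)"
proof -
  have "Db (Db (h f) + h (Db f)) = Db (f - e f)" by (simp only: Db_h[OF f])
  moreover have "Db (h (Db f)) + h (Db (Db f)) = Db f - e (Db f)" by (rule Db_h[OF Db_L0[OF f]])
  ultimately show ?thesis by (simp add: Db_Db)
qed

lemma d0_e:
  fixes f :: "('b, 'k::field) chain"
  assumes f: "f \<in> chains L0"
  shows "d0 (e f) = e (d0 f)"
proof (rule lin_eqI[OF f])
  fix x :: "'b list" assume "x \<in> L0"
  then obtain a l where x: "x = a # l" and a: "a \<in> S0" and l: "set l \<subseteq> S" by (auto simp: L0_def)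
  show "d0 (e (single x 1)) = e (d0 (single x (1 :: 'k)))"
  proof (cases l)
    case (Cons b m)
    then have b: "b \<in> S" using l by simp
    let ?F = "gi (fin (nx (st a) b) m)"
    show ?thesis
    proof (cases "ok a b")
      case True
      have "ok ?F (hd' a) \<and> ok (dot ?F (hd' a)) (ph (st a) b) \<longleftrightarrow> ok ?F (hd' (dot a b))"
        using ok_assoc[of ?F "hd' a" "ph (st a) b"] hd_dot[OF a b True] by auto
      moreover have "dot (dot ?F (hd' a)) (ph (st a) b) = dot ?F (hd' (dot a b))"
        if "ok ?F (hd' a)" "ok (dot ?F (hd' a)) (ph (st a) b)"
        using dot_assoc[OF that] hd_dot[OF a b True] by simp
      ultimately show ?thesis
        using x Cons True st_ok[OF a b] st_dot[OF a b True] by auto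
    qed (use x Cons st_ok[OF a b] in simp)
  qed (use x in simp)
qed simp_all

text \<open>Unlike \<open>L0\<close>, closed under rotation: no adjoined unit can be moved to the
  front.\<close>

definition L1 :: "'b list set" where
  "L1 = {l. l \<noteq> [] \<and> set l \<subseteq> S0}"

lemma L1_L0: "L1 \<subseteq> L0"
proof
  fix l assume "l \<in> L1"
  then show "l \<in> L0" using S0_S by (cases l) (auto simp: L1_def L0_def)
qed

lemma fin_L1: "y \<in> Ob \<Longrightarrow> set l \<subseteq> S0 \<Longrightarrow> l \<noteq> [] \<Longrightarrow> fin y l = st (last l)"
  by (induction l arbitrary: y) (auto simp: nx_S0 st_in)

text \<open>Every letter now has a source, so by \<open>ph_S0\<close> the first letter is conjugated
  in the same way as the others and the formula for \<open>e\<close> becomes cyclically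
  symmetric.\<close>

lemma el_L1:
  assumes "l \<in> L1"
  shows "el l = (if pth (st (last l)) l then single (phs (st (last l)) l) 1 else 0)"
proof -
  obtain a m where l: "l = a # m" "a \<in> S0" "set m \<subseteq> S0" using assms by (cases l) (auto simp: L1_def)
  have F: "fin (st a) m = st (last l)"
    using l fin_L1[of "st a" m] st_in by (cases "m = []") auto
  have y: "st (last l) \<in> Ob" using assms st_in[of "last l"] last_in_set[of l] unfolding L1_def by blast
  have "ok (gi (st (last l))) (hd' a) \<longleftrightarrow> mt (st (last l)) a"
    using ok_hd[of "gi (st (last l))" a] ok_gi[OF y, of a] gi_in[OF y] S0_S l by blast
  then show ?thesis
    using l F nx_S0[OF y l(2)] ph_S0[OF y l(2)] by auto
qed

lemma La_e:
  fixes f :: "('b, 'k::field) chain"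
  assumes f: "f \<in> chains L1"
  shows "La (e f) = e (La f)"
proof (rule lin_eqI[OF f])
  fix x :: "'b list" assume xL: "x \<in> L1"
  then obtain u z where x: "x = u @ [z]" and z: "z \<in> S0" and u: "set u \<subseteq> S0"
    by (cases x rule: rev_cases) (auto simp: L1_def)
  have zu: "z # u \<in> L1" using z u by (auto simp: L1_def)
  have F: "fin (st z) u = st (last (z # u))"
    using fin_L1[OF st_in[OF z] u] by (cases "u = []") auto
  have y: "st (last (z # u)) \<in> Ob" using st_in[of "last (z # u)"] zu last_in_set[of "z # u"] unfolding L1_def by blast
  have "Lal (phs (st z) x) = single (ph (st (last (z # u))) z # phs (st z) u) ((- 1 :: 'k) ^ length u)"
    unfolding x phs_snoc Lal_snoc F by simp
  moreover have "el x = (if pth (st z) x then single (phs (st z) x) (1 :: 'k) else 0)"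
    using el_L1[OF xL] unfolding x last_snoc .
  moreover have "el (z # u) = (if mt (st (last (z # u))) z \<and> pth (st z) u
      then single (ph (st (last (z # u))) z # phs (st z) u) (1 :: 'k) else 0)"
    using el_L1[OF zu] unfolding phs.simps pth.simps nx_S0[OF y z] .
  moreover have "pth (st z) x \<longleftrightarrow> mt (st (last (z # u))) z \<and> pth (st z) u"
    unfolding x pth_snoc F by auto
  ultimately show "La (e (single x 1)) = e (La (single x (1 :: 'k)))"
    using x by (simp del: el.simps pth_snoc phs_snoc)
qed simp_all

lemma h_L0_length:
  fixes f :: "('b, 'k::field) chain"
  assumes "f \<in> chains {l \<in> L0. length l = n}"
  shows "h f \<in> chains {l \<in> L0. length l = Suc n}"
  unfolding h_def
proof (rule ext_in[OF assms])
  fix x assume "x \<in> {l \<in> L0. length l = n}"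
  then obtain a l where x: "x = a # l" "a \<in> S0" "set l \<subseteq> S" "n = Suc (length l)" by (auto simp: L0_def)
  have "(cns (hd' a) (H l (st a)) :: ('b, 'k) chain) \<in> chains {l \<in> L0. length l = Suc n}"
    by (rule cns_chains[OF H_in_S[OF st_in[OF x(2)] x(3)]]) (use x hd_in in \<open>auto simp: L0_def words_def\<close>)
  then show "(hl x :: ('b, 'k) chain) \<in> chains {l \<in> L0. length l = Suc n}" using x by simp
qed simp

end


section \<open>Acyclicity of the Connes complex\<close>

context partial_semigroup
begin

lemma sum_const_pm_scale: "(\<Sum>i<k. f) = pm_scale (of_nat k) f"
  by (rule poly_mapping_eqI) (simp add: lookup_finite_sum)

text \<open>Telescoping gives \<open>Nm j f - La (Nm j f) = f - (La ^^ j) f\<close>. Averaging over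
  j < m leaves f minus 1/m times \<open>Nm m f\<close>, which is f; the average of the
  \<open>Nm j f\<close> is the witness \<open>x\<close>.\<close>

lemma Nm_eq_0_imp:
  fixes f :: "('b, 'k::field_char_0) chain"
  assumes "f \<in> chains (lists_of_length m)" "0 < m" "Nm m f = 0"
  defines "x \<equiv> pm_scale (1 / of_nat m) (\<Sum>j<m. Nm j f)"
  shows "f = x - La x"
proof -
  have tele: "Nm j f - La (Nm j f) = f - (La ^^ j) f" for j
  proof -
    have "La (Nm j f) = (\<Sum>i<j. (La ^^ Suc i) f)" by (simp add: Nm_def)
    then have "Nm j f - La (Nm j f) = (\<Sum>i<j. (La ^^ i) f - (La ^^ Suc i) f)"
      by (simp add: Nm_def sum_subtractf)
    also have "\<dots> = f - (La ^^ j) f" by (induction j) simp_all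
    finally show ?thesis .
  qed
  have "x - La x = pm_scale (1 / of_nat m) (\<Sum>j<m. Nm j f - La (Nm j f))"
    by (simp add: x_def pm.scale_right_diff_distrib sum_subtractf)
  also have "(\<Sum>j<m. Nm j f - La (Nm j f)) = (\<Sum>j<m. f - (La ^^ j) f)"
    by (simp only: tele)
  also have "\<dots> = (\<Sum>j<m. f) - Nm m f"
    by (simp add: sum_subtractf Nm_def)
  also have "\<dots> = (\<Sum>j<m. f)" by (simp add: assms(3))
  also have "(\<Sum>j<m. f) = pm_scale (of_nat m) f"
    by (rule sum_const_pm_scale)
  finally show ?thesis using assms(2) unfolding pm.scale_scale by simp
qed

text \<open>A diagram chase in the first two columns of Tsygan's bicomplex: there the columns are the
  complexes of \<open>Db\<close> and \<open>bp\<close>, and the rows, with maps \<open>1 - La\<close> and \<open>Nm\<close>, are exact in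
  characteristic zero.\<close>

lemma connes_acyclic:
  fixes K :: "nat \<Rightarrow> ('b, 'k::field_char_0) chain set"
  assumes K: "\<And>m. pm.subspace (K m)" and Kl: "\<And>m. K m \<subseteq> chains (lists_of_length m)"
    and L: "\<And>m v. v \<in> K m \<Longrightarrow> La v \<in> K m"
    and D: "\<And>m v. v \<in> K (Suc m) \<Longrightarrow> Db v \<in> K m" and B: "\<And>m v. v \<in> K (Suc m) \<Longrightarrow> bp v \<in> K m"
    and acD: "\<And>m v. v \<in> K (Suc m) \<Longrightarrow> Db v = 0 \<Longrightarrow> \<exists>u\<in>K (Suc (Suc m)). v = Db u"
    and acB: "\<And>m v. v \<in> K (Suc m) \<Longrightarrow> bp v = 0 \<Longrightarrow> \<exists>u\<in>K (Suc (Suc m)). v = bp u"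
    and z: "z \<in> K (Suc n)" and w: "w \<in> K n" and zw: "Db z = w - La w"
  shows "\<exists>u\<in>K (Suc (Suc n)). \<exists>x\<in>K (Suc n). z = Db u + (x - La x)"
  using z w zw
proof (induction n arbitrary: z w rule: less_induct)
  case (less n)
  have Kd: "u - v \<in> K m" if "u \<in> K m" "v \<in> K m" for u v m using K that pm.subspace_diff by blast
  have Ks: "pm_scale c u \<in> K m" if "u \<in> K m" for u m c using K that pm.subspace_scale by blast
  have Kz: "0 \<in> K m" for m using K pm.subspace_0 by blast
  have KN: "Nm j u \<in> K m" if "u \<in> K m" for u j m
  proof -
    have "(La ^^ i) u \<in> K m" for i by (induction i) (use that L in auto)
    then show ?thesis unfolding Nm_def by (intro pm.subspace_sum K)
  qed
  have Klen: "u \<in> chains (lists_of_length m)" if "u \<in> K m" for u m using Kl that by blast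
  show ?case
  proof (cases n)
    case 0
    then have "Db z = 0" using Db_singletons Klen[OF less.prems(1)] by simp
    then obtain u where "u \<in> K (Suc (Suc n))" "z = Db u" using acD less.prems(1) by blast
    then show ?thesis using Kz by (intro bexI[of _ u] bexI[of _ 0]) auto
  next
    case (Suc n1)
    have "\<exists>u\<in>K n. bp (w - Nm n u) = 0"
    proof (cases n1)
      case 0
      then have "bp w = 0" using bp_singletons Klen[OF less.prems(2)] Suc by simp
      then show ?thesis using Kz by (intro bexI[of _ 0]) auto
    next
      case (Suc n2)
      \<comment> \<open>\<open>bp w\<close> is rotation invariant, as derived below from
        \<open>Db (Db z) = 0\<close>; so it is the norm of this multiple of itself. The division
        uses characteristic zero.\<close>
      let ?v = "pm_scale (1 / of_nat n1) (bp w)"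
      have bw: "bp w \<in> K n1" using B less.prems(2) \<open>n = Suc n1\<close> by simp
      then have v: "?v \<in> K n1" by (rule Ks)
      have "bp w - La (bp w) = 0"
        using Db_Db[of z] less.prems(3) Db_one_minus_La[of w] by simp
      then have "La (bp w) = bp w" by simp
      then have "(La ^^ i) (bp w) = bp w" for i by (induction i) simp_all
      then have "Nm n1 (bp w) = (\<Sum>i<n1. bp w)" by (simp add: Nm_def)
      also have "\<dots> = pm_scale (of_nat n1) (bp w)"
        by (rule sum_const_pm_scale)
      finally have "Nm n1 (bp w) = pm_scale (of_nat n1) (bp w)" .
      moreover have "(of_nat n1 :: 'k) \<noteq> 0" unfolding Suc of_nat_eq_0_iff by simp
      ultimately have Nv: "Nm n1 ?v = bp w" by simp
      have n1: "0 < n1" "n1 - 1 = n2" using Suc by simp_all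
      have "Nm (n1 - 1) (Db ?v) = 0" unfolding Nm_Db[OF Klen[OF v] n1(1)] Nv by (rule bp_bp)
      then have "Nm n2 (Db ?v) = 0" unfolding n1(2) .
      moreover have Dv: "Db ?v \<in> K n2" using D v Suc by blast
      \<comment> \<open>Exactness of the rows: \<open>Db ?v\<close> has norm zero, so
        \<open>?v\<close> and the chain x found here meet the hypotheses two degrees lower.\<close>
      ultimately have "\<exists>x\<in>K n2. Db ?v = x - La x"
      proof (cases n2)
        case 0
        then have "Db ?v = 0" using Db_singletons Klen[OF v] Suc by simp
        then show ?thesis using Kz by (intro bexI[of _ 0]) auto
      next
        case (Suc m)
        show ?thesis
        proof (rule bexI)
          show "Db ?v = pm_scale (1 / of_nat n2) (\<Sum>j<n2. Nm j (Db ?v))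
              - La (pm_scale (1 / of_nat n2) (\<Sum>j<n2. Nm j (Db ?v)))"
            using Nm_eq_0_imp[OF Klen[OF Dv]] Suc \<open>Nm n2 (Db ?v) = 0\<close> by blast
          show "pm_scale (1 / of_nat n2) (\<Sum>j<n2. Nm j (Db ?v)) \<in> K n2"
            by (intro Ks pm.subspace_sum K KN Dv)
        qed
      qed
      then obtain x where "x \<in> K n2" "Db ?v = x - La x" by blast
      moreover have "n2 < n" using Suc \<open>n = Suc n1\<close> by simp
      ultimately obtain u y where u: "u \<in> K (Suc (Suc n2))" "y \<in> K (Suc n2)" "?v = Db u + (y - La y)"
        using less.IH[of n2 ?v x] v Suc by blast
      \<comment> \<open>The norm kills y - \<open>La\<close> y, hence \<open>bp w\<close> is the
        norm of \<open>Db u\<close>, that is, \<open>bp (Nm n u)\<close>.\<close>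
      have "bp (Nm n u) = Nm n1 (Db u)"
        using Nm_Db[OF Klen[OF u(1)]] Suc \<open>n = Suc n1\<close> by simp
      moreover have "bp w = Nm n1 (Db u) + (Nm n1 y - Nm n1 (La y))"
        using Nv unfolding u(3) by simp
      moreover have "Nm n1 (La y) = Nm n1 y" using Nm_La[OF Klen[OF u(2)]] Suc by simp
      ultimately have "bp (w - Nm n u) = 0" by simp
      then show ?thesis using u(1) Suc \<open>n = Suc n1\<close> by blast
    qed
    then obtain u where u: "u \<in> K n" "bp (w - Nm n u) = 0" by blast
    then obtain q where q: "q \<in> K (Suc n)" "w - Nm n u = bp q"
      using acB[of "w - Nm n u" n1] Kd[OF less.prems(2) KN[OF u(1)]] Suc by blast
    \<comment> \<open>Subtracting a norm does not change w - \<open>La\<close> w, so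
      \<open>q - La q\<close> has the same boundary as \<open>z\<close>.\<close>
    have "Db (q - La q) = (w - La w) - (Nm n u - La (Nm n u))"
      unfolding Db_one_minus_La q(2)[symmetric] by simp
    also have "\<dots> = Db z" using La_Nm[OF Klen[OF u(1)]] less.prems(3) by simp
    finally have "Db (z - (q - La q)) = 0" by simp
    then obtain r where "r \<in> K (Suc (Suc n))" "z - (q - La q) = Db r"
      using acD[of "z - (q - La q)" n] Kd[OF less.prems(1) Kd[OF q(1) L[OF q(1)]]] by blast
    then show ?thesis using q(1) by (metis diff_add_cancel)
  qed
qed

end

context bar_homotopy
begin

abbreviation X :: "nat \<Rightarrow> 'b list set" where
  "X \<equiv> words S0"

lemma X_L1: "f \<in> chains (X n) \<Longrightarrow> f \<in> chains L1" and X_L0: "f \<in> chains (X n) \<Longrightarrow> f \<in> chains L0"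
  and X_len: "f \<in> chains (X n) \<Longrightarrow> f \<in> chains (lists_of_length n)"
  using L1_L0 by (auto simp: words_def L1_def chains_def)

lemma dot_S0_S0: "a \<in> S0 \<Longrightarrow> b \<in> S0 \<Longrightarrow> ok a b \<Longrightarrow> dot a b \<in> S0"
  using dot_S0 S0_S by blast

lemma bp_X: "f \<in> chains (X (Suc n)) \<Longrightarrow> bp f \<in> chains (X n)"
  by (erule bp_chains) (auto simp: words_def dot_S0_S0)

lemma Db_X: "f \<in> chains (X (Suc n)) \<Longrightarrow> Db f \<in> chains (X n)"
  by (erule Db_chains) (auto simp: words_def dot_S0_S0)

lemma La_X: "f \<in> chains (X n) \<Longrightarrow> La f \<in> chains (X n)"
  by (erule La_chains) (auto simp: words_def L1_def)

lemma ph_in_S0: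
  assumes y: "y \<in> Ob" and a: "a \<in> S0" and mt: "mt y a"
  shows "ph y a \<in> S0"
proof -
  have "ok (gi y) (hd' a)"
    using ok_hd[OF gi_in_S[OF y] a] ok_gi[OF y, of a] S0_S a mt by blast
  then show ?thesis using ph_S0[OF y a mt] dot_S0_S0 gi_in[OF y] hd_in[OF a] by simp
qed

lemma H_in_S0: "y \<in> Ob \<Longrightarrow> set l \<subseteq> S0 \<Longrightarrow> (H l y :: ('b, 'k::field) chain) \<in> chains (words S0 (Suc (length l)))"
  by (rule H_in) (auto intro: gi_in ph_in_S0 subsetD[OF S0_S])

lemma h_X:
  fixes f :: "('b, 'k::field) chain"
  assumes "f \<in> chains (X n)"
  shows "h f \<in> chains (X (Suc n))"
  unfolding h_def
proof (rule ext_in[OF assms])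
  fix x assume "x \<in> X n"
  then obtain a l where x: "x = a # l" "a \<in> S0" "set l \<subseteq> S0" "n = Suc (length l)"
    by (cases x) (auto simp: words_def L1_def)
  have "(cns (hd' a) (H l (st a)) :: ('b, 'k) chain) \<in> chains (X (Suc n))"
    by (rule cns_chains[OF H_in_S0[OF st_in[OF x(2)] x(3)]]) (use x hd_in in \<open>auto simp: words_def L1_def\<close>)
  then show "(hl x :: ('b, 'k) chain) \<in> chains (X (Suc n))" using x by simp
qed simp

text \<open>\<open>bp\<close> is \<open>Db\<close> minus \<open>d0\<close> after \<open>La\<close>,
  and \<open>e\<close> commutes with each of these three operators.\<close>

lemma bp_e:
  assumes f: "f \<in> chains L1"
  shows "bp (e f) = e (bp f)"
proof -
  have L: "La f \<in> chains L1" using f by (rule La_chains) (auto simp: L1_def)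
  then have L0: "f \<in> chains L0" "La f \<in> chains L0" using f L1_L0 chains_mono by blast+
  show ?thesis
    using Db_e[OF L0(1)] La_e[OF f] d0_e[OF L0(2)] by (simp add: Db_eq)
qed

end

text \<open>The last two assumptions make \<open>e\<close> a projection onto the chains on
  \<open>Y\<close>.\<close>

locale bar_retract = bar_homotopy ok dot S S0 Ob mt nx ph gi st hd'
  for ok :: "'b \<Rightarrow> 'b \<Rightarrow> bool" and dot :: "'b \<Rightarrow> 'b \<Rightarrow> 'b"
    and S S0 :: "'b set" and Ob :: "'o set"
    and mt :: "'o \<Rightarrow> 'b \<Rightarrow> bool" and nx :: "'o \<Rightarrow> 'b \<Rightarrow> 'o" and ph :: "'o \<Rightarrow> 'b \<Rightarrow> 'b"
    and gi :: "'o \<Rightarrow> 'b" and st :: "'b \<Rightarrow> 'o" and hd' :: "'b \<Rightarrow> 'b" +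
  fixes Y :: "nat \<Rightarrow> 'b list set"
  assumes Y_X: "Y n \<subseteq> X n"
    and phs_Y: "a # l \<in> L0 \<Longrightarrow> pth (st a) l \<Longrightarrow> ok (gi (fin (st a) l)) (hd' a) \<Longrightarrow>
      dot (gi (fin (st a) l)) (hd' a) # phs (st a) l \<in> Y (Suc (length l))"
    and phs_id: "a # l \<in> Y n \<Longrightarrow> pth (st a) l \<and> ok (gi (fin (st a) l)) (hd' a) \<and>
      dot (gi (fin (st a) l)) (hd' a) # phs (st a) l = a # l"
begin

lemma el_Y: "l \<in> L0 \<Longrightarrow> el l \<in> chains (Y (length l))"
  using phs_Y by (cases l) auto

lemma el_id: "l \<in> Y n \<Longrightarrow> el l = single l 1"
  using phs_id[of _ _ n] Y_X[of n] by (cases l) (auto simp: words_def L1_def)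

lemma e_Y:
  assumes "f \<in> chains L0" "f \<in> chains (lists_of_length n)"
  shows "e f \<in> chains (Y n)"
proof -
  have "f \<in> chains {l \<in> L0. length l = n}" using assms by (auto simp: chains_def)
  then show ?thesis unfolding e_def by (rule ext_in) (auto intro: el_Y)
qed

lemma e_X: "f \<in> chains (X n) \<Longrightarrow> e f \<in> chains (Y n)"
  using e_Y X_L0 X_len by blast

lemma e_id: "f \<in> chains (Y n) \<Longrightarrow> e f = f"
  by (rule lin_eqI[of f "Y n" e "\<lambda>f. f"]) (simp_all add: el_id)

lemma Y_in_X: "f \<in> chains (Y n) \<Longrightarrow> f \<in> chains (X n)"
  using Y_X chains_mono by blast

definition K :: "nat \<Rightarrow> ('b, 'k::field) chain set" where
  "K n = {f \<in> chains (X n). e f = 0}"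

text \<open>\<open>h\<close> need not preserve the kernel of \<open>e\<close>; subtracting
  \<open>e (h f)\<close> brings the primitive back into it, and \<open>F (e (h f)) = e f = 0\<close>
  leaves its image unchanged. Serves for both \<open>Db\<close> and \<open>bp\<close>.\<close>

lemma K_acyclic:
  fixes f :: "('b, 'k::field) chain"
  assumes f: "f \<in> K (Suc n)" and F: "F (h f) = f" "e (F (h f)) = F (e (h f))" "\<And>a b. F (a - b) = F a - F b"
  shows "\<exists>u\<in>K (Suc (Suc n)). f = F u"
proof (rule bexI)
  have hf: "h f \<in> chains (X (Suc (Suc n)))" using f h_X by (auto simp: K_def)
  then have eh: "e (h f) \<in> chains (Y (Suc (Suc n)))" by (rule e_X)
  then show "h f - e (h f) \<in> K (Suc (Suc n))"
    using hf e_id[OF eh] Y_in_X[OF eh] by (auto simp: K_def)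
  show "f = F (h f - e (h f))" using F f by (simp add: K_def)
qed

lemma connes_retract:
  fixes v w :: "('b, 'k::field_char_0) chain"
  assumes v: "v \<in> chains (X (Suc n))" and w: "w \<in> chains (X n)" and vw: "Db v = w - La w"
  shows "\<exists>u\<in>chains (X (Suc (Suc n))). \<exists>x\<in>chains (X (Suc n)). v - e v = Db u + (x - La x)"
proof -
  have eq0: "f - e f \<in> K m" if "f \<in> chains (X m)" for f :: "('b, 'k) chain" and m
    using that e_X[OF that] Y_in_X e_id[OF e_X[OF that]] by (auto simp: K_def)
  have "\<exists>u\<in>K (Suc (Suc n)). \<exists>x\<in>K (Suc n). v - e v = Db u + (x - La x)"
  proof (rule connes_acyclic[where K = K and w = "w - e w"])
    show "pm.subspace (K m)" for m
      using subspace_chains[of "X m"] by (auto simp: pm.subspace_def K_def)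
    show "K m \<subseteq> chains (lists_of_length m)" for m
      using X_len by (auto simp: K_def)
    show "La f \<in> K m" if "f \<in> K m" for f m
      using that La_X[of f m] La_e[OF X_L1, of f m] by (auto simp: K_def)
    show "Db f \<in> K m" if "f \<in> K (Suc m)" for f m
      using that Db_X[of f m] Db_e[OF X_L0, of f "Suc m"] by (auto simp: K_def)
    show "bp f \<in> K m" if "f \<in> K (Suc m)" for f m
      using that bp_X[of f m] bp_e[OF X_L1, of f "Suc m"] by (auto simp: K_def)
    show "\<exists>u\<in>K (Suc (Suc m)). f = Db u" if f: "f \<in> K (Suc m)" and "Db f = 0" for f m
    proof -
      have fX: "f \<in> chains (X (Suc m))" and "e f = 0" using f by (auto simp: K_def)
      then have "Db (h f) = f" using Db_h[OF X_L0[OF fX]] that(2) by simp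
      then show ?thesis using Db_e[OF X_L0[OF h_X[OF fX]]] by (intro K_acyclic f) simp_all
    qed
    show "\<exists>u\<in>K (Suc (Suc m)). f = bp u" if f: "f \<in> K (Suc m)" and "bp f = 0" for f m
    proof -
      have fX: "f \<in> chains (X (Suc m))" using f by (auto simp: K_def)
      then have "bp (h f) = f" using bp_h[OF X_L0[OF fX]] that(2) by simp
      then show ?thesis using bp_e[OF X_L1[OF h_X[OF fX]]] by (intro K_acyclic f) simp_all
    qed
    show "v - e v \<in> K (Suc n)" "w - e w \<in> K n" using v w eq0 by auto
    show "Db (v - e v) = w - e w - La (w - e w)"
      using Db_e[OF X_L0[OF v]] La_e[OF X_L1[OF w]] vw by simp
  qed
  then show ?thesis by (auto simp: K_def)
qed

end


section \<open>Direct sums of homology groups\<close>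

lemma restr_family_commute:
  assumes dP: "disjoint_family_on P I" and dQ: "disjoint_family_on Q I" and i: "i \<in> I"
    and \<phi>: "\<And>j l. j \<in> I \<Longrightarrow> l \<in> P j \<Longrightarrow> \<phi> l \<in> chains (Q j)" and f: "f \<in> chains (\<Union>i\<in>I. P i)"
  shows "restr (Q i) (ext \<phi> f) = ext \<phi> (restr (P i) f)"
proof (rule restr_ext_commute[OF f])
  show "\<phi> l \<in> chains (Q i)" if "l \<in> P i" for l using \<phi> i that by blast
  fix l assume "l \<notin> P i" "l \<in> (\<Union>i\<in>I. P i)"
  then obtain j where j: "j \<in> I" "l \<in> P j" "j \<noteq> i" by blast
  then have "Q i \<inter> Q j = {}" using dQ i by (auto simp: disjoint_family_on_def)
  then show "restr (Q i) (\<phi> l) = 0" using \<phi>[OF j(1,2)] restr_disjoint by blast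
qed

text \<open>Preimages chosen block by block add up to one chain, since only finitely many blocks are
  met. Together with the analogues for sums and preimages of subspaces, this allows cycles and
  boundaries to be formed before or after gluing.\<close>

lemma image_family:
  assumes dP: "disjoint_family_on P I" and dQ: "disjoint_family_on Q I"
    and \<phi>: "\<And>j l. j \<in> I \<Longrightarrow> l \<in> P j \<Longrightarrow> \<phi> l \<in> chains (Q j)"
  shows "(glued I Q (\<lambda>i. ext \<phi> ` chains (P i))) = ext \<phi> ` chains (\<Union>i\<in>I. P i)"
proof (intro equalityI subsetI)
  fix f assume f: "f \<in> (glued I Q (\<lambda>i. ext \<phi> ` chains (P i)))"
  then have "\<forall>i\<in>I. \<exists>u. u \<in> chains (P i) \<and> restr (Q i) f = ext \<phi> u" by auto
  then obtain u where u: "\<And>i. i \<in> I \<Longrightarrow> u i \<in> chains (P i)" "\<And>i. i \<in> I \<Longrightarrow> restr (Q i) f = ext \<phi> (u i)" by metis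
  let ?J = "{i \<in> I. restr (Q i) f \<noteq> 0}"
  have "f = (\<Sum>i\<in>?J. restr (Q i) f)" using restr_family_sum[OF dQ] f by blast
  also have "\<dots> = (\<Sum>i\<in>?J. ext \<phi> (u i))" by (rule sum.cong) (simp_all add: u(2))
  also have "\<dots> = ext \<phi> (\<Sum>i\<in>?J. u i)" by simp
  finally have "f = ext \<phi> (\<Sum>i\<in>?J. u i)" .
  moreover have "(\<Sum>i\<in>?J. u i) \<in> chains (\<Union>i\<in>I. P i)"
    using u(1) chains_mono[of "P _" "\<Union>i\<in>I. P i"] by (intro pm.subspace_sum subspace_chains) blast
  ultimately show "f \<in> ext \<phi> ` chains (\<Union>i\<in>I. P i)" by blast
next
  fix f assume "f \<in> ext \<phi> ` chains (\<Union>i\<in>I. P i)"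
  then obtain u where u: "u \<in> chains (\<Union>i\<in>I. P i)" "f = ext \<phi> u" by blast
  have "\<phi> l \<in> chains (\<Union>i\<in>I. Q i)" if "l \<in> (\<Union>i\<in>I. P i)" for l
    using that \<phi> chains_mono[of "Q _" "\<Union>i\<in>I. Q i"] by blast
  then have "f \<in> chains (\<Union>i\<in>I. Q i)" using u by (auto intro: ext_in)
  then show "f \<in> (glued I Q (\<lambda>i. ext \<phi> ` chains (P i)))"
    using restr_family_commute[OF dP dQ _ \<phi> u(1)] u(2) by auto
qed

lemma sum_family:
  assumes dQ: "disjoint_family_on Q I" and AB: "\<And>i. i \<in> I \<Longrightarrow> A i \<subseteq> chains (Q i)" "\<And>i. i \<in> I \<Longrightarrow> B i \<subseteq> chains (Q i)"
    and 0: "\<And>i. i \<in> I \<Longrightarrow> 0 \<in> A i" "\<And>i. i \<in> I \<Longrightarrow> 0 \<in> B i"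
  shows "(glued I Q (\<lambda>i. {a + b |a b. a \<in> A i \<and> b \<in> B i})) =
    {a + b |a b. a \<in> (glued I Q A) \<and>
      b \<in> (glued I Q B)}"
proof (intro equalityI subsetI)
  fix f assume f: "f \<in> (glued I Q (\<lambda>i. {a + b |a b. a \<in> A i \<and> b \<in> B i}))"
  then have "\<forall>i\<in>I. \<exists>a b. a \<in> A i \<and> b \<in> B i \<and> restr (Q i) f = a + b" by simp blast
  then obtain a b where ab: "\<And>i. i \<in> I \<Longrightarrow> a i \<in> A i" "\<And>i. i \<in> I \<Longrightarrow> b i \<in> B i"
    "\<And>i. i \<in> I \<Longrightarrow> restr (Q i) f = a i + b i" by metis
  let ?J = "{i \<in> I. restr (Q i) f \<noteq> 0}"
  have "f = (\<Sum>i\<in>?J. restr (Q i) f)" using restr_family_sum[OF dQ] f by blast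
  also have "\<dots> = (\<Sum>i\<in>?J. a i + b i)" by (rule sum.cong) (simp_all add: ab(3))
  finally have "f = (\<Sum>i\<in>?J. a i) + (\<Sum>i\<in>?J. b i)" by (simp add: sum.distrib)
  moreover have "(\<Sum>i\<in>?J. c i) \<in> (glued I Q C)"
    if c: "\<And>i. i \<in> I \<Longrightarrow> c i \<in> C i" "\<And>i. i \<in> I \<Longrightarrow> C i \<subseteq> chains (Q i)" "\<And>i. i \<in> I \<Longrightarrow> 0 \<in> C i" for c C
  proof -
    have "(\<Sum>i\<in>?J. c i) \<in> chains (\<Union>i\<in>I. Q i)"
      using c(1,2) chains_mono[of "Q _" "\<Union>i\<in>I. Q i"] by (intro pm.subspace_sum subspace_chains) blast
    moreover have "restr (Q i) (\<Sum>i\<in>?J. c i) = (if i \<in> ?J then c i else 0)" if "i \<in> I" for i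
      by (rule restr_sum_family[OF dQ]) (use c(1,2) that restr_family_finite[OF dQ] in auto)
    ultimately show ?thesis using c(1,3) by auto
  qed
  ultimately show "f \<in> {a + b |a b. a \<in> (glued I Q A) \<and>
      b \<in> (glued I Q B)}"
    using ab(1,2) AB 0 by blast
next
  fix f assume "f \<in> {a + b |a b. a \<in> (glued I Q A) \<and>
      b \<in> (glued I Q B)}"
  then show "f \<in> (glued I Q (\<lambda>i. {a + b |a b. a \<in> A i \<and> b \<in> B i}))"
    by auto blast
qed

lemma preimage_family:
  assumes dP: "disjoint_family_on P I" and dQ: "disjoint_family_on Q I"
    and \<phi>: "\<And>j l. j \<in> I \<Longrightarrow> l \<in> P j \<Longrightarrow> \<phi> l \<in> chains (Q j)"
  shows "(glued I P (\<lambda>i. {v \<in> chains (P i). ext \<phi> v \<in> R i})) =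
    {f \<in> chains (\<Union>i\<in>I. P i). ext \<phi> f \<in> (glued I Q R)}"
proof -
  have "\<phi> l \<in> chains (\<Union>i\<in>I. Q i)" if "l \<in> (\<Union>i\<in>I. P i)" for l
    using that \<phi> chains_mono[of "Q _" "\<Union>i\<in>I. Q i"] by blast
  then have "ext \<phi> f \<in> chains (\<Union>i\<in>I. Q i)" if "f \<in> chains (\<Union>i\<in>I. P i)" for f
    using that by (auto intro: ext_in)
  then show ?thesis
    using restr_family_commute[OF dP dQ _ \<phi>] by auto
qed

lemma words_disjoint: "disjoint_family_on S I \<Longrightarrow> disjoint_family_on (\<lambda>i. words (S i) m) I"
  by (fastforce simp: disjoint_family_on_def words_def neq_Nil_conv)

context partial_semigroup
begin

definition closed_set :: "'b set \<Rightarrow> bool" where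
  "closed_set S \<longleftrightarrow> (\<forall>a\<in>S. \<forall>b\<in>S. ok a b \<longrightarrow> dot a b \<in> S)"

lemma Db_words: "closed_set S \<Longrightarrow> f \<in> chains (words S (Suc m)) \<Longrightarrow> Db f \<in> chains (words S m)"
  by (erule Db_chains) (auto simp: words_def closed_set_def)

lemma La_words: "f \<in> chains (words S m) \<Longrightarrow> La f \<in> chains (words S m)"
  by (erule La_chains) (auto simp: words_def)

definition one_minus_L :: "'b list \<Rightarrow> ('b, 'k::field) chain" where
  "one_minus_L l = single l 1 - Lal l"

lemma ext_one_minus_L: "ext one_minus_L f = f - La f"
  unfolding one_minus_L_def ext_fun_diff by (simp add: La_def)

lemma
  assumes closed: "\<forall>i\<in>I. closed_set (S i)" and dis: "disjoint_family_on S I"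
  defines "U \<equiv> (\<lambda>m. \<Union>i\<in>I. words (S i) m)"
  shows hhZ_family: "{f \<in> chains (U (Suc n)). \<forall>i\<in>I. restr (words (S i) (Suc n)) f \<in> hhZ (words (S i)) n}
      = (hhZ U n :: ('b, 'k::field) chain set)"
    and hhB_family: "{f \<in> chains (U (Suc n)). \<forall>i\<in>I. restr (words (S i) (Suc n)) f \<in> hhB (words (S i)) n}
      = (hhB U n :: ('b, 'k) chain set)"
    and hcZ_family: "{f \<in> chains (U (Suc n)). \<forall>i\<in>I. restr (words (S i) (Suc n)) f \<in> hcZ (words (S i)) n}
      = (hcZ U n :: ('b, 'k) chain set)"
    and hcB_family: "{f \<in> chains (U (Suc n)). \<forall>i\<in>I. restr (words (S i) (Suc n)) f \<in> hcB (words (S i)) n}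
      = (hcB U n :: ('b, 'k) chain set)"
proof -
  note wd = words_disjoint[OF dis] and S = closed[rule_format]
  have D: "(Dl l :: ('b, 'k) chain) \<in> chains (words (S j) m)" if "j \<in> I" "l \<in> words (S j) (Suc m)" for j l m
    using Db_words[OF S[OF that(1)] single_in_chains[OF that(2), of 1]] by (simp add: Db_def)
  have L: "(one_minus_L l :: ('b, 'k) chain) \<in> chains (words (S j) m)" if "l \<in> words (S j) m" for j l m
  proof -
    have "(La (single l 1) :: ('b, 'k) chain) \<in> chains (words (S j) m)"
      by (rule La_words) (use that in simp)
    then show ?thesis using that by (auto simp: one_minus_L_def)
  qed
  have cycB: "cycB P m = ext one_minus_L ` chains (P m)" for P m
    by (simp add: cycB_def ext_one_minus_L)
  have cycB_family: "{f \<in> chains (U m). \<forall>i\<in>I. restr (words (S i) m) f \<in> cycB (words (S i)) m}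
      = (cycB U m :: ('b, 'k) chain set)" for m
    unfolding cycB U_def by (rule image_family[OF wd wd L])
  show hhB: "{f \<in> chains (U (Suc n)). \<forall>i\<in>I. restr (words (S i) (Suc n)) f \<in> hhB (words (S i)) n}
      = (hhB U n :: ('b, 'k) chain set)"
    unfolding hhB_def Db_def U_def by (rule image_family[OF wd wd D])
  have pre: "{f \<in> chains (U (Suc n)). \<forall>i\<in>I. restr (words (S i) (Suc n)) f \<in> {v \<in> chains (words (S i) (Suc n)). ext Dl v \<in> R i}}
      = {f \<in> chains (U (Suc n)). ext Dl f \<in> {f \<in> chains (U n). \<forall>i\<in>I. restr (words (S i) n) f \<in> R i}}"
    for R :: "_ \<Rightarrow> ('b, 'k) chain set"
    unfolding U_def by (rule preimage_family[OF wd wd D])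
  have "{f \<in> chains (U n). \<forall>i\<in>I. restr (words (S i) n) f \<in> {0}} = {0 :: ('b, 'k) chain}"
    using restr_family_sum[OF wd] by (fastforce simp: U_def)
  then have "{f \<in> chains (U (Suc n)). \<forall>i\<in>I. restr (words (S i) (Suc n)) f \<in> {v \<in> chains (words (S i) (Suc n)). ext Dl v \<in> {0}}}
      = {f \<in> chains (U (Suc n)). ext Dl f \<in> {0 :: ('b, 'k) chain}}"
    using pre[of "\<lambda>_. {0}"] by (simp only:)
  then show "{f \<in> chains (U (Suc n)). \<forall>i\<in>I. restr (words (S i) (Suc n)) f \<in> hhZ (words (S i)) n}
      = (hhZ U n :: ('b, 'k) chain set)"
    unfolding hhZ_def Db_def by simp
  show "{f \<in> chains (U (Suc n)). \<forall>i\<in>I. restr (words (S i) (Suc n)) f \<in> hcZ (words (S i)) n}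
      = (hcZ U n :: ('b, 'k) chain set)"
    using pre[of "\<lambda>i. cycB (words (S i)) n"] unfolding cycB_family hcZ_def Db_def .
  have 0: "(0 :: ('b, 'k) chain) \<in> cycB P m" "(0 :: ('b, 'k) chain) \<in> hhB P m" for P m
    unfolding cycB_def hhB_def by (force intro!: image_eqI[of _ _ 0])+
  have c: "(cycB (words (S i)) (Suc n) :: ('b, 'k) chain set) \<subseteq> chains (words (S i) (Suc n))" for i
    using La_words by (auto simp: cycB_def)
  have d: "(hhB (words (S i)) n :: ('b, 'k) chain set) \<subseteq> chains (words (S i) (Suc n))" if "i \<in> I" for i
    using Db_words[OF S[OF that]] by (auto simp: hhB_def)
  show "{f \<in> chains (U (Suc n)). \<forall>i\<in>I. restr (words (S i) (Suc n)) f \<in> hcB (words (S i)) n}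
      = (hcB U n :: ('b, 'k) chain set)"
    unfolding hcB_def hhB[symmetric] cycB_family[symmetric] unfolding U_def
    by (rule sum_family[OF wd c d 0]) assumption
qed

end

context based_algebra
begin

lemma blists_words: "blists (Suc n) = words S (Suc n)"
  by (auto simp: blists_def words_def)

lemma closed_S: "closed_set S"
  using dot_in by (simp add: closed_set_def)

lemma presents_HH_words: "presents (HH A n) (hhZ (words S) n) (hhB (words S) n) (hh_class n)"
  using presents_HH[of n] by (simp add: hhZ_def hhB_def blists_words)

lemma presents_HC_words: "presents (HC A n) (hcZ (words S) n) (hcB (words S) n) (hc_class n)"
proof -
  \<comment> \<open>\<open>blists 0\<close> contains the empty word and \<open>words S 0\<close>
    does not, so degree 0 is checked separately; boundaries of single letters vanish there.\<close>
  have "hc_cycles n = hcZ (words S) n"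
  proof (cases n)
    case 0
    have "(0 :: ('b, 'k) chain) \<in> cycB (words S) 0" unfolding cycB_def by (rule image_eqI[of _ _ 0]) auto
    then show ?thesis
      using pm.subspace_0[OF subspace_cyc_rels] 0
      by (auto simp: hcZ_def Db_blists_singletons blists_words[symmetric])
  qed (simp add: hcZ_def cycB_def blists_words)
  moreover have "hc_bounds n = hcB (words S) n"
    by (auto simp: hcB_def hhB_def cycB_def blists_words)
  ultimately show ?thesis using presents_HC[of n] by simp
qed

end

lemma
  fixes A :: "'i \<Rightarrow> ('k::field, 'a) module"
  assumes "partial_semigroup ok dot"
    and A: "\<And>i. i \<in> I \<Longrightarrow> based_algebra ok dot (A i) (S i) coord bas" and dis: "disjoint_family_on S I"
  shows presents_HH_sum: "\<exists>q. presents (direct_sum I (\<lambda>i. HH (A i) n))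
      (partial_semigroup.hhZ ok dot (\<lambda>m. \<Union>i\<in>I. words (S i) m) n)
      (partial_semigroup.hhB ok dot (\<lambda>m. \<Union>i\<in>I. words (S i) m) n) q"
    and presents_HC_sum: "\<exists>q. presents (direct_sum I (\<lambda>i. HC (A i) n))
      (partial_semigroup.hcZ ok dot (\<lambda>m. \<Union>i\<in>I. words (S i) m) n)
      (partial_semigroup.hcB ok dot (\<lambda>m. \<Union>i\<in>I. words (S i) m) n) q"
proof -
  interpret partial_semigroup ok dot by fact
  have S: "\<forall>i\<in>I. closed_set (S i)" using based_algebra.closed_S[OF A] by blast
  note wd = words_disjoint[OF dis]
  have "presents (direct_sum I (\<lambda>i. HH (A i) n))
      {f \<in> chains (\<Union>i\<in>I. words (S i) (Suc n)). \<forall>i\<in>I. restr (words (S i) (Suc n)) f \<in> hhZ (words (S i)) n}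
      {f \<in> chains (\<Union>i\<in>I. words (S i) (Suc n)). \<forall>i\<in>I. restr (words (S i) (Suc n)) f \<in> hhB (words (S i)) n}
      (\<lambda>f. \<lambda>i\<in>I. based_algebra.hh_class (A i) bas n (restr (words (S i) (Suc n)) f))"
    by (rule presents_direct_sum[OF based_algebra.presents_HH_words[OF A] _ wd]) (auto simp: hhZ_def)
  then show "\<exists>q. presents (direct_sum I (\<lambda>i. HH (A i) n))
      (hhZ (\<lambda>m. \<Union>i\<in>I. words (S i) m) n) (hhB (\<lambda>m. \<Union>i\<in>I. words (S i) m) n) q"
    unfolding hhZ_family[OF S dis] hhB_family[OF S dis] by blast
  have "presents (direct_sum I (\<lambda>i. HC (A i) n))
      {f \<in> chains (\<Union>i\<in>I. words (S i) (Suc n)). \<forall>i\<in>I. restr (words (S i) (Suc n)) f \<in> hcZ (words (S i)) n}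
      {f \<in> chains (\<Union>i\<in>I. words (S i) (Suc n)). \<forall>i\<in>I. restr (words (S i) (Suc n)) f \<in> hcB (words (S i)) n}
      (\<lambda>f. \<lambda>i\<in>I. based_algebra.hc_class (A i) bas n (restr (words (S i) (Suc n)) f))"
    by (rule presents_direct_sum[OF based_algebra.presents_HC_words[OF A] _ wd]) (auto simp: hcZ_def)
  then show "\<exists>q. presents (direct_sum I (\<lambda>i. HC (A i) n))
      (hcZ (\<lambda>m. \<Union>i\<in>I. words (S i) m) n) (hcB (\<lambda>m. \<Union>i\<in>I. words (S i) m) n) q"
    unfolding hcZ_family[OF S dis] hcB_family[OF S dis] by blast
qed

context bar_retract
begin

lemma retract_HC:
  assumes P: "presents (M :: ('k::field_char_0, 'v) module) (hcZ (words S0) n) (hcB (words S0) n) q"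
    and P': "presents (M' :: ('k, 'w) module) (hcZ Y n) (hcB Y n) q'"
  shows "M \<cong>\<^sub>v M'"
proof (rule vs_iso_presents[OF P P'])
  show "(hcZ Y n :: ('b, 'k) chain set) \<subseteq> hcZ (words S0) n" "(hcB Y n :: ('b, 'k) chain set) \<subseteq> hcB (words S0) n"
    using Y_in_X by (fastforce simp: hcZ_def hcB_def cycB_def hhB_def)+
  show "(hcZ Y n :: ('b, 'k) chain set) \<inter> hcB (words S0) n \<subseteq> hcB Y n"
  proof
    fix v :: "('b, 'k) chain" assume v: "v \<in> hcZ Y n \<inter> hcB (words S0) n"
    then obtain w u where w: "w \<in> chains (X (Suc n))" and u: "u \<in> chains (X (Suc (Suc n)))"
      and eq: "v = (w - La w) + Db u"
      by (auto simp: hcB_def cycB_def hhB_def)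
    \<comment> \<open>\<open>e\<close> commutes with \<open>Db\<close> and \<open>La\<close>, so
      applying it to the chains \<open>w\<close> and \<open>u\<close> that bound \<open>v\<close>
      moves them into \<open>Y\<close> without changing \<open>v\<close>.\<close>
    have "v = e v" using v e_id[of v "Suc n"] by (simp add: hcZ_def)
    also have "\<dots> = (e w - La (e w)) + Db (e u)"
      by (simp add: eq La_e[OF X_L1[OF w]] Db_e[OF X_L0[OF u]])
    finally show "v \<in> hcB Y n"
      using e_X[OF w] e_X[OF u] by (auto simp: hcB_def cycB_def hhB_def)
  qed
  fix v :: "('b, 'k) chain" assume "v \<in> hcZ (words S0) n"
  then obtain w where v: "v \<in> chains (X (Suc n))" and w: "w \<in> chains (X n)" "Db v = w - La w"
    by (auto simp: hcZ_def cycB_def)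
  obtain u x where "u \<in> chains (X (Suc (Suc n)))" "x \<in> chains (X (Suc n))" "v - e v = Db u + (x - La x)"
    using connes_retract[OF v w] by blast
  then have "v - e v \<in> hcB (words S0) n"
    unfolding hcB_def cycB_def hhB_def by (auto simp: add.commute)
  moreover have "Db (e v) = e w - La (e w)"
    using Db_e[OF X_L0[OF v]] La_e[OF X_L1[OF w(1)]] w(2) by simp
  then have "e v \<in> hcZ Y n"
    using e_X[OF v] e_X[OF w(1)] by (auto simp: hcZ_def cycB_def)
  ultimately show "\<exists>v'\<in>hcZ Y n. v - v' \<in> hcB (words S0) n" by blast
qed

lemma retract_HH:
  assumes P: "presents (M :: ('k::field, 'v) module) (hhZ (words S0) n) (hhB (words S0) n) q"
    and P': "presents (M' :: ('k, 'w) module) (hhZ Y n) (hhB Y n) q'"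
  shows "M \<cong>\<^sub>v M'"
proof (rule vs_iso_presents[OF P P'])
  show "(hhZ Y n :: ('b, 'k) chain set) \<subseteq> hhZ (words S0) n" "(hhB Y n :: ('b, 'k) chain set) \<subseteq> hhB (words S0) n"
    using Y_in_X by (fastforce simp: hhZ_def hhB_def)+
  show "(hhZ Y n :: ('b, 'k) chain set) \<inter> hhB (words S0) n \<subseteq> hhB Y n"
  proof
    fix v :: "('b, 'k) chain" assume v: "v \<in> hhZ Y n \<inter> hhB (words S0) n"
    then obtain u where u: "u \<in> chains (X (Suc (Suc n)))" and eq: "v = Db u"
      by (auto simp: hhB_def)
    have "v = e v" using v e_id[of v "Suc n"] by (simp add: hhZ_def)
    also have "\<dots> = Db (e u)" by (simp add: eq Db_e[OF X_L0[OF u]])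
    finally show "v \<in> hhB Y n" using e_X[OF u] by (auto simp: hhB_def)
  qed
  fix v :: "('b, 'k) chain" assume "v \<in> hhZ (words S0) n"
  then have v: "v \<in> chains (X (Suc n))" "Db v = 0" by (auto simp: hhZ_def)
  have "v - e v = Db (h v)" using Db_h[OF X_L0[OF v(1)]] v(2) by simp
  then have "v - e v \<in> hhB (words S0) n"
    using h_X[OF v(1)] by (auto simp: hhB_def)
  moreover have "e v \<in> hhZ Y n"
    using e_X[OF v(1)] Db_e[OF X_L0[OF v(1)]] v(2) by (simp add: hhZ_def)
  ultimately show "\<exists>v'\<in>hhZ Y n. v - v' \<in> hhB (words S0) n" by blast
qed

end


section \<open>Groupoids\<close>

text \<open>\<open>None\<close> is the adjoined unit. Membership in \<open>Mor G\<close> is part of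
  the condition because \<open>partial_semigroup\<close> requires associativity for all values of
  the type, including those that are no arrows.\<close>

definition gok :: "('o, 'm) groupoid \<Rightarrow> 'm option \<Rightarrow> 'm option \<Rightarrow> bool" where
  "gok G a b = (case a of None \<Rightarrow> True | Some g \<Rightarrow>
     (case b of None \<Rightarrow> True | Some h \<Rightarrow> g \<in> Mor G \<and> h \<in> Mor G \<and> src G g = tgt G h))"

definition gdot :: "('o, 'm) groupoid \<Rightarrow> 'm option \<Rightarrow> 'm option \<Rightarrow> 'm option" where
  "gdot G a b = (case a of None \<Rightarrow> b | Some g \<Rightarrow> (case b of None \<Rightarrow> Some g | Some h \<Rightarrow> Some (mcomp G g h)))"

lemma gok_simps [simp]:
  "gok G None b" "gok G a None" "gok G (Some g) (Some h) \<longleftrightarrow> g \<in> Mor G \<and> h \<in> Mor G \<and> src G g = tgt G h"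
  by (simp_all add: gok_def split: option.splits)

lemma gdot_simps [simp]:
  "gdot G None b = b" "gdot G a None = a" "gdot G (Some g) (Some h) = Some (mcomp G g h)"
  by (simp_all add: gdot_def split: option.splits)

definition loops :: "('o, 'm) groupoid \<Rightarrow> 'o \<Rightarrow> 'm set" where
  "loops G x = {l \<in> Mor G. src G l = x \<and> tgt G l = x}"

definition ginv :: "('o, 'm) groupoid \<Rightarrow> 'm \<Rightarrow> 'm" where
  "ginv G g = (SOME h. h \<in> Mor G \<and> src G h = tgt G g \<and> tgt G h = src G g \<and>
     mcomp G h g = ident G (src G g) \<and> mcomp G g h = ident G (tgt G g))"

context groupoid
begin

lemma partial_semigroup_gok: "partial_semigroup (gok G) (gdot G)"
proof
  fix a b c :: "'m option"
  show "(gok G a b \<and> gok G (gdot G a b) c) = (gok G b c \<and> gok G a (gdot G b c))"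
    by (cases a; cases b; cases c) (auto simp: comp_closed src_comp tgt_comp)
  show "gdot G (gdot G a b) c = gdot G a (gdot G b c)" if "gok G a b" "gok G (gdot G a b) c"
    using that by (cases a; cases b; cases c) (auto simp: comp_assoc src_comp)
qed

lemma ginv:
  assumes "g \<in> Mor G"
  shows "ginv G g \<in> Mor G" "src G (ginv G g) = tgt G g" "tgt G (ginv G g) = src G g"
    "mcomp G (ginv G g) g = ident G (src G g)" "mcomp G g (ginv G g) = ident G (tgt G g)"
  using someI_ex[of "\<lambda>h. h \<in> Mor G \<and> src G h = tgt G g \<and> tgt G h = src G g \<and>
     mcomp G h g = ident G (src G g) \<and> mcomp G g h = ident G (tgt G g)"] invertible[OF assms]
  unfolding ginv_def[symmetric] by auto

lemma comp_ginv_cancel: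
  assumes "h \<in> Mor G" "k \<in> Mor G" "src G h = tgt G k"
  shows "mcomp G (mcomp G h k) (ginv G k) = h"
  using assms ginv[OF assms(2)] comp_assoc[of h k "ginv G k"] comp_ident_right[of h] by simp

end

text \<open>Choosing the identity as \<gamma> at a base point makes conjugation trivial on loops
  there, so that \<open>e\<close> fixes the words in one vertex group.\<close>

locale based_groupoid = groupoid G for G :: "('o, 'm) groupoid" +
  fixes base :: "'o \<Rightarrow> 'o" and \<gamma> :: "'o \<Rightarrow> 'm"
  assumes gam: "y \<in> Obj G \<Longrightarrow> \<gamma> y \<in> Mor G" "y \<in> Obj G \<Longrightarrow> tgt G (\<gamma> y) = y" "y \<in> Obj G \<Longrightarrow> src G (\<gamma> y) = base y"
    and base_in: "y \<in> Obj G \<Longrightarrow> base y \<in> Obj G"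
    and base_mor: "g \<in> Mor G \<Longrightarrow> base (src G g) = base (tgt G g)"
    and gam_base: "y \<in> Obj G \<Longrightarrow> \<gamma> (base y) = ident G (base y)"
begin

definition phi :: "'m \<Rightarrow> 'm" where
  "phi g = mcomp G (mcomp G (ginv G (\<gamma> (tgt G g))) g) (\<gamma> (src G g))"

primrec mt :: "'o \<Rightarrow> 'm option \<Rightarrow> bool" where
  "mt y None \<longleftrightarrow> True"
| "mt y (Some g) \<longleftrightarrow> tgt G g = y"

primrec nx :: "'o \<Rightarrow> 'm option \<Rightarrow> 'o" where
  "nx y None = y"
| "nx y (Some g) = src G g"

primrec ph :: "'o \<Rightarrow> 'm option \<Rightarrow> 'm option" where
  "ph y None = Some (ident G (base y))"
| "ph y (Some g) = Some (phi g)"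

definition gi :: "'o \<Rightarrow> 'm option" where
  "gi y = Some (ginv G (\<gamma> y))"

definition st :: "'m option \<Rightarrow> 'o" where
  "st a = src G (the a)"

definition hd' :: "'m option \<Rightarrow> 'm option" where
  "hd' a = Some (mcomp G (the a) (\<gamma> (src G (the a))))"

definition Y :: "nat \<Rightarrow> 'm option list set" where
  "Y n = (\<Union>b\<in>base ` Obj G. words (Some ` loops G b) n)"

section \<open>Conjugation into the vertex groups\<close>

lemma gam_src [simp]:
  assumes "g \<in> Mor G"
  shows "\<gamma> (src G g) \<in> Mor G" "tgt G (\<gamma> (src G g)) = src G g" "src G (\<gamma> (src G g)) = base (src G g)"
    "\<gamma> (tgt G g) \<in> Mor G" "tgt G (\<gamma> (tgt G g)) = tgt G g" "src G (\<gamma> (tgt G g)) = base (tgt G g)"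
  using assms src_closed tgt_closed gam by auto

lemma half_phi:
  assumes "g \<in> Mor G"
  shows "mcomp G (ginv G (\<gamma> (tgt G g))) g \<in> Mor G" "src G (mcomp G (ginv G (\<gamma> (tgt G g))) g) = src G g"
    "tgt G (mcomp G (ginv G (\<gamma> (tgt G g))) g) = base (tgt G g)"
  using assms by (simp_all add: comp_closed src_comp tgt_comp ginv)

lemma phi_mor:
  assumes "g \<in> Mor G"
  shows "phi g \<in> Mor G" "src G (phi g) = base (src G g)" "tgt G (phi g) = base (tgt G g)"
  using assms half_phi[OF assms] by (simp_all add: phi_def comp_closed src_comp tgt_comp)

lemma phi_gi:
  assumes "g \<in> Mor G"
  shows "mcomp G (phi g) (ginv G (\<gamma> (src G g))) = mcomp G (ginv G (\<gamma> (tgt G g))) g"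
  unfolding phi_def using assms half_phi[OF assms] by (simp add: comp_ginv_cancel)

lemma phi_alt:
  assumes "g \<in> Mor G"
  shows "phi g = mcomp G (ginv G (\<gamma> (tgt G g))) (mcomp G g (\<gamma> (src G g)))"
  unfolding phi_def using assms by (simp add: comp_assoc ginv)

lemma phi_comp:
  assumes g: "g \<in> Mor G" and h: "h \<in> Mor G" and gh: "src G g = tgt G h"
  shows "mcomp G (phi g) (phi h) = phi (mcomp G g h)"
proof -
  let ?k = "ginv G (\<gamma> (tgt G h))"
  have k: "?k \<in> Mor G" "tgt G ?k = base (tgt G h)" "src G ?k = tgt G h" using h by (simp_all add: ginv)
  have "mcomp G (phi g) (phi h) = mcomp G (mcomp G (phi g) (mcomp G ?k h)) (\<gamma> (src G h))"
    unfolding phi_def[of h] using h half_phi[OF h] phi_mor[OF g] gh by (simp add: comp_assoc)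
  also have "mcomp G (phi g) (mcomp G ?k h) = mcomp G (mcomp G (phi g) ?k) h"
    using h k phi_mor[OF g] gh by (simp add: comp_assoc)
  also have "mcomp G (phi g) ?k = mcomp G (ginv G (\<gamma> (tgt G g))) g"
    using phi_gi[OF g] gh by simp
  also have "mcomp G (mcomp G (ginv G (\<gamma> (tgt G g))) g) h = mcomp G (ginv G (\<gamma> (tgt G g))) (mcomp G g h)"
    using g h gh by (simp add: comp_assoc ginv)
  finally show ?thesis
    using g h gh by (simp add: phi_def src_comp tgt_comp)
qed

lemma base_ident:
  assumes "y \<in> Obj G"
  shows "ident G (base y) \<in> Mor G" "src G (ident G (base y)) = base y" "tgt G (ident G (base y)) = base y"
  using assms base_in ident_closed src_ident tgt_ident by auto

lemma hom_mor:
  assumes "g \<in> Mor G"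
  shows "mcomp G g (\<gamma> (src G g)) \<in> Mor G" "src G (mcomp G g (\<gamma> (src G g))) = base (src G g)"
    "tgt G (mcomp G g (\<gamma> (src G g))) = tgt G g"
  using assms by (simp_all add: comp_closed src_comp tgt_comp)

lemma bar_homotopy_groupoid: "bar_homotopy (gok G) (gdot G) (insert None (Some ` Mor G)) (Some ` Mor G) (Obj G) mt nx ph gi st hd'"
proof -
  interpret partial_semigroup "gok G" "gdot G" by (rule partial_semigroup_gok)
  show ?thesis
  proof unfold_locales
    fix a b z :: "'m option" and y :: 'o
    let ?S = "insert None (Some ` Mor G)" and ?T = "Some ` Mor G"
    show "?T \<subseteq> ?S" by blast
    show "gdot G a b \<in> ?S" if "a \<in> ?S" "b \<in> ?S" "gok G a b"
      using that by (auto simp: comp_closed)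
    show "gdot G a b \<in> ?T" if "a \<in> ?T" "b \<in> ?S" "gok G a b"
      using that by (auto simp: comp_closed)
    show "gdot G b a \<in> ?T" if "b \<in> ?S" "a \<in> ?T" "gok G b a"
      using that by (auto simp: comp_closed)
    show "nx y a \<in> Obj G" if "y \<in> Obj G" "a \<in> ?S"
      using that by (auto simp: src_closed)
    show "st a \<in> Obj G" if "a \<in> ?T" using that by (auto simp: src_closed st_def)
    show "gi y \<in> ?T" if "y \<in> Obj G" using that by (auto simp: gi_def ginv gam)
    show "hd' a \<in> ?T" if "a \<in> ?T" using that by (auto simp: hd'_def hom_mor)
    show "ph y a \<in> ?S" if "y \<in> Obj G" "a \<in> ?S" "mt y a"
      using that by (auto simp: phi_mor base_ident)
    show "gok G (gi y) a = mt y a" if "y \<in> Obj G" "a \<in> ?S"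
      using that by (auto simp: gi_def ginv gam)
    show "gok G (ph y a) (gi (nx y a)) \<and> gdot G (ph y a) (gi (nx y a)) = gdot G (gi y) a"
      if "y \<in> Obj G" "a \<in> ?S" "mt y a"
    proof (cases a)
      case None
      then show ?thesis
        using that base_ident[OF that(1)] comp_ident_left[of "ginv G (\<gamma> y)"] by (simp add: gi_def ginv gam)
    next
      case (Some g)
      then show ?thesis using that by (auto simp: gi_def ginv phi_mor phi_gi)
    qed
    show "mt y (gdot G a b) \<longleftrightarrow> mt y a \<and> mt (nx y a) b" if "y \<in> Obj G" "a \<in> ?S" "b \<in> ?S" "gok G a b"
      using that by (auto simp: tgt_comp)
    show "gok G a b" if "y \<in> Obj G" "a \<in> ?S" "b \<in> ?S" "mt y a" "mt (nx y a) b"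
      using that by auto
    show "nx y (gdot G a b) = nx (nx y a) b" if "y \<in> Obj G" "a \<in> ?S" "b \<in> ?S" "gok G a b"
      using that by (auto simp: src_comp)
    show "gok G (ph y a) (ph (nx y a) b) \<and> gdot G (ph y a) (ph (nx y a) b) = ph y (gdot G a b)"
      if "y \<in> Obj G" "a \<in> ?S" "b \<in> ?S" "mt y a" "mt (nx y a) b"
    proof (cases a)
      case None
      then show ?thesis
        using that base_ident[OF that(1)] comp_ident_left[of "ident G (base y)"]
          comp_ident_left[OF phi_mor(1)] by (auto simp: phi_mor)
    next
      case (Some g)
      then show ?thesis
        using that base_ident[OF src_closed, of g] comp_ident_right[OF phi_mor(1), of g] by (auto simp: phi_mor phi_comp)
    qed
    show "gok G (hd' a) (gi (st a)) \<and> gdot G (hd' a) (gi (st a)) = a" if "a \<in> ?T"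
      using that by (auto simp: hd'_def gi_def st_def ginv hom_mor comp_ginv_cancel)
    show "gok G a b = mt (st a) b" if "a \<in> ?T" "b \<in> ?S"
      using that by (auto simp: st_def)
    show "st (gdot G a b) = nx (st a) b" if "a \<in> ?T" "b \<in> ?S" "gok G a b"
      using that by (auto simp: st_def src_comp)
    show "gok G (hd' a) (ph (st a) b) \<and> gdot G (hd' a) (ph (st a) b) = hd' (gdot G a b)"
      if ab: "a \<in> ?T" "b \<in> ?S" "gok G a b"
    proof -
      obtain g where g: "a = Some g" "g \<in> Mor G" using ab(1) by auto
      show ?thesis
      proof (cases b)
        case None
        then show ?thesis
          using g base_ident[OF src_closed, of g] comp_ident_right[OF hom_mor(1), of g]
          by (simp add: hd'_def st_def hom_mor)
      next
        case (Some h)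
        then have h: "h \<in> Mor G" "src G g = tgt G h" using ab g by auto
        have gg: "mcomp G g (\<gamma> (src G g)) \<in> Mor G" "src G (mcomp G g (\<gamma> (src G g))) = base (tgt G h)"
          using hom_mor[OF g(2)] h(2) by simp_all
        have "mcomp G (mcomp G g (\<gamma> (src G g))) (phi h)
            = mcomp G (mcomp G (mcomp G g (\<gamma> (src G g))) (ginv G (\<gamma> (tgt G h)))) (mcomp G h (\<gamma> (src G h)))"
          unfolding phi_alt[OF h(1)] using gg h hom_mor[OF h(1)] by (simp add: comp_assoc ginv)
        also have "mcomp G (mcomp G g (\<gamma> (src G g))) (ginv G (\<gamma> (tgt G h))) = g"
          using g(2) h by (simp add: comp_ginv_cancel)
        also have "mcomp G g (mcomp G h (\<gamma> (src G h))) = mcomp G (mcomp G g h) (\<gamma> (src G h))"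
          using g(2) h by (simp add: comp_assoc)
        finally show ?thesis
          using g h gg Some by (simp add: hd'_def st_def phi_mor src_comp)
      qed
    qed
    show "gok G z (hd' a) = gok G z a" if "z \<in> ?S" "a \<in> ?T"
      using that by (auto simp: hd'_def hom_mor)
    show "gdot G z (hd' a) = hd' (gdot G z a)" if "z \<in> ?S" "a \<in> ?T" "gok G z a"
      using that by (auto simp: hd'_def comp_assoc src_comp)
    show "st (gdot G z a) = st a" if "z \<in> ?S" "a \<in> ?T" "gok G z a"
      using that by (auto simp: st_def src_comp)
    show "nx y a = st a" if "y \<in> Obj G" "a \<in> ?T" using that by (auto simp: st_def)
    show "ph y a = gdot G (gi y) (hd' a)" if "y \<in> Obj G" "a \<in> ?T" "mt y a"
      using that by (auto simp: gi_def hd'_def phi_alt)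
  qed
qed

sublocale bar_homotopy "gok G" "gdot G" "insert None (Some ` Mor G)" "Some ` Mor G" "Obj G" mt nx ph gi st hd'
  by (rule bar_homotopy_groupoid)

lemma phs_loops:
  assumes "y \<in> Obj G" "set l \<subseteq> insert None (Some ` Mor G)" "pth y l"
  shows "set (phs y l) \<subseteq> Some ` loops G (base y) \<and> base (fin y l) = base y"
  using assms
proof (induction l arbitrary: y)
  case (Cons a l)
  show ?case
  proof (cases a)
    case None
    then show ?thesis using Cons base_ident[of y] by (auto simp: loops_def)
  next
    case (Some g)
    then have g: "g \<in> Mor G" "tgt G g = y" "base (src G g) = base y" using Cons.prems base_mor[of g] by auto
    then show ?thesis using Cons.IH[of "src G g"] Cons.prems Some phi_mor[OF g(1)] src_closed[OF g(1)]
      by (auto simp: loops_def)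
  qed
qed simp

lemma loops_phi:
  assumes "b \<in> base ` Obj G" "g \<in> loops G b"
  shows "phi g = g" "mcomp G (ginv G (\<gamma> b)) (mcomp G g (\<gamma> b)) = g"
proof -
  have b: "b \<in> Obj G" "\<gamma> b = ident G b" using assms(1) base_in gam_base by auto
  have g: "g \<in> Mor G" "src G g = b" "tgt G g = b" using assms(2) by (auto simp: loops_def)
  have "ginv G (ident G b) = ident G b"
    using ginv[OF ident_closed[OF b(1)]] comp_ident_right[OF ginv(1)[OF ident_closed[OF b(1)]]]
      src_ident[OF b(1)] tgt_ident[OF b(1)] by simp
  then show "mcomp G (ginv G (\<gamma> b)) (mcomp G g (\<gamma> b)) = g"
    using b g comp_ident_right[OF g(1)] comp_ident_left[OF g(1)] by simp
  then show "phi g = g" using phi_alt[OF g(1)] g by simp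
qed

lemma loops_path:
  assumes "b \<in> base ` Obj G" "set l \<subseteq> Some ` loops G b"
  shows "pth b l \<and> phs b l = l \<and> fin b l = b"
  using assms(2)
proof (induction l)
  case (Cons a l)
  then obtain g where g: "a = Some g" "g \<in> loops G b" by auto
  then have "src G g = b" "tgt G g = b" by (auto simp: loops_def)
  then show ?case using Cons g loops_phi(1)[OF assms(1) g(2)] by auto
qed simp

sublocale bar_retract "gok G" "gdot G" "insert None (Some ` Mor G)" "Some ` Mor G" "Obj G" mt nx ph gi st hd' Y
proof
  show "Y n \<subseteq> X n" for n
    by (auto simp: Y_def words_def loops_def)
  fix a l
  show "gdot G (gi (fin (st a) l)) (hd' a) # phs (st a) l \<in> Y (Suc (length l))"
    if al: "a # l \<in> L0" "pth (st a) l" "gok G (gi (fin (st a) l)) (hd' a)"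
  proof -
    obtain g where g: "a = Some g" "g \<in> Mor G" and l: "set l \<subseteq> insert None (Some ` Mor G)"
      using al(1) by (auto simp: L0_def)
    have F: "fin (st a) l \<in> Obj G" using l src_closed[OF g(2)] g fin_in by (simp add: st_def)
    \<comment> \<open>The closing condition forces the path to end at the target of the first
      letter; then the first letter of \<open>el\<close> is the conjugate
      \<open>phi g\<close>.\<close>
    then have t: "fin (st a) l = tgt G g" using al(3) g hom_mor[OF g(2)] by (simp add: gi_def hd'_def ginv gam)
    have "gdot G (gi (fin (st a) l)) (hd' a) = Some (phi g)"
      unfolding t phi_alt[OF g(2)] by (simp add: gi_def hd'_def g)
    moreover have "set (phs (st a) l) \<subseteq> Some ` loops G (base (src G g))" "base (tgt G g) = base (src G g)"
      using phs_loops[of "st a" l] l al(2) src_closed[OF g(2)] t g by (auto simp: st_def)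
    ultimately show ?thesis
      using phi_mor[OF g(2)] src_closed[OF g(2)] by (auto simp: Y_def words_def loops_def)
  qed
  show "pth (st a) l \<and> gok G (gi (fin (st a) l)) (hd' a) \<and> gdot G (gi (fin (st a) l)) (hd' a) # phs (st a) l = a # l"
    if aY: "a # l \<in> Y n" for n
  proof -
    obtain b where b: "b \<in> base ` Obj G" "set (a # l) \<subseteq> Some ` loops G b" using aY by (auto simp: Y_def words_def)
    then obtain g where g: "a = Some g" "g \<in> loops G b" by auto
    then have m: "g \<in> Mor G" "src G g = b" "tgt G g = b" by (auto simp: loops_def)
    have "b \<in> Obj G" using b base_in by auto
    then show ?thesis
      using loops_path[of b l] b g m loops_phi(2)[OF b(1) g(2)] hom_mor[OF m(1)]
      by (simp add: st_def gi_def hd'_def ginv gam)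
  qed
qed

end


section \<open>The complex of the unitization\<close>

definition RS :: "'m option list set" where
  "RS = {l. \<exists>a\<in>set l. a \<noteq> None}"

locale based_groupoid_finite = based_groupoid G base \<gamma>
  for G :: "('o, 'm) groupoid" and base :: "'o \<Rightarrow> 'o" and \<gamma> :: "'o \<Rightarrow> 'm" +
  fixes F :: "'o set"
  assumes finF: "finite F" and F_Obj: "F \<subseteq> Obj G"
begin

text \<open>The element \<open>1 - (\<Sum>y\<in>F. id y)\<close> of the unitization is idempotent and annihilates the arrows between
  objects of \<open>F\<close>; \<open>epsc\<close> prepends it to a word, \<open>epsa\<close> multiplies the first letter by it.\<close>

definition epsc :: "('m option, 'k::field) chain \<Rightarrow> ('m option, 'k) chain" where
  "epsc f = cns None f - (\<Sum>y\<in>F. cns (Some (ident G y)) f)"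

definition epsa :: "('m option, 'k::field) chain \<Rightarrow> ('m option, 'k) chain" where
  "epsa f = act None f - (\<Sum>y\<in>F. act (Some (ident G y)) f)"

definition SF :: "'m option set" where
  "SF = insert None (Some ` {g \<in> Mor G. src G g \<in> F \<and> tgt G g \<in> F})"

lemma epsc_simps [simp]:
  "epsc 0 = 0" "epsc (f + g) = epsc f + epsc g" "epsc (f - g) = epsc f - epsc g"
  "epsc (- f) = - epsc f" "epsc (pm_scale c f) = pm_scale c (epsc f)"
  by (simp_all add: epsc_def sum.distrib sum_subtractf sum_negf pm.scale_sum_right pm.scale_right_diff_distrib)

lemma epsa_simps [simp]:
  "epsa 0 = 0" "epsa (f + g) = epsa f + epsa g" "epsa (f - g) = epsa f - epsa g"
  "epsa (- f) = - epsa f" "epsa (pm_scale c f) = pm_scale c (epsa f)"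
  by (simp_all add: epsa_def sum.distrib sum_subtractf sum_negf pm.scale_sum_right pm.scale_right_diff_distrib)

lemma bp_epsc: "bp (epsc f) = epsa f - epsc (bp f)"
  by (simp add: epsc_def epsa_def bp_cns sum_subtractf)

lemma snc_sum: "snc z (sum f A) = (\<Sum>x\<in>A. snc z (f x))"
  by (simp add: snc_def)

lemma act_sum: "act z (sum f A) = (\<Sum>x\<in>A. act z (f x))"
  by (simp add: act_def)

lemma snc_epsc: "snc z (epsc f) = epsc (snc z f)"
  by (simp add: epsc_def snc_cns snc_sum)

lemma gok_ident:
  assumes "y \<in> F" "z \<in> F"
  shows "gok G (Some (ident G y)) (Some (ident G z)) \<longleftrightarrow> y = z"
  using assms F_Obj by (auto simp: ident_closed src_ident tgt_ident subset_iff)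

lemma ident_ident:
  assumes "y \<in> F"
  shows "mcomp G (ident G y) (ident G y) = ident G y"
  using assms F_Obj comp_ident_left[OF ident_closed, of y] tgt_ident[of y] by auto

lemma epsa_epsc: "epsa (epsc f) = epsc f"
proof -
  have "act (Some (ident G y)) (epsc f) = 0" if y: "y \<in> F" for y
  proof -
    have "(\<Sum>z\<in>F. act (Some (ident G y)) (cns (Some (ident G z)) f))
        = (\<Sum>z\<in>F. if z = y then cns (Some (ident G y)) f else 0)"
      by (rule sum.cong) (use y gok_ident[OF y] ident_ident[OF y] in \<open>auto simp: act_cns simp del: gok_simps(3)\<close>)
    then show ?thesis
      using y finF by (simp add: epsc_def act_sum act_cns)
  qed
  moreover have "act None (epsc f) = epsc f" by (simp add: epsc_def act_sum act_cns)
  ultimately show ?thesis by (simp add: epsa_def)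
qed

lemma act_epsc:
  assumes "Some g \<in> SF"
  shows "act (Some g) (epsc f) = 0"
proof -
  have g: "g \<in> Mor G" "src G g \<in> F" using assms by (auto simp: SF_def)
  have "(\<Sum>z\<in>F. act (Some g) (cns (Some (ident G z)) f)) = (\<Sum>z\<in>F. if z = src G g then cns (Some g) f else 0)"
    using F_Obj g by (intro sum.cong) (auto simp: act_cns ident_closed tgt_ident comp_ident_right subset_iff)
  then show ?thesis using g finF by (simp add: epsc_def act_sum act_cns)
qed

lemma epsa_None: "epsa (single (None # l) 1) = epsc (single l 1)"
  by (simp add: epsa_def epsc_def)

lemma epsa_Nil: "epsa (single [] 1) = 0"
  by (simp add: epsa_def)

lemma epsa_Some:
  assumes "Some g \<in> SF"
  shows "epsa (single (Some g # l) 1) = 0"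
proof -
  have g: "g \<in> Mor G" "tgt G g \<in> F" using assms by (auto simp: SF_def)
  have "(\<Sum>z\<in>F. act (Some (ident G z)) (single (Some g # l) (1 :: 'a)))
      = (\<Sum>z\<in>F. if z = tgt G g then single (Some g # l) 1 else 0)"
    using F_Obj g by (intro sum.cong) (auto simp: ident_closed src_ident comp_ident_left subset_iff)
  then show ?thesis using g finF by (simp add: epsa_def)
qed

text \<open>With \<epsilon> for the idempotent: inserts \<epsilon> at successive places, moving on
  only past units, which then turn into \<epsilon>. An arrow ends the process, because \<epsilon>
  times it is 0 and leaves nothing to cancel.\<close>

primrec H2 :: "'m option list \<Rightarrow> ('m option, 'k::field) chain" where
  "H2 [] = epsc (single [] 1)"
| "H2 (a # l) = epsc (single (a # l) 1) - (if a = None then epsc (H2 l) else 0)"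

definition Hm2 :: "('m option, 'k::field) chain \<Rightarrow> ('m option, 'k) chain" where
  "Hm2 = ext H2"

lemma Hm2_simps [simp]:
  "Hm2 0 = 0" "Hm2 (f + g) = Hm2 f + Hm2 g" "Hm2 (f - g) = Hm2 f - Hm2 g"
  "Hm2 (- f) = - Hm2 f" "Hm2 (pm_scale c f) = pm_scale c (Hm2 f)"
  "Hm2 (single l c) = pm_scale c (H2 l)"
  by (simp_all add: Hm2_def)

lemma epsa_H2: "epsa (H2 l) = H2 l"
  by (cases l) (simp_all add: epsa_epsc)

lemma Hm2_cns_None: "Hm2 (cns None f) = epsc (cns None f) - epsc (Hm2 f)"
  by (rule lin_eqI[of f UNIV]) (simp_all add: pm.scale_right_diff_distrib)

lemma Hm2_Some: "f \<in> chains {Some g # l |g l. True} \<Longrightarrow> Hm2 f = epsc f"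
  by (rule lin_eqI[of f "{Some g # l |g l. True}"]) auto

lemma bpl_Some: "bpl (Some g # l) \<in> chains {Some g # l |g l. True}"
  by (rule bpl_chains) (auto simp: Cons_eq_append_conv gdot_def split: option.splits)

lemma bp_H2:
  assumes "set l \<subseteq> SF"
  shows "bp (H2 l :: ('m option, 'k::field) chain) = - Hm2 (bpl l)"
  using assms
proof (induction l)
  case Nil
  then show ?case by (simp add: bp_epsc epsa_Nil)
next
  case (Cons a l)
  show ?case
  proof (cases a)
    case (Some g)
    then show ?thesis
      using Cons.prems epsa_Some[of g l] by (simp add: bp_epsc Hm2_Some[OF bpl_Some] del: bpl.simps)
  next
    case None
    have "epsc (single l 1) - epsc (actl None l) - H2 l + Hm2 (actl None l) = (0 :: ('m option, 'k) chain)"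
      by (cases l) auto
    moreover have "bp (H2 (a # l)) + Hm2 (bpl (a # l)) =
        epsc (single l 1) - epsc (actl None l) - H2 l + (Hm2 (actl None l) :: ('m option, 'k) chain)"
      using Cons None by (simp add: bp_epsc epsa_None epsa_H2 Hm2_cns_None)
    ultimately show ?thesis by (simp only: eq_neg_iff_add_eq_0)
  qed
qed

text \<open>A word of units alone is read to its end and gets one more term, with the idempotent
  after the last letter. This exception is why the homotopy is confined to words that contain an
  arrow.\<close>

lemma H2_snoc:
  assumes "z \<noteq> None \<or> (\<exists>a\<in>set l. a \<noteq> None)"
  shows "(H2 (l @ [z]) :: ('m option, 'k::field) chain) = snc z (H2 l)"
  using assms
proof (induction l)
  case Nil
  then show ?case by (auto simp: snc_epsc)
next
  case (Cons a l)
  have "(H2 (l @ [z]) :: ('m option, 'k) chain) = snc z (H2 l)" if "a = None"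
    using Cons that by simp
  then show ?case by (simp add: snc_epsc)
qed

lemma epsc_chains:
  assumes "f \<in> chains P" "\<And>l a. l \<in> P \<Longrightarrow> a \<in> insert None (Some ` ident G ` F) \<Longrightarrow> a # l \<in> Q"
  shows "epsc f \<in> chains Q"
  unfolding epsc_def using assms
  by (intro chains_closed pm.subspace_sum subspace_chains cns_chains[OF assms(1)]) auto

lemma epsc_words:
  assumes "insert None (Some ` ident G ` F) \<subseteq> S"
  shows "f \<in> chains (words S n) \<Longrightarrow> epsc f \<in> chains (words S (Suc n))"
    and "epsc (single [] c) \<in> chains (words S (Suc 0))"
proof -
  have a: "a \<in> S" if "a \<in> insert None (Some ` ident G ` F)" for a using assms that by blast
  show "epsc f \<in> chains (words S (Suc n))" if "f \<in> chains (words S n)"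
    using that by (rule epsc_chains) (use a in \<open>simp add: words_def\<close>)
  show "epsc (single [] c) \<in> chains (words S (Suc 0))"
    by (rule epsc_chains[of _ "{[]}"]) (use a in \<open>simp_all add: words_def\<close>)
qed

lemma ident_F: "insert None (Some ` ident G ` F) \<subseteq> insert None (Some ` Mor G)"
  using F_Obj ident_closed by blast

lemma H2_chains:
  assumes "insert None (Some ` ident G ` F) \<subseteq> S" "set l \<subseteq> S"
  shows "(H2 l :: ('m option, 'k::field) chain) \<in> chains (words S (Suc (length l)))"
  using assms(2)
proof (induction l)
  case Nil
  show ?case using epsc_words(2)[OF assms(1)] by simp
next
  case (Cons a l)
  have "(single (a # l) 1 :: ('m option, 'k) chain) \<in> chains (words S (Suc (length l)))"
    using Cons.prems by (simp add: words_def)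
  from epsc_words(1)[OF assms(1) this] show ?case
    using Cons epsc_words(1)[OF assms(1) Cons.IH] by auto
qed

text \<open>Zero on words that begin with an arrow, which need no correction and are left to
  \<open>h\<close>.\<close>

primrec h2l :: "'m option list \<Rightarrow> ('m option, 'k::field) chain" where
  "h2l [] = 0"
| "h2l (a # l) = (if a = None then epsc (H2 l) else 0)"

definition h2 :: "('m option, 'k::field) chain \<Rightarrow> ('m option, 'k) chain" where
  "h2 = ext h2l"

lemma h2_simps [simp]:
  "h2 0 = 0" "h2 (f + g) = h2 f + h2 g" "h2 (f - g) = h2 f - h2 g"
  "h2 (- f) = - h2 f" "h2 (pm_scale c f) = pm_scale c (h2 f)"
  "h2 (single l c) = pm_scale c (h2l l)"
  by (simp_all add: h2_def)

lemma h2_cns_None: "h2 (cns None f) = epsc (Hm2 f)"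
  by (rule lin_eqI[of f UNIV]) simp_all

lemma h2_Some: "f \<in> chains {Some g # l |g l. True} \<Longrightarrow> h2 f = 0"
  by (rule lin_eqI[of f "{Some g # l |g l. True}" h2 "\<lambda>_. 0"]) auto

text \<open>The unit differs from this sum of identities by the idempotent, so 1 - \<open>r\<close>
  puts the idempotent in place of a leading unit and kills words that begin with an arrow.\<close>

primrec rl :: "'m option list \<Rightarrow> ('m option, 'k::field) chain" where
  "rl [] = 0"
| "rl (a # l) = (if a = None then \<Sum>y\<in>F. single (Some (ident G y) # l) 1 else single (a # l) 1)"

definition r :: "('m option, 'k::field) chain \<Rightarrow> ('m option, 'k) chain" where
  "r = ext rl"

lemma Db_h2:
  fixes f :: "('m option, 'k::field) chain"
  assumes f: "f \<in> chains {l \<in> RS. set l \<subseteq> SF}"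
  shows "Db (h2 f) + h2 (Db f) = f - r f"
proof (rule lin_eqI[OF f, where F = "\<lambda>f. Db (h2 f) + h2 (Db f)" and G = "\<lambda>f. f - r f"])
  fix x assume x: "x \<in> {l \<in> RS. set l \<subseteq> SF}"
  then obtain a l where al: "x = a # l" "set l \<subseteq> SF" by (cases x) (auto simp: RS_def)
  have Dx: "Db (single x (1 :: 'k)) = bpl x + d0 (Lal x)" by (simp add: Db_eq)
  show "Db (h2 (single x 1)) + h2 (Db (single x 1)) =
      single x 1 - r (single x (1 :: 'k))"
  proof (cases a)
    case (Some g)
    have "(d0 (Lal x) :: ('m option, 'k) chain) \<in> chains {Some g # l |g l. True}"
    proof (cases l rule: rev_cases)
      case Nil
      then show ?thesis using al Some by (auto simp: Lal_def)
    next
      case (snoc m z)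
      then have "Lal x = single (z # Some g # m) ((- 1 :: 'k) ^ Suc (length m))"
        using al Some Lal_snoc[of "Some g # m" z] by simp
      then show ?thesis by (cases z) auto
    qed
    then have "h2 (d0 (Lal x) :: ('m option, 'k) chain) = 0" by (rule h2_Some)
    moreover have "h2 (bpl x :: ('m option, 'k) chain) = 0" using al Some by (simp add: h2_Some[OF bpl_Some] del: bpl.simps)
    ultimately show ?thesis using al Some unfolding Dx by (simp add: r_def del: bpl.simps)
  next
    case None
    then have lR: "l \<in> RS" "l \<noteq> []" using x al by (auto simp: RS_def)
    then obtain m z where l: "l = m @ [z]" by (cases l rule: rev_cases) auto
    have z: "z \<in> SF" and mS: "set m \<subseteq> SF" using al l by auto
    have r: "single x 1 - r (single x (1 :: 'k)) = epsc (single l 1)"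
      using al None by (simp add: r_def epsc_def)
    \<comment> \<open>If \<open>l\<close> begins with a unit, the second term of \<open>H2 l\<close>
      cancels against \<open>h2\<close> of the product of the two units; if it begins with an arrow,
      both are absent.\<close>
    have "h2 (actl None l) + H2 l = (epsc (single l 1) :: ('m option, 'k) chain)"
      using lR by (cases l) auto
    then have 1: "bp (h2l x) + h2 (bpl x) = (epsc (single l 1) :: ('m option, 'k) chain)"
      using al None by (simp add: bp_epsc epsa_H2 bp_H2 h2_cns_None algebra_simps)
    have H2l: "H2 l = (snc z (H2 m) :: ('m option, 'k) chain)"
      unfolding l using lR l by (intro H2_snoc) (auto simp: RS_def)
    have "(H2 m :: ('m option, 'k) chain) \<in> chains (words (insert None (Some ` Mor G)) (Suc (length m)))"
      using mS by (intro H2_chains ident_F) (auto simp: SF_def)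
    then have "(epsc (H2 m) :: ('m option, 'k) chain) \<in> chains (lists_of_length (Suc (Suc (length m))))"
      by (rule epsc_chains) (auto simp: words_def)
    then have 2: "d0 (La (h2l x)) = pm_scale ((- 1) ^ length m) (act z (epsc (H2 m)) :: ('m option, 'k) chain)"
      using al None by (simp add: H2l snc_epsc[symmetric] La_snc d0_cns)
    have L: "Lal x = single (z # None # m) ((- 1 :: 'k) ^ Suc (length m))"
      using al None l Lal_snoc[of "None # m" z] by simp
    \<comment> \<open>The cyclic face leaves nothing: a final arrow annihilates the idempotent in
      front, and on the rotated side gives a word on which \<open>h2\<close> is 0; a final unit
      yields two equal terms of opposite sign.\<close>
    have "d0 (La (h2l x)) + h2 (d0 (Lal x)) = (0 :: ('m option, 'k) chain)"
    proof (cases z)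
      case None
      moreover have "act None (epsc (H2 m)) = (epsc (H2 m) :: ('m option, 'k) chain)"
        by (simp add: epsc_def act_sum act_cns)
      ultimately show ?thesis unfolding 2 L by simp
    next
      case (Some g)
      then show ?thesis unfolding 2 L using act_epsc[of g] z by simp
    qed
    then show ?thesis
      unfolding r Dx using 1 by (simp add: Db_eq algebra_simps del: bpl.simps h2l.simps)
  qed
qed (simp_all add: r_def pm.scale_right_distrib pm.scale_right_diff_distrib)

lemma h2_chains:
  fixes f :: "('m option, 'k::field) chain"
  assumes "f \<in> chains (words (insert None (Some ` Mor G)) n)"
  shows "h2 f \<in> chains (words (insert None (Some ` Mor G)) (Suc n))"
  unfolding h2_def
proof (rule ext_in[OF assms])
  fix x assume "x \<in> words (insert None (Some ` Mor G)) n"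
  then obtain a l where al: "x = a # l" "n = Suc (length l)" "set l \<subseteq> insert None (Some ` Mor G)"
    by (cases x) (auto simp: words_def)
  have "(epsc (H2 l) :: ('m option, 'k) chain) \<in> chains (words (insert None (Some ` Mor G)) (Suc n))"
    unfolding al(2) by (rule epsc_words(1)[OF ident_F H2_chains[OF ident_F al(3)]])
  then show "(h2l x :: ('m option, 'k) chain) \<in> chains (words (insert None (Some ` Mor G)) (Suc n))"
    using al by auto
qed simp

lemma r_chains:
  fixes f :: "('m option, 'k::field) chain"
  assumes "f \<in> chains (words (insert None (Some ` Mor G)) n)"
  shows "r f \<in> chains {l \<in> L0. length l = n}"
  unfolding r_def
proof (rule ext_in[OF assms])
  fix x assume "x \<in> words (insert None (Some ` Mor G)) n"
  then obtain a l where al: "x = a # l" "n = Suc (length l)" "a \<in> insert None (Some ` Mor G)"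
      "set l \<subseteq> insert None (Some ` Mor G)"
    by (cases x) (auto simp: words_def)
  then show "(rl x :: ('m option, 'k) chain) \<in> chains {l \<in> L0. length l = n}"
    using F_Obj ident_closed by (auto simp: L0_def intro!: pm.subspace_sum subspace_chains)
qed simp

end

section \<open>Words in the unit split off; comparison with the vertex groups\<close>

context based_groupoid
begin

text \<open>A product is the unit only if both factors are, so faces neither create nor destroy the
  presence of an arrow: the words with an arrow and those without span complementary
  subcomplexes.\<close>

lemma restr_RS_Db: "restr RS (Db f) = Db (restr RS f)"
  unfolding Db_def
proof (rule restr_ext_commute[of f UNIV])
  have dot: "(\<exists>g. gdot G a b = Some g) \<longleftrightarrow> (\<exists>g. a = Some g) \<or> (\<exists>g. b = Some g)" for a b
    by (cases a; cases b) auto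
  have Dl: "(Dl l :: ('m option, 'a) chain) \<in> chains Q"
    if "\<And>u a b v. l = u @ a # b # v \<Longrightarrow> u @ gdot G a b # v \<in> Q"
      "\<And>a m b. l = a # m @ [b] \<Longrightarrow> gdot G b a # m \<in> Q" for l Q
  proof -
    have "Db (single l 1 :: ('m option, 'a) chain) \<in> chains Q"
      by (rule Db_chains[of _ "{l}"]) (use that in auto)
    then show ?thesis by (simp add: Db_def)
  qed
  show "(Dl l :: ('m option, 'a) chain) \<in> chains RS" if "l \<in> RS" for l
    using that by (intro Dl) (auto simp: RS_def dot)
  fix l :: "'m option list" assume "l \<notin> RS"
  then have "(Dl l :: ('m option, 'a) chain) \<in> chains (- RS)"
    by (intro Dl) (auto simp: RS_def)
  then show "restr RS (Dl l :: ('m option, 'a) chain) = 0"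
    by (rule restr_disjoint) auto
qed simp

lemma finite_support:
  fixes f :: "('m option, 'k::field) chain"
  assumes "f \<in> chains (words (insert None (Some ` Mor G)) n)"
  obtains F where "finite F" "F \<subseteq> Obj G"
    "f \<in> chains {l. set l \<subseteq> insert None (Some ` {g \<in> Mor G. src G g \<in> F \<and> tgt G g \<in> F})}"
proof -
  define M where "M = Some -` (\<Union>l\<in>keys f. set l)"
  define F where "F = src G ` M \<union> tgt G ` M"
  have "finite M" unfolding M_def by (rule finite_vimageI) auto
  then have "finite F" by (simp add: F_def)
  moreover have k: "set l \<subseteq> insert None (Some ` Mor G)" if "l \<in> keys f" for l
    using keys_in[OF assms that] by (simp add: words_def)
  then have M: "M \<subseteq> Mor G" unfolding M_def by blast
  then have "F \<subseteq> Obj G" unfolding F_def using src_closed tgt_closed by blast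
  moreover have "set l \<subseteq> insert None (Some ` {g \<in> Mor G. src G g \<in> F \<and> tgt G g \<in> F})"
    if l: "l \<in> keys f" for l
  proof
    fix a assume a: "a \<in> set l"
    show "a \<in> insert None (Some ` {g \<in> Mor G. src G g \<in> F \<and> tgt G g \<in> F})"
    proof (cases a)
      case (Some g)
      then have "g \<in> M" using a l unfolding M_def by blast
      then show ?thesis using Some M unfolding F_def by blast
    qed simp
  qed
  then have "f \<in> chains {l. set l \<subseteq> insert None (Some ` {g \<in> Mor G. src G g \<in> F \<and> tgt G g \<in> F})}"
    by (auto simp: chains_def)
  ultimately show thesis by (rule that)
qed

abbreviation Wall :: "nat \<Rightarrow> 'm option list set" where
  "Wall \<equiv> words (insert None (Some ` Mor G))"

text \<open>\<open>F\<close> collects the sources and targets occurring in \<open>f\<close>, so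
  \<open>r\<close> and \<open>h2\<close> depend on \<open>f\<close>. The last property disposes of
  \<open>h2 (Db f)\<close> in the applications, where \<open>Db f\<close> is 0 or consists of words
  that begin with an arrow.\<close>

lemma unit_homotopy:
  fixes f :: "('m option, 'k::field) chain"
  assumes f: "f \<in> chains (Wall n)" "f \<in> chains RS"
  obtains r h2 :: "('m option, 'k) chain \<Rightarrow> ('m option, 'k) chain"
  where "Db (h2 f) + h2 (Db f) = f - r f" "h2 f \<in> chains (Wall (Suc n))"
    "r f \<in> chains {l \<in> L0. length l = n}" "\<And>g. g \<in> chains {Some a # l |a l. True} \<Longrightarrow> h2 g = 0"
proof -
  obtain F where F: "finite F" "F \<subseteq> Obj G"
    "f \<in> chains {l. set l \<subseteq> insert None (Some ` {g \<in> Mor G. src G g \<in> F \<and> tgt G g \<in> F})}"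
    using finite_support[OF f(1)] by blast
  interpret fin: based_groupoid_finite G base \<gamma> F
    by unfold_locales (use F in auto)
  have fS: "f \<in> chains {l \<in> RS. set l \<subseteq> fin.SF}"
    using f(2) F(3) by (auto simp: chains_def RS_def fin.SF_def)
  show thesis
    by (rule that[of fin.h2 fin.r, OF fin.Db_h2[OF fS] fin.h2_chains[OF f(1)] fin.r_chains[OF f(1)] fin.h2_Some])
qed

text \<open>The cycles that vanish in \<open>HH_nonunital\<close>: sums of boundaries and of cycles
  on words in the unit, the latter coming from the ground field.\<close>

definition unitB :: "nat \<Rightarrow> ('m option, 'k::field) chain set" where
  "unitB n = {b + c |b c. b \<in> hhB Wall n \<and> c \<in> hhZ (words {None}) n}"

lemma L0_Wall: "{l \<in> L0. length l = n} \<subseteq> Wall n"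
  by (auto simp: L0_def words_def)

lemma Y_Some: "Y n \<subseteq> {Some a # l |a l. True}"
proof
  fix l assume "l \<in> Y n"
  then show "l \<in> {Some a # l |a l. True}" by (cases l) (auto simp: Y_def words_def)
qed

lemma unit_retract:
  assumes P: "presents (M :: ('k::field, 'v) module) (hhZ Wall n) (unitB n) q"
    and P': "presents (M' :: ('k, 'w) module) (hhZ Y n) (hhB Y n) q'"
  shows "M \<cong>\<^sub>v M'"
proof (rule vs_iso_presents[OF P P'])
  have YW: "Y m \<subseteq> Wall m" for m by (auto simp: Y_def words_def loops_def)
  then have YW': "f \<in> chains (Wall m)" if "f \<in> chains (Y m)" for f :: "('m option, 'k) chain" and m
    using that chains_mono by blast
  show "(hhZ Y n :: ('m option, 'k) chain set) \<subseteq> hhZ Wall n" using YW' by (auto simp: hhZ_def)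
  have z: "(0 :: ('m option, 'k) chain) \<in> hhZ (words {None}) n" by (auto simp: hhZ_def)
  show "(hhB Y n :: ('m option, 'k) chain set) \<subseteq> unitB n"
  proof
    fix b :: "('m option, 'k) chain" assume "b \<in> hhB Y n"
    then have "b \<in> hhB Wall n" using YW' by (auto simp: hhB_def)
    then have "b + 0 \<in> unitB n" using z unfolding unitB_def by blast
    then show "b \<in> unitB n" by simp
  qed
  have YR: "f \<in> chains RS" if "f \<in> chains (Y m)" for f :: "('m option, 'k) chain" and m
    using that Y_Some[of m] by (fastforce simp: chains_def RS_def)
  have None_RS: "restr RS c = 0" if "c \<in> chains (words {None} m)" for c :: "('m option, 'k) chain" and m
    by (rule restr_disjoint[OF that]) (auto simp: RS_def words_def)
  have restr_Wall: "restr RS f \<in> chains (Wall m)" if "f \<in> chains (Wall m)" for f :: "('m option, 'k) chain" and m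
    using restr_in_chains[OF that, of RS] chains_mono[of "RS \<inter> Wall m" "Wall m"] by blast
  show "(hhZ Y n :: ('m option, 'k) chain set) \<inter> unitB n \<subseteq> hhB Y n"
  proof
    fix v :: "('m option, 'k) chain" assume "v \<in> hhZ Y n \<inter> unitB n"
    then obtain u c where v: "v \<in> chains (Y (Suc n))" and u: "u \<in> chains (Wall (Suc (Suc n)))"
      and c: "c \<in> chains (words {None} (Suc n))" and eq: "v = Db u + c"
      by (auto simp: hhZ_def hhB_def unitB_def)
    let ?u = "restr RS u"
    \<comment> \<open>Passing to the words with an arrow removes the part that comes from the ground
      field.\<close>
    have "v = restr RS v" using YR[OF v] by (simp add: restr_id)
    also have "\<dots> = Db ?u" by (simp add: eq None_RS[OF c] restr_RS_Db)
    finally have vu: "v = Db ?u" .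
    obtain r h2 :: "('m option, 'k) chain \<Rightarrow> ('m option, 'k) chain"
      where h2: "Db (h2 ?u) + h2 (Db ?u) = ?u - r ?u" "h2 ?u \<in> chains (Wall (Suc (Suc (Suc n))))"
        "r ?u \<in> chains {l \<in> L0. length l = Suc (Suc n)}" "\<And>g. g \<in> chains {Some a # l |a l. True} \<Longrightarrow> h2 g = 0"
      by (rule unit_homotopy[OF restr_Wall[OF u] restr_in]) (rule that; assumption)
    have "v \<in> chains {Some a # l |a l. True}" using v Y_Some chains_mono by blast
    \<comment> \<open>As \<open>v\<close> itself needs no correction by \<open>h2\<close>, the
      bounding chain may be replaced by its image under \<open>r\<close>, and \<open>e\<close> then
      moves it into \<open>Y\<close>.\<close>
    then have "h2 (Db ?u) = 0" using h2(4) vu by simp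
    then have "Db (Db (h2 ?u)) = Db (?u - r ?u)" using h2(1) by simp
    then have v2: "v = Db (r ?u)" using vu by (simp add: Db_Db)
    have rL: "r ?u \<in> chains L0" "r ?u \<in> chains (lists_of_length (Suc (Suc n)))"
      using h2(3) by (auto simp: chains_def)
    have "v = Db (e (r ?u))" using e_id[OF v] Db_e[OF rL(1)] v2 by simp
    then show "v \<in> hhB Y n" using e_Y[OF rL] by (auto simp: hhB_def)
  qed
  fix v :: "('m option, 'k) chain" assume "v \<in> hhZ Wall n"
  then have v: "v \<in> chains (Wall (Suc n))" "Db v = 0" by (auto simp: hhZ_def)
  let ?v = "restr RS v"
  have Dv: "Db ?v = 0" using restr_RS_Db[of v] v(2) by simp
  obtain r h2 :: "('m option, 'k) chain \<Rightarrow> ('m option, 'k) chain"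
    where h2: "Db (h2 ?v) + h2 (Db ?v) = ?v - r ?v" "h2 ?v \<in> chains (Wall (Suc (Suc n)))"
      "r ?v \<in> chains {l \<in> L0. length l = Suc n}" "\<And>g. g \<in> chains {Some a # l |a l. True} \<Longrightarrow> h2 g = 0"
    by (rule unit_homotopy[OF restr_Wall[OF v(1)] restr_in]) (rule that; assumption)
  have "h2 (Db ?v) = 0" unfolding Dv by (rule h2(4)) auto
  then have 1: "Db (h2 ?v) = ?v - r ?v" using h2(1) by simp
  have rL: "r ?v \<in> chains L0" "r ?v \<in> chains (lists_of_length (Suc n))"
    using h2(3) by (auto simp: chains_def)
  have "Db (Db (h2 ?v)) = Db (?v - r ?v)" by (simp only: 1)
  then have Dr: "Db (r ?v) = 0" by (simp add: Db_Db Dv)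
  then have 2: "Db (h (r ?v)) = r ?v - e (r ?v)" using Db_h[OF rL(1)] by simp
  have "h (r ?v) \<in> chains (Wall (Suc (Suc n)))"
    using h_L0_length[OF h2(3)] L0_Wall chains_mono by blast
  then have "h2 ?v + h (r ?v) \<in> chains (Wall (Suc (Suc n)))" using h2(2) by auto
  then have "Db (h2 ?v + h (r ?v)) \<in> hhB Wall n" unfolding hhB_def by blast
  \<comment> \<open>The part of \<open>v\<close> in words of units alone, which is the contribution
    of the ground field.\<close>
  moreover have "v - ?v \<in> hhZ (words {None}) n"
  proof -
    have "v - ?v \<in> chains (words {None} (Suc n))"
    proof -
      have "l \<in> words {None} (Suc n)" if "l \<in> Wall (Suc n)" "l \<notin> RS" for l
        using that by (auto simp: RS_def words_def)
      then show ?thesis using v(1) by (auto simp: chains_iff lookup_minus lookup_restr)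
    qed
    then show ?thesis using v(2) Dv by (simp add: hhZ_def)
  qed
  ultimately have "Db (h2 ?v + h (r ?v)) + (v - ?v) \<in> unitB n" unfolding unitB_def by blast
  moreover have "Db (h2 ?v + h (r ?v)) + (v - ?v) = v - e (r ?v)" by (simp add: 1 2)
  moreover have "e (r ?v) \<in> hhZ Y n" using e_Y[OF rL] Db_e[OF rL(1)] Dr by (simp add: hhZ_def)
  ultimately show "\<exists>v'\<in>hhZ Y n. v - v' \<in> unitB n" by metis
qed

end


section \<open>Groupoid algebras in coordinates\<close>

definition up :: "('m \<Rightarrow>\<^sub>0 'k::field) \<Rightarrow> 'm option \<Rightarrow>\<^sub>0 'k" where
  "up = ext (\<lambda>m. single (Some m) 1)"

definition down :: "('m option \<Rightarrow>\<^sub>0 'k::field) \<Rightarrow> 'm \<Rightarrow>\<^sub>0 'k" where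
  "down = ext (\<lambda>s. case s of None \<Rightarrow> 0 | Some m \<Rightarrow> single m 1)"

lemma down_up: "down (up f) = f"
  by (simp add: down_def up_def ext_ext)

lemma up_simps [simp]:
  "up 0 = 0" "up (f + g) = up f + up g" "up (pm_scale c f) = pm_scale c (up f)"
  "up (single m c) = single (Some m) c"
  by (simp_all add: up_def)

lemma up_chains: "f \<in> chains P \<Longrightarrow> up f \<in> chains (Some ` P)"
  unfolding up_def by (erule ext_in) auto

definition gmult :: "('o, 'm) groupoid \<Rightarrow> ('m \<Rightarrow>\<^sub>0 'k::field) \<Rightarrow> ('m \<Rightarrow>\<^sub>0 'k) \<Rightarrow> ('m \<Rightarrow>\<^sub>0 'k)" where
  "gmult G f h = ext (\<lambda>a. ext (\<lambda>b. if src G a = tgt G b then single (mcomp G a b) 1 else 0) h) f"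

lemma gmult_eq: "gmult G f h = (\<Sum>a\<in>keys f. \<Sum>b\<in>keys h.
    if src G a = tgt G b then single (mcomp G a b) (lookup f a * lookup h b) else 0)"
  unfolding gmult_def ext_def pm.scale_sum_right by (intro sum.cong refl) auto

definition omult :: "('o, 'm) groupoid \<Rightarrow> ('m option \<Rightarrow>\<^sub>0 'k::field) \<Rightarrow> ('m option \<Rightarrow>\<^sub>0 'k) \<Rightarrow> ('m option \<Rightarrow>\<^sub>0 'k)" where
  "omult G u v = ext (\<lambda>s. ext (\<lambda>t. if gok G s t then single (gdot G s t) 1 else 0) v) u"

lemma omult_up:
  assumes "f \<in> chains P" "h \<in> chains P" "P \<subseteq> Mor G"
  shows "omult G (up f) (up h) = up (gmult G f h)"
  unfolding omult_def up_def gmult_def ext_ext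
proof (rule ext_cong_chains[OF assms(1)])
  fix a assume "a \<in> P"
  then have "ext (\<lambda>b. ext (\<lambda>t. if gok G (Some a) t then single (gdot G (Some a) t) 1 else 0)
        (single (Some b) 1)) h =
      ext (\<lambda>b. ext (\<lambda>m. single (Some m) 1)
        (if src G a = tgt G b then single (mcomp G a b) 1 else 0)) h"
    by (intro ext_cong_chains[OF assms(2)]) (use assms(3) in auto)
  then show "ext (\<lambda>s. ext (\<lambda>b. ext (\<lambda>t. if gok G s t then single (gdot G s t) 1 else 0)
        (single (Some b) 1)) h) (single (Some a) 1) =
      ext (\<lambda>b. ext (\<lambda>m. single (Some m) 1)
        (if src G a = tgt G b then single (mcomp G a b) 1 else 0)) h"
    by simp
qed

lemma omult_add: "omult G (u + u') v = omult G u v + omult G u' v" "omult G u (v + v') = omult G u v + omult G u v'"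
  by (simp_all add: omult_def ext_fun_add)

lemma omult_None: "omult G (single None c) v = pm_scale c v"
  "omult G v (single None c) = pm_scale c v"
  using ext_fun_scale[of c "\<lambda>s. single s 1" v] by (simp_all add: omult_def)

context groupoid
begin

lemma gmult_chains:
  assumes "f \<in> chains P" "h \<in> chains P" "\<And>a b. a \<in> P \<Longrightarrow> b \<in> P \<Longrightarrow> src G a = tgt G b \<Longrightarrow> mcomp G a b \<in> P"
  shows "gmult G f h \<in> chains P"
  unfolding gmult_def
  by (intro ext_in[OF assms(1)] ext_in[OF assms(2)] subspace_chains) (use assms(3) in auto)

text \<open>\<open>P\<close> will be the set of all arrows or the loops at one object; the group
  algebras thus get the product of the groupoid and share its coordinates.\<close>

lemma based_algebra_free:
  fixes A :: "('k::field, 'm \<Rightarrow>\<^sub>0 'k) module"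
  assumes P: "P \<subseteq> Mor G" "\<And>a b. a \<in> P \<Longrightarrow> b \<in> P \<Longrightarrow> src G a = tgt G b \<Longrightarrow> mcomp G a b \<in> P"
    and A: "carrier A = chains P" "zero A = 0" "add A = (+)" "smult A = pm_scale"
      "\<And>f h. f \<in> chains P \<Longrightarrow> h \<in> chains P \<Longrightarrow> mult A f h = gmult G f h"
  shows "based_algebra (gok G) (gdot G) A (Some ` P) up (\<lambda>s. single (the s) 1)"
proof -
  interpret partial_semigroup "gok G" "gdot G" by (rule partial_semigroup_gok)
  show ?thesis
  proof
    show "inj_on up (carrier A)" by (rule inj_on_inverseI[of _ down]) (rule down_up)
    show "up (a \<otimes>\<^bsub>A\<^esub> b) = ext (\<lambda>s. ext (\<lambda>t. if gok G s t then single (gdot G s t) 1 else 0) (up b)) (up a)"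
      if "a \<in> carrier A" "b \<in> carrier A" for a b
      using that omult_up[of a P b G] P(1) A by (simp add: omult_def)
    show "gdot G s t \<in> Some ` P" if "s \<in> Some ` P" "t \<in> Some ` P" "gok G s t" for s t
      using that P(2) by auto
  qed (use A P in \<open>auto intro: up_chains gmult_chains\<close>)
qed

lemma based_groupoid_algebra:
  "based_algebra (gok G) (gdot G) (groupoid_algebra G :: ('k::field, 'm \<Rightarrow>\<^sub>0 'k) module) (Some ` Mor G) up
     (\<lambda>s. single (the s) 1)"
  by (rule based_algebra_free) (auto simp: groupoid_algebra_def free_space_def chains_def gmult_eq comp_closed)

lemma based_group_algebra:
  "based_algebra (gok G) (gdot G) (group_algebra (loop_group G x) :: ('k::field, 'm \<Rightarrow>\<^sub>0 'k) module) (Some ` loops G x) up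
     (\<lambda>s. single (the s) 1)"
proof (rule based_algebra_free)
  fix f h :: "'m \<Rightarrow>\<^sub>0 'k" assume fh: "f \<in> chains (loops G x)" "h \<in> chains (loops G x)"
  have "src G a = tgt G b" if "a \<in> keys f" "b \<in> keys h" for a b
    using keys_in[OF fh(1) that(1)] keys_in[OF fh(2) that(2)] by (simp add: loops_def)
  then show "f \<otimes>\<^bsub>group_algebra (loop_group G x)\<^esub> h = gmult G f h"
    by (simp add: group_algebra_def free_space_def loop_group_def gmult_eq)
qed (auto simp: group_algebra_def free_space_def loop_group_def loops_def chains_def comp_closed src_comp tgt_comp)

lemma based_unitization:
  "based_algebra (gok G) (gdot G) (unitization (groupoid_algebra G) :: ('k::field, 'k \<times> ('m \<Rightarrow>\<^sub>0 'k)) module)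
     (insert None (Some ` Mor G)) (\<lambda>(c, f). single None c + up f)
     (\<lambda>s. case s of None \<Rightarrow> (1, 0) | Some m \<Rightarrow> (0, single m 1))"
proof -
  interpret partial_semigroup "gok G" "gdot G" by (rule partial_semigroup_gok)
  let ?A = "groupoid_algebra G :: ('k, 'm \<Rightarrow>\<^sub>0 'k) module"
  let ?co = "\<lambda>(c :: 'k, f). single None c + up f"
  interpret B: based_algebra "gok G" "gdot G" ?A "Some ` Mor G" up "\<lambda>s. single (the s) 1"
    by (rule based_groupoid_algebra)
  have A: "carrier ?A = chains (Mor G)" "zero ?A = 0" "add ?A = (+)" "smult ?A = pm_scale"
    by (auto simp: groupoid_algebra_def free_space_def chains_def)
  have gm: "gmult G f h \<in> chains (Mor G)" if "f \<in> chains (Mor G)" "h \<in> chains (Mor G)" for f h :: "'m \<Rightarrow>\<^sub>0 'k"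
    by (rule gmult_chains[OF that comp_closed])
  have mA: "mult ?A f h = gmult G f h" for f h by (simp add: groupoid_algebra_def gmult_eq)
  have U: "carrier (unitization ?A) = UNIV \<times> chains (Mor G)" "zero (unitization ?A) = (0, 0)"
    "add (unitization ?A) = (\<lambda>(c, a) (d, b). (c + d, a + b))" "smult (unitization ?A) = (\<lambda>c (d, b). (c * d, pm_scale c b))"
    "mult (unitization ?A) = (\<lambda>(c, a) (d, b). (c * d, pm_scale c b + pm_scale d a + gmult G a b))"
    by (auto simp: unitization_def A mA)
  show ?thesis
  proof
    show "inj_on ?co (carrier (unitization ?A))"
    proof (rule inj_onI, clarsimp)
      fix c d :: 'k and f g :: "'m \<Rightarrow>\<^sub>0 'k"
      assume eq: "single None c + up f = single None d + up g"
      have up0: "lookup (up h) None = 0" for h :: "'m \<Rightarrow>\<^sub>0 'k"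
        using up_chains[of h UNIV] by (auto simp: chains_iff)
      have "lookup (single None c + up f) None = lookup (single None d + up g) None"
        by (simp only: eq)
      then have "c = d" by (simp add: lookup_add up0)
      moreover from this eq have "down (up f) = down (up g)" by simp
      ultimately show "c = d \<and> f = g" by (simp add: down_up)
    qed
    show "?co (a \<otimes>\<^bsub>unitization ?A\<^esub> b) =
        ext (\<lambda>s. ext (\<lambda>t. if gok G s t then single (gdot G s t) 1 else 0) (?co b)) (?co a)"
      if ab: "a \<in> carrier (unitization ?A)" "b \<in> carrier (unitization ?A)" for a b
    proof -
      obtain c f d h where ab': "a = (c, f)" "b = (d, h)" by (cases a; cases b)
      then have fh: "f \<in> chains (Mor G)" "h \<in> chains (Mor G)" using ab by (auto simp: U)
      have "omult G (?co a) (?co b) = ?co (a \<otimes>\<^bsub>unitization ?A\<^esub> b)"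
        by (simp add: ab' U omult_add omult_None omult_up[OF fh] pm.scale_right_distrib add_ac mult.commute[of d c])
      then show ?thesis by (simp add: omult_def)
    qed
    show "?co a \<in> chains (insert None (Some ` Mor G))" if "a \<in> carrier (unitization ?A)" for a
    proof -
      have "chains (Some ` Mor G) \<subseteq> (chains (insert None (Some ` Mor G)) :: ('m option \<Rightarrow>\<^sub>0 'k) set)"
        by (rule chains_mono) blast
      then have "up (snd a) \<in> chains (insert None (Some ` Mor G))"
        using that up_chains[of "snd a" "Mor G"] by (auto simp: U)
      then show ?thesis by (auto simp: case_prod_beta)
    qed
  qed (auto simp: U comp_closed single_add pm.scale_right_distrib gm chains_closed split: option.splits)
qed

text \<open>With \<open>None\<close> as its only letter, the ground field occupies the words in the
  unit inside the coordinates of the unitization.\<close>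

lemma based_ground:
  "based_algebra (gok G) (gdot G) (ground_algebra :: ('k::field, 'k) module) {None :: 'm option}
     (single None) (\<lambda>_. 1)"
proof -
  interpret partial_semigroup "gok G" "gdot G" by (rule partial_semigroup_gok)
  show ?thesis
  proof
    show "inj_on (single None) (carrier ground_algebra)"
      by (rule inj_onI) (metis lookup_single_eq)
  qed (auto simp: ground_algebra_def single_add)
qed

text \<open>The map from the homology of the ground field hits the classes of the cycles on words in the
  unit.\<close>

lemma presents_HH_nonunital:
  "\<exists>q. presents (HH_nonunital (groupoid_algebra G :: ('k::field, 'm \<Rightarrow>\<^sub>0 'k) module) n)
     (partial_semigroup.hhZ (gok G) (gdot G) (words (insert None (Some ` Mor G))) n)
     {b + c |b c. b \<in> partial_semigroup.hhB (gok G) (gdot G) (words (insert None (Some ` Mor G))) n \<and>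
       c \<in> partial_semigroup.hhZ (gok G) (gdot G) (words {None}) n} q"
proof -
  let ?A = "groupoid_algebra G :: ('k, 'm \<Rightarrow>\<^sub>0 'k) module"
  let ?S = "insert None (Some ` Mor G)"
  interpret g: based_algebra "gok G" "gdot G" "ground_algebra :: ('k, 'k) module" "{None}"
    "single None" "\<lambda>_. 1"
    by (rule based_ground)
  interpret u: based_algebra "gok G" "gdot G" "unitization ?A" ?S
    "\<lambda>(c, f). single None c + up f" "\<lambda>s. case s of None \<Rightarrow> (1, 0) | Some m \<Rightarrow> (0, single m 1)"
    by (rule based_unitization)
  define inc where "inc cs = map (\<lambda>c :: 'k. (c, \<zero>\<^bsub>?A\<^esub>)) cs" for cs
  define gg where "gg cs = single (inc cs) (1 :: 'k)" for cs
  have zA: "\<zero>\<^bsub>?A\<^esub> = 0" "0 \<in> carrier ?A" by (simp_all add: groupoid_algebra_def free_space_def)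
  have inc: "inc cs \<in> tuples (unitization ?A) m" if "cs \<in> tuples ground_algebra m" for cs m
    using that zA by (auto simp: inc_def tuples_def unitization_def)
  \<comment> \<open>A scalar has the same coordinate vector in the ground field and in the
    unitization, so in coordinates the inclusion is the identity.\<close>
  have T: "u.T (inc cs) = g.T cs" for cs
    by (induction cs) (simp_all add: inc_def zA)
  have gin: "gg cs \<in> chains (tuples (unitization ?A) m)" if "cs \<in> tuples ground_algebra m" for cs m
    unfolding gg_def using inc[OF that] by simp
  have Tg: "ext u.T (ext gg f) = ext g.T f" for f
    by (simp add: ext_ext gg_def T)
  have ginc: "ext gg f \<in> chains (tuples (unitization ?A) m)" if "f \<in> chains (tuples ground_algebra m)" for f m
    by (rule ext_in[OF that gin subspace_chains])
  have incl: "unit_inclusion ?A m (g.tclass m v) = u.tclass m v" if v: "v \<in> chains (g.blists (Suc m))" for v m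
  proof -
    have "unit_inclusion ?A m (g.tclass m v) = u.tup_coset m (ext gg (g.lft v))"
      unfolding unit_inclusion_def g.tclass_def
    proof (rule g.tensor_ext_tup_coset[OF u.presents_tuples gin])
      show "pure_tensor (unitization ?A) m (map (\<lambda>c. (c, \<zero>\<^bsub>?A\<^esub>)) bs) = u.tup_coset m (gg bs)" for bs
        by (simp add: u.pure_tensor_eq gg_def inc_def)
      fix x assume x: "x \<in> multilin_rels (ground_algebra :: ('k, 'k) module) m"
      then have "x \<in> chains (tuples ground_algebra m)" using g.rels_chains by blast
      then show "ext gg x \<in> multilin_rels (unitization ?A) m"
        using u.rels_iff[OF ginc] Tg g.ext_T_rels[OF x] by simp
    qed (use g.lft_in[OF v] in auto)
    also have "\<dots> = u.tclass m v"
      using u.tup_coset_eq_tclass[OF ginc[OF g.lft_in[OF v]]] Tg g.ext_T_lft[OF v] by simp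
    finally show ?thesis .
  qed
  have Wn: "f \<in> chains (words ?S m)" if "f \<in> chains (words {None} m)" for f :: "('m option, 'k) chain" and m
    using that chains_mono[of "words {None} m" "words ?S m"] by (auto simp: words_def)
  have ZZ: "c \<in> g.hhZ (words ?S) n" if "c \<in> g.hhZ (words {None}) n" for c :: "('m option, 'k) chain"
    using that Wn by (auto simp: g.hhZ_def)
  note pg = presentsD[OF g.presents_HH_words[of n]] and pu = presentsD[OF u.presents_HH_words[of n]]
  have hom: "homology_map (tensor_power (unitization ?A)) (hochschild_boundary (unitization ?A)) (unit_inclusion ?A) n
      (g.hh_class n v) = u.hh_class n v" if v: "v \<in> g.hhZ (words {None}) n" for v
    unfolding homology_map_def
  proof (rule the_elem_image_const)
    have vB: "v \<in> chains (g.blists (Suc n))" using v by (simp add: g.hhZ_def g.blists_words)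
    have bd: "boundaries (tensor_power ground_algebra) (hochschild_boundary ground_algebra) n
        = g.tclass n ` g.hh_bounds n"
      using presentsD(4)[OF g.presents_tensor_power[of "Suc n"], symmetric] g.hochschild_boundary_tclass
      by (auto simp: boundaries_def g.hhB_def image_image intro!: image_cong)
    have "g.hh_bounds n \<subseteq> chains (g.blists (Suc n))" using g.Db_blists by (auto simp: g.hhB_def)
    then have cl: "g.hh_class n v = g.tclass n ` {b + v |b. b \<in> g.hh_bounds n}"
      unfolding g.hh_class_def bd by (rule presents_coset[OF g.presents_tensor_power _ vB])
    have "0 \<in> g.hh_bounds n" unfolding g.hhB_def by (rule image_eqI[of _ _ 0]) auto
    then show "g.hh_class n v \<noteq> {}" unfolding cl by blast
    fix z assume "z \<in> g.hh_class n v"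
    then obtain w where w: "w \<in> chains (g.blists (Suc (Suc n)))" "z = g.tclass n (g.Db w + v)"
      unfolding cl by (auto simp: g.hhB_def)
    have b: "g.Db w + v \<in> chains (g.blists (Suc n))" using g.Db_blists[OF w(1)] vB by auto
    have wS: "w \<in> chains (words ?S (Suc (Suc n)))" using w(1) Wn by (simp add: g.blists_words)
    then have Dw: "g.Db w \<in> g.hhB (words ?S) n" by (auto simp: g.hhB_def)
    have "g.Db w + v \<in> g.hhZ (words ?S) n"
      using subsetD[OF pu(3) Dw] ZZ[OF v] pm.subspace_add[OF pu(1)] by blast
    then have "u.hh_class n (g.Db w + v) = u.hh_class n v"
      using presents_eq_iff[OF u.presents_HH_words _ ZZ[OF v]] Dw by simp
    then show "boundaries (tensor_power (unitization ?A)) (hochschild_boundary (unitization ?A)) n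
        +>\<^bsub>tensor_power (unitization ?A) n\<^esub> unit_inclusion ?A n z = u.hh_class n v"
      unfolding w(2) incl[OF b] u.hh_class_def .
  qed
  let ?N = "homology_map (tensor_power (unitization ?A)) (hochschild_boundary (unitization ?A))
     (unit_inclusion ?A) n ` carrier (HH (ground_algebra :: ('k, 'k) module) n)"
  let ?U = "{b + c |b c. b \<in> g.hhB (words ?S) n \<and> c \<in> (g.hhZ (words {None}) n :: ('m option, 'k) chain set)}"
  have N: "?N = u.hh_class n ` g.hhZ (words {None}) n"
    unfolding pg(4)[symmetric] image_image by (rule image_cong) (simp_all add: hom)
  have cls: "u.hh_class n (b + c) = u.hh_class n c"
    if "b \<in> g.hhB (words ?S) n" "c \<in> g.hhZ (words {None}) n" for b c
    using presents_eq_iff[OF u.presents_HH_words, of "b + c" n c] that ZZ[OF that(2)] subsetD[OF pu(3) that(1)]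
      pm.subspace_add[OF pu(1)] by simp
  have z: "(0 :: ('m option, 'k) chain) \<in> g.hhB (words ?S) n" using pm.subspace_0[OF pu(2)] .
  \<comment> \<open>Adding boundaries changes no class, so the image is also described by a subspace
    that contains the boundaries, as \<open>presents_quot\<close> demands.\<close>
  have NU: "?N = u.hh_class n ` ?U"
  proof -
    have "u.hh_class n ` ?U \<subseteq> u.hh_class n ` g.hhZ (words {None}) n" using cls by auto
    moreover have "c \<in> ?U" if "c \<in> g.hhZ (words {None}) n" for c
      using that z by (intro CollectI exI[of _ 0] exI[of _ c]) simp
    then have "u.hh_class n ` g.hhZ (words {None}) n \<subseteq> u.hh_class n ` ?U"
      by (intro image_mono subsetI)
    ultimately show ?thesis unfolding N by (rule equalityI[rotated])
  qed
  have sU: "pm.subspace ?U"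
    by (rule pm.subspace_sums[OF pu(2) pg(1)])
  have "g.hhB (words ?S) n \<subseteq> ?U"
    using pm.subspace_0[OF pg(1)] by force
  moreover have "?U \<subseteq> g.hhZ (words ?S) n"
    using pm.subspace_add[OF pu(1)] subsetD[OF pu(3)] ZZ by auto
  ultimately show ?thesis
    unfolding HH_nonunital_def using presents_quot[OF u.presents_HH_words sU _ _ NU] by blast
qed

end

theorem corollary3p17:
  fixes G :: "('o, 'm) groupoid"
    and I :: "'i set" and C :: "'i \<Rightarrow> 'o set" and x :: "'i \<Rightarrow> 'o"
    and B :: "('k::field_char_0, 'm \<Rightarrow>\<^sub>0 'k) module"
  assumes "groupoid G"
    and "bij_betw C I (components G)"
    and "\<forall>i\<in>I. x i \<in> C i"
    and "B = groupoid_algebra G"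
  shows "(\<forall>n. HC B n \<cong>\<^sub>v direct_sum I (\<lambda>i. HC (group_algebra (loop_group G (x i))) n)) \<and>
    ((\<forall>i\<in>I. finite (C i)) \<longrightarrow>
      (\<forall>n. if unital B
           then HH B n \<cong>\<^sub>v direct_sum I (\<lambda>i. HH (group_algebra (loop_group G (x i))) n)
           else HH_nonunital B n
                  \<cong>\<^sub>v direct_sum I (\<lambda>i. HH (group_algebra (loop_group G (x i))) n)))"
proof -
  interpret groupoid G by fact
  let ?R = "{(x, y). \<exists>g\<in>Mor G. src G g = x \<and> tgt G g = y}"
  have symR: "(b, a) \<in> ?R" if ab: "(a, b) \<in> ?R" for a b
  proof -
    obtain g where "g \<in> Mor G" "src G g = a" "tgt G g = b" using ab by auto
    then show ?thesis using ginv[of g] by auto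
  qed
  have transR: "(a, c) \<in> ?R" if ab: "(a, b) \<in> ?R" and bc: "(b, c) \<in> ?R" for a b c
  proof -
    obtain g h where "g \<in> Mor G" "src G g = a" "tgt G g = b" "h \<in> Mor G" "src G h = b" "tgt G h = c"
      using ab bc by auto
    then have "mcomp G h g \<in> Mor G" "src G (mcomp G h g) = a" "tgt G (mcomp G h g) = c"
      by (simp_all add: comp_closed src_comp tgt_comp)
    then show ?thesis by auto
  qed
  have "equiv (Obj G) ?R"
  proof (rule equivI)
    show "?R \<subseteq> Obj G \<times> Obj G" using src_closed tgt_closed by auto
    show "refl_on (Obj G) ?R"
      using src_ident tgt_ident ident_closed by (auto intro!: refl_onI bexI[of _ "ident G _"])
    show "sym ?R" using symR by (intro symI)
    show "trans ?R" using transR by (intro transI)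
  qed
  have comp: "components G = Obj G // ?R" by (simp add: components_def)
  have Cc: "C i \<in> Obj G // ?R" if "i \<in> I" for i
    using assms(2) that comp by (auto simp: bij_betw_def)
  have CO: "C i \<subseteq> Obj G" if "i \<in> I" for i
    using Cc[OF that] Union_quotient[OF \<open>equiv (Obj G) ?R\<close>] by blast
  have xO: "x i \<in> Obj G" if "i \<in> I" for i using CO assms(3) that by blast
  have Crel: "(a, b) \<in> ?R" if "i \<in> I" "a \<in> C i" "b \<in> C i" for i a b
    using quotient_eq_iff[OF \<open>equiv (Obj G) ?R\<close> Cc[OF that(1)] Cc[OF that(1)] that(2,3)] by simp
  have Cclosed: "b \<in> C i" if "i \<in> I" "a \<in> C i" "(a, b) \<in> ?R" for i a b
    using in_quotient_imp_closed[OF \<open>equiv (Obj G) ?R\<close> Cc[OF that(1)] that(2,3)] .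
  have Cinj: "i = j" if "i \<in> I" "j \<in> I" "a \<in> C i" "a \<in> C j" for i j a
  proof -
    have "C i = C j"
      using quotient_disj[OF \<open>equiv (Obj G) ?R\<close> Cc[OF that(1)] Cc[OF that(2)]] that(3,4) by blast
    then show ?thesis using assms(2) that(1,2) by (auto simp: bij_betw_def inj_on_def)
  qed
  have ex: "\<exists>i\<in>I. y \<in> C i" if "y \<in> Obj G" for y
  proof -
    have "y \<in> \<Union>(C ` I)"
      using that Union_quotient[OF \<open>equiv (Obj G) ?R\<close>] assms(2) comp by (simp add: bij_betw_def)
    then show ?thesis by blast
  qed
  define ix where "ix y = (SOME i. i \<in> I \<and> y \<in> C i)" for y
  have ix: "ix y \<in> I" "y \<in> C (ix y)" if "y \<in> Obj G" for y
    using someI_ex[of "\<lambda>i. i \<in> I \<and> y \<in> C i"] ex[OF that] unfolding ix_def by blast+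
  have ixI: "ix y = i" if "i \<in> I" "y \<in> C i" for i y
    using Cinj[OF ix(1) that(1) ix(2) that(2)] CO[OF that(1)] that(2) by blast
  define base where "base y = x (ix y)" for y
  have base_x: "base (x i) = x i" if "i \<in> I" for i
    using ixI[OF that] assms(3) that by (simp add: base_def)
  \<comment> \<open>At a base point the identity is taken, as \<open>based_groupoid\<close>
    requires; elsewhere any arrow from the base point will do, and one exists by
    connectedness.\<close>
  define \<gamma> where "\<gamma> y = (if y = base y then ident G y else (SOME g. g \<in> Mor G \<and> src G g = base y \<and> tgt G g = y))" for y
  have gam: "\<gamma> y \<in> Mor G \<and> src G (\<gamma> y) = base y \<and> tgt G (\<gamma> y) = y" if y: "y \<in> Obj G" for y
  proof (cases "y = base y")
    case True
    then show ?thesis using y ident_closed src_ident tgt_ident by (simp add: \<gamma>_def)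
  next
    case False
    have "(base y, y) \<in> ?R"
      unfolding base_def using Crel[OF ix(1)[OF y] _ ix(2)[OF y]] assms(3) ix(1)[OF y] by blast
    then have "\<exists>g. g \<in> Mor G \<and> src G g = base y \<and> tgt G g = y" by auto
    from someI_ex[OF this] show ?thesis using False by (simp add: \<gamma>_def)
  qed
  interpret based_groupoid G base \<gamma>
  proof
    fix y assume y: "y \<in> Obj G"
    show "\<gamma> y \<in> Mor G" "tgt G (\<gamma> y) = y" "src G (\<gamma> y) = base y" using gam[OF y] by auto
    show "base y \<in> Obj G" using xO[OF ix(1)[OF y]] by (simp add: base_def)
    have "base (base y) = base y" using base_x[OF ix(1)[OF y]] by (simp add: base_def)
    then show "\<gamma> (base y) = ident G (base y)" by (simp add: \<gamma>_def)
  next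
    fix g assume g: "g \<in> Mor G"
    note i = ix[OF src_closed[OF g]]
    have "(src G g, tgt G g) \<in> ?R" using g by blast
    then have "tgt G g \<in> C (ix (src G g))" by (rule Cclosed[OF i])
    then have "ix (tgt G g) = ix (src G g)" by (rule ixI[OF i(1)])
    then show "base (src G g) = base (tgt G g)" by (simp add: base_def)
  qed
  \<comment> \<open>The base points are exactly the given objects \<open>x i\<close>, so
    \<open>Y\<close> becomes a union indexed by \<open>I\<close>, the shape in which the direct sum
    is presented.\<close>
  have bO: "base ` Obj G = x ` I"
    using ix(1) base_x xO by (force simp: base_def image_iff)
  have Y: "Y = (\<lambda>n. \<Union>i\<in>I. words (Some ` loops G (x i)) n)"
    by (rule ext) (simp add: Y_def bO)
  have xinj: "i = j" if "i \<in> I" "j \<in> I" "x i = x j" for i j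
    using Cinj[OF that(1,2), of "x i"] assms(3) that by auto
  have dis: "disjoint_family_on (\<lambda>i. Some ` loops G (x i)) I"
    using xinj by (fastforce simp: disjoint_family_on_def loops_def)
  have "HC B n \<cong>\<^sub>v direct_sum I (\<lambda>i. HC (group_algebra (loop_group G (x i))) n)" for n
  proof -
    obtain q where "presents (direct_sum I (\<lambda>i. HC (group_algebra (loop_group G (x i)) :: ('k, 'm \<Rightarrow>\<^sub>0 'k) module) n))
        (hcZ Y n) (hcB Y n) q"
      using presents_HC_sum[OF partial_semigroup_gok based_group_algebra dis] unfolding Y by blast
    from retract_HC[OF based_algebra.presents_HC_words[OF based_groupoid_algebra] this]
    show ?thesis using assms(4) by simp
  qed
  moreover have "HH B n \<cong>\<^sub>v direct_sum I (\<lambda>i. HH (group_algebra (loop_group G (x i))) n)"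
    "HH_nonunital B n \<cong>\<^sub>v direct_sum I (\<lambda>i. HH (group_algebra (loop_group G (x i))) n)" for n
  proof -
    obtain q where q: "presents (direct_sum I (\<lambda>i. HH (group_algebra (loop_group G (x i)) :: ('k, 'm \<Rightarrow>\<^sub>0 'k) module) n))
        (hhZ Y n) (hhB Y n) q"
      using presents_HH_sum[OF partial_semigroup_gok based_group_algebra dis] unfolding Y by blast
    show "HH B n \<cong>\<^sub>v direct_sum I (\<lambda>i. HH (group_algebra (loop_group G (x i))) n)"
      using retract_HH[OF based_algebra.presents_HH_words[OF based_groupoid_algebra] q] assms(4) by simp
    obtain q' where "presents (HH_nonunital B n) (hhZ Wall n) (unitB n) q'"
      using presents_HH_nonunital[of n] assms(4) unfolding unitB_def by blast
    from unit_retract[OF this q]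
    show "HH_nonunital B n \<cong>\<^sub>v direct_sum I (\<lambda>i. HH (group_algebra (loop_group G (x i))) n)" .
  qed
  ultimately show ?thesis by simp
qed

end
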